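(* Let $0<\epsilon<1$ and let $f\in C^{k}([0,1]\times\mathbb{R})$, $k\geqslant 2$, with $\frac{\partial f}{\partial y}\geqslant m>0$ on $[0,1]\times\mathbb{R}$ ($m$ constant). Let $y$ be the solution of $\epsilon^2y''(x)=f(x,y(x))$ on $[0,1]$, $y(0)=y(1)=0$. Let $N$ be divisible by $4$, $q=1/4$, and assume $\lambda:=\frac{2\epsilon}{\sqrt{m}}\ln N\leqslant q$ and $\epsilon\leqslant C_0/N$ for a constant $C_0$. Let the mesh be $x_i=\varphi(i/N)$, $i=0,\dots,N$, where $$\varphi(t)=\begin{cases}\frac{\lambda}{q}t, & t\in[0,q],\\ p(t-q)^3+\frac{\lambda}{q}t, & t\in[q,1/2],\\ 1-\varphi(1-t), & t\in[1/2,1],\end{cases}\qquad p=\tfrac12\big(1-\tfrac{\lambda}{q}\big)\big(\tfrac12-q\big)^{-3},$$ and $h_i=x_{i+1}-x_i$. Let $\gamma$ be a constant with $\gamma\geqslant\frac{\partial f}{\partial y}$ on $[0,1]\times\mathbb{R}$, $\beta=\sqrt\gamma/\epsilon$, and for $i=1,\dots,N$ let $a_i=1/\sinh(\beta h_{i-1})$, $d_i=1/\tanh(\beta h_{i-1})$, $\Delta d_i=d_i-a_i$. Let $\overline{y}=(\overline{y}_0,\dots,\overline{y}_N)^T$ be the solution of $\overline{y}_0=\overline{y}_N=0$ and, for $i=1,\dots,N-1$, $$\frac{\gamma}{\Delta d_i+\Delta d_{i+1}}\Big[(3a_i+d_i+\Delta d_{i+1})(\overline{y}_{i-1}-\overline{y}_i)-(3a_{i+1}+d_{i+1}+\Delta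 d_i)(\overline{y}_i-\overline{y}_{i+1})$$ $$\qquad -\frac{f(x_{i-1},\overline{y}_{i-1})+2f(x_i,\overline{y}_i)+f(x_{i+1},\overline{y}_{i+1})}{\gamma}(\Delta d_i+\Delta d_{i+1})\Big]=0.$$ Then the scheme is uniformly convergent with respect to $\epsilon$: there is a constant $C>0$ independent of $N$ and $\epsilon$ such that $$|y(x_i)-\overline{y}_i|\leqslant\begin{cases} C\dfrac{\ln^2N}{N^2}, & i=0,\dots,\frac N4-1,\\[2mm] C\dfrac{1}{N^2}, & i=\frac N4,\dots,\frac{3N}{4},\\[2mm] C\dfrac{\ln^2N}{N^2}, & i=\frac{3N}{4}+1,\dots,N.\end{cases}$$
   Context: The mesh is a smoothed (modified) Shishkin mesh with transition point $\lambda$, refined in the boundary layers near $x=0$ and $x=1$. Constants $C$ are independent of $N$ and $\epsilon$. *)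

theory Defs
  imports "HOL-Analysis.Analysis"
begin

fun Ck_on :: "nat \<Rightarrow> (real \<times> real) set \<Rightarrow> (real \<times> real \<Rightarrow> real) \<Rightarrow> bool" where
  "Ck_on 0 S g = continuous_on S g"
| "Ck_on (Suc k) S g =
     (\<exists>gx gy. (\<forall>p\<in>S. (g has_derivative (\<lambda>(u,v). gx p * u + gy p * v)) (at p within S))
              \<and> Ck_on k S gx \<and> Ck_on k S gy)"

definition q_mesh :: real where "q_mesh = 1/4"

definition p_mesh :: "real \<Rightarrow> real" where
  "p_mesh lam = (1/2) * (1 - lam / q_mesh) * (1/2 - q_mesh) powr (-3)"

definition phi0 :: "real \<Rightarrow> real \<Rightarrow> real" where
  "phi0 lam t = (if t \<le> q_mesh then lam / q_mesh * t
                 else p_mesh lam * (t - q_mesh)^3 + lam / q_mesh * t)"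

definition phi_mesh :: "real \<Rightarrow> real \<Rightarrow> real" where
  "phi_mesh lam t = (if t \<le> 1/2 then phi0 lam t else 1 - phi0 lam (1 - t))"

definition lam_mesh :: "real \<Rightarrow> real \<Rightarrow> nat \<Rightarrow> real" where
  "lam_mesh m eps N = 2 * eps / sqrt m * ln (real N)"

definition xm :: "real \<Rightarrow> real \<Rightarrow> nat \<Rightarrow> nat \<Rightarrow> real" where
  "xm m eps N i = phi_mesh (lam_mesh m eps N) (real i / real N)"

definition hm :: "real \<Rightarrow> real \<Rightarrow> nat \<Rightarrow> nat \<Rightarrow> real" where
  "hm m eps N i = xm m eps N (i + 1) - xm m eps N i"

definition am :: "real \<Rightarrow> real \<Rightarrow> real \<Rightarrow> nat \<Rightarrow> nat \<Rightarrow> real" where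
  "am gam m eps N i = 1 / sinh (sqrt gam / eps * hm m eps N (i - 1))"

definition dm :: "real \<Rightarrow> real \<Rightarrow> real \<Rightarrow> nat \<Rightarrow> nat \<Rightarrow> real" where
  "dm gam m eps N i = 1 / tanh (sqrt gam / eps * hm m eps N (i - 1))"

definition Ddm :: "real \<Rightarrow> real \<Rightarrow> real \<Rightarrow> nat \<Rightarrow> nat \<Rightarrow> real" where
  "Ddm gam m eps N i = dm gam m eps N i - am gam m eps N i"

end

theory Submission
  imports Defs
begin

text \<open>
  Since \<open>d_i - a_i = tanh (\<beta> h_{i-1} / 2)\<close>, the scheme says that a three-point operator applied to
  the discrete solution equals \<open>(f_{i-1} + 2 f_i + f_{i+1}) / \<gamma>\<close>, and \<open>f_y \<le> \<gamma>\<close> makes its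
  linearisation an M-matrix, so errors are controlled by barrier functions.

  Let \<open>z\<close> be the solution of the reduced equation \<open>f (x, z x) = 0\<close> and
  \<open>E x = exp (- sqrt m x / \<epsilon>) + exp (- sqrt m (1 - x) / \<epsilon>)\<close>. The maximum principle gives
  \<open>\<bar>y - z\<bar> = O (\<epsilon>\<^sup>2 + E)\<close>, hence \<open>\<epsilon>\<^sup>2 y'' = f (x, y) = O (\<epsilon>\<^sup>2 + E)\<close>, and by differentiating
  the equation twice \<open>\<epsilon>\<^sup>4 y'''' = O (\<epsilon>\<^sup>2 + E)\<close>. Outside the layers \<open>E = O (1 / N\<^sup>2)\<close> by the
  choice of \<open>\<lambda>\<close>, and the local mesh variation is \<open>O (1 / N\<^sup>2)\<close>, which makes the residual
  \<open>O (1 / N\<^sup>2)\<close>; inside the layers the mesh is uniform and fourth-order Taylor expansion gives the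
  residual \<open>O (ln\<^sup>2 N / N\<^sup>2 (\<epsilon>\<^sup>2 + E))\<close>. The error is compared with the barrier
  \<open>K1 / N\<^sup>2 + K2 ln\<^sup>2 N / N\<^sup>2 \<mu> ^ min (i, N - i, N / 4)\<close>, whose last factor dominates \<open>E\<close> and has
  decayed to \<open>O (N powr (- 3 / 2))\<close> at the transition points. That is enough to absorb its kink
  there and to remove the logarithms in the middle of the interval.
\<close>

section \<open>Hyperbolic and Taylor estimates\<close>

text \<open>Outside the layers \<open>h / eps\<close> is unbounded, so a Taylor remainder of
  \<open>y\<close> is usable only when multiplied by a weight of the operator: weight times
  \<open>h^2\<close> is O(eps^2), which cancels the \<open>1 / eps^2\<close> in the bound on
  \<open>y''\<close>. The remaining, unweighted second difference has no such factor; there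
  \<open>y\<close> is exchanged for \<open>z\<close>, whose derivatives are bounded independently of
  \<open>eps\<close>. Operator and right-hand side are then small separately. In the layers neither
  is small: they cancel to leading order and leave a factor \<open>(h / eps)^2\<close>, the source
  of the squared logarithm.

  The barrier faces conflicting demands. To dominate the layer function it must not decay faster per
  step than the exponential, and to be mapped to something strictly negative it must decay at a rate
  slower by a fixed factor. It must not be too slow either: the operator amplifies the kink by about
  \<open>N / ln N\<close>, so that after multiplication by \<open>ln^2 N\<close> the quantity
  \<open>N * ln N * mu ^ n\<close> has to stay bounded.

  Uniformity rests on the order of choices: \<open>z\<close> and the constant of the a priori
  estimates depend on the data of the equation alone and are fixed before \<open>eps\<close>,
  \<open>N\<close> and \<open>y\<close>.\<close>

lemma le_sinh:
  fixes x :: real assumes "0 \<le> x" shows "x \<le> sinh x"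
proof -
  have "(\<lambda>t. sinh t - t) 0 \<le> (\<lambda>t. sinh t - t) x"
    by (rule DERIV_nonneg_imp_nondecreasing[OF assms])
       (auto intro!: exI derivative_eq_intros simp: cosh_real_ge_1)
  then show ?thesis by simp
qed

lemma tanh_le:
  fixes x :: real assumes "0 \<le> x" shows "tanh x \<le> x"
proof -
  have "(\<lambda>t. t - tanh t) 0 \<le> (\<lambda>t. t - tanh t) x"
    by (rule DERIV_nonneg_imp_nondecreasing[OF assms])
       (auto intro!: exI derivative_eq_intros)
  then show ?thesis by simp
qed

text \<open>The difference of the two sides has derivative \<open>2 * t - (tanh t)^2\<close>,
  nonnegative because \<open>tanh t\<close> is at most both 1 and \<open>t\<close>. The quadratic
  loss is affordable later since it is multiplied by \<open>N\<close> at an argument of order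
  \<open>ln N / N\<close>.\<close>

lemma tanh_ge_quadratic:
  fixes x :: real assumes "0 \<le> x" shows "x - x\<^sup>2 \<le> tanh x"
proof -
  have sq: "(tanh t)\<^sup>2 \<le> 2 * t" if "0 \<le> t" for t :: real
  proof -
    have "tanh t * tanh t \<le> tanh t * 1"
      using that tanh_real_lt_1[of t] by (intro mult_left_mono) auto
    then show ?thesis using tanh_le[OF that] that by (simp add: power2_eq_square)
  qed
  have "(\<lambda>t. tanh t - (t - t\<^sup>2)) 0 \<le> (\<lambda>t. tanh t - (t - t\<^sup>2)) x"
    by (rule DERIV_nonneg_imp_nondecreasing[OF assms])
       (auto intro!: exI derivative_eq_intros simp: sq)
  then show ?thesis by simp
qed

text \<open>Concavity of \<open>tanh\<close> on the nonnegative axis together with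
  \<open>tanh 0 = 0\<close>. It lets the barrier rate, built from \<open>kap * tanh s\<close>, be
  compared with the rate of the layer exponential.\<close>

lemma tanh_scale_ge:
  fixes c x :: real assumes "0 \<le> c" "c \<le> 1" "0 \<le> x"
  shows "c * tanh x \<le> tanh (c * x)"
proof -
  have "(\<lambda>t. tanh (c * t) - c * tanh t) 0 \<le> (\<lambda>t. tanh (c * t) - c * tanh t) x"
  proof (rule DERIV_nonneg_imp_nondecreasing[OF assms(3)], intro exI conjI)
    fix t :: real assume "0 \<le> t"
    show "((\<lambda>t. tanh (c * t) - c * tanh t) has_real_derivative
            (1 - (tanh (c * t))\<^sup>2) * c - c * (1 - (tanh t)\<^sup>2)) (at t)"
      by (auto intro!: derivative_eq_intros)
    have "c * t \<le> 1 * t" using assms \<open>0 \<le> t\<close> by (intro mult_right_mono) auto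
    then have "(tanh (c * t))\<^sup>2 \<le> (tanh t)\<^sup>2"
      using assms \<open>0 \<le> t\<close> by (intro power_mono) auto
    then have "0 \<le> c * ((tanh t)\<^sup>2 - (tanh (c * t))\<^sup>2)" using assms by simp
    then show "0 \<le> (1 - (tanh (c * t))\<^sup>2) * c - c * (1 - (tanh t)\<^sup>2)"
      by (simp add: algebra_simps)
  qed
  then show ?thesis by simp
qed

lemma cosh_minus_one_half: "cosh z - 1 = 2 * (sinh (z / 2))\<^sup>2" for z :: real
  using cosh_double_cosh[of "z/2"] cosh_square_eq[of "z/2"] by simp

lemma sinh_half: "sinh z = 2 * sinh (z / 2) * cosh (z / 2)" for z :: real
  using sinh_double[of "z/2"] by simp

lemma sinh_mult_tanh_half: "sinh z * tanh (z / 2) = 2 * (sinh (z / 2))\<^sup>2" for z :: real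
  by (simp add: sinh_half[of z] tanh_def power2_eq_square)

lemma coth_minus_csch:
  fixes z :: real assumes "z \<noteq> 0"
  shows "1 / tanh z - 1 / sinh z = tanh (z / 2)"
proof -
  have "sinh z \<noteq> 0" using assms by simp
  then have "1 / tanh z - 1 / sinh z = (cosh z - 1) / sinh z"
    by (simp add: tanh_def field_simps)
  also have "\<dots> = tanh (z / 2)"
    using sinh_mult_tanh_half[of z] cosh_minus_one_half[of z] \<open>sinh z \<noteq> 0\<close>
    by (simp add: field_simps)
  finally show ?thesis .
qed

text \<open>The derivative of \<open>z / sinh z\<close> is bounded by \<open>tanh (z / 2)\<close>: after clearing
  denominators this is \<open>z \<le> sinh z\<close>.\<close>

lemma csch_quotient_diff:
  fixes a b D :: real
  assumes "0 < a" "0 < b" "tanh (a / 2) \<le> D" "tanh (b / 2) \<le> D"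
  shows "\<bar>b / sinh b - a / sinh a\<bar> \<le> D * \<bar>b - a\<bar>"
proof -
  let ?g' = "\<lambda>z::real. (sinh z - z * cosh z) / (sinh z)\<^sup>2"
  have bound: "norm (?g' z) \<le> D" if z: "z \<in> closed_segment a b" for z
  proof -
    have "min a b \<le> z" "z \<le> max a b" using z by (auto simp: closed_segment_eq_real_ivl split: if_splits)
    then have "0 < z" and "tanh (z / 2) \<le> D"
      using assms by (auto simp: min_def max_def split: if_splits intro: order_trans[rotated])
    have s: "0 < sinh z" using \<open>0 < z\<close> by simp
    have "sinh z \<le> z * cosh z"
      using tanh_le[of z] \<open>0 < z\<close> by (simp add: tanh_def field_simps)
    moreover have "z * cosh z - sinh z \<le> tanh (z / 2) * (sinh z)\<^sup>2"
    proof -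
      have "tanh (z / 2) * (sinh z)\<^sup>2 = (cosh z - 1) * sinh z"
        using sinh_mult_tanh_half[of z] cosh_minus_one_half[of z]
        by (simp add: power2_eq_square mult.commute)
      moreover have "z * cosh z \<le> sinh z * cosh z"
        using le_sinh[of z] \<open>0 < z\<close> by (intro mult_right_mono) auto
      ultimately show ?thesis by (simp add: algebra_simps)
    qed
    ultimately have "\<bar>?g' z\<bar> \<le> tanh (z / 2)"
      using s by (simp add: abs_if field_simps)
    then show ?thesis using \<open>tanh (z / 2) \<le> D\<close> by simp
  qed
  have "norm (b / sinh b - a / sinh a) \<le> D * norm (b - a)"
  proof (rule field_differentiable_bound[where S = "closed_segment a b" and f' = ?g'])
    fix z assume "z \<in> closed_segment a b"
    then have "z \<noteq> 0" using assms by (auto simp: closed_segment_eq_real_ivl split: if_splits)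
    then show "((\<lambda>z. z / sinh z) has_real_derivative ?g' z) (at z within closed_segment a b)"
      by (auto intro!: derivative_eq_intros simp: power2_eq_square)
  qed (use bound in auto)
  then show ?thesis by simp
qed

lemma csch_quotient_bounds:
  fixes z :: real assumes "0 < z" shows "0 \<le> z / sinh z" "z / sinh z \<le> 1"
  using le_sinh[of z] assms by auto

lemma ln_le_sqrt:
  fixes x :: real assumes "1 \<le> x" shows "ln x \<le> 2 * sqrt x"
proof -
  have "ln x = 2 * ln (sqrt x)" using assms by (simp add: ln_sqrt)
  also have "\<dots> \<le> 2 * sqrt x" using ln_bound[of "sqrt x"] assms by simp
  finally show ?thesis .
qed

text \<open>For \<open>r < 1\<close> the fraction is exp (-2 artanh r), so this is
  \<open>r <= artanh r\<close> in disguise. Together with the next lemma it encloses the barrier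
  ratio \<open>mu\<close> between exponentials.\<close>

lemma moebius_le_exp:
  fixes r :: real assumes "0 \<le> r" shows "(1 - r) / (1 + r) \<le> exp (- 2 * r)"
proof -
  have "(1 - exp (- 2 * r)) / (1 + exp (- 2 * r)) \<le> r"
    using tanh_le[OF assms] by (simp add: tanh_real_altdef)
  then have "1 - exp (- 2 * r) \<le> r * (1 + exp (- 2 * r))"
    by (simp add: pos_divide_le_eq add_pos_pos)
  then show ?thesis using assms by (simp add: field_simps)
qed

lemma exp_le_moebius:
  fixes r t :: real assumes "0 \<le> r" "r \<le> tanh t" shows "exp (- 2 * t) \<le> (1 - r) / (1 + r)"
proof -
  have "r * (1 + exp (- 2 * t)) \<le> 1 - exp (- 2 * t)"
    using assms(2) by (simp add: tanh_real_altdef pos_le_divide_eq add_pos_pos)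
  then show ?thesis using assms by (simp add: field_simps)
qed

section \<open>Taylor remainders and the continuous maximum principle\<close>

lemma second_order_Taylor_bound:
  fixes g g' g'' :: "real \<Rightarrow> real"
  assumes "convex S" and "\<And>x. x \<in> S \<Longrightarrow> (g has_real_derivative g' x) (at x within S)"
    and "\<And>x. x \<in> S \<Longrightarrow> (g' has_real_derivative g'' x) (at x within S)"
    and "\<And>x. x \<in> S \<Longrightarrow> \<bar>g'' x\<bar> \<le> B" and "w \<in> S" "z \<in> S"
  shows "\<bar>g z - g w - g' w * (z - w)\<bar> \<le> B * (z - w)\<^sup>2"
proof -
  let ?f = "\<lambda>i. [g, g', g''] ! i"
  \<comment> \<open>The remainder is divided by \<open>fact 1\<close>, not by 2, so the constant is
    not sharp; only its order matters. The same holds for the fourth-order bound with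
    \<open>fact 3\<close>.\<close>
  have "norm (?f 0 z - (\<Sum>i\<le>1. ?f i w * (z - w) ^ i / fact i)) \<le> B * norm (z - w) ^ Suc 1 / fact 1"
    by (rule field_Taylor[OF assms(1)]) (use assms in \<open>auto simp: le_Suc_eq\<close>)
  then show ?thesis by (simp add: algebra_simps power2_eq_square)
qed

lemma fourth_order_Taylor_bound:
  fixes g0 g1 g2 g3 g4 :: "real \<Rightarrow> real"
  assumes "convex S" and "\<And>x. x \<in> S \<Longrightarrow> (g0 has_real_derivative g1 x) (at x within S)"
    and "\<And>x. x \<in> S \<Longrightarrow> (g1 has_real_derivative g2 x) (at x within S)"
    and "\<And>x. x \<in> S \<Longrightarrow> (g2 has_real_derivative g3 x) (at x within S)"
    and "\<And>x. x \<in> S \<Longrightarrow> (g3 has_real_derivative g4 x) (at x within S)"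
    and "\<And>x. x \<in> S \<Longrightarrow> \<bar>g4 x\<bar> \<le> B" and "w \<in> S" "z \<in> S"
  shows "\<bar>g0 z - (g0 w + g1 w * (z - w) + g2 w * (z - w)\<^sup>2 / 2 + g3 w * (z - w) ^ 3 / 6)\<bar>
         \<le> B * (z - w) ^ 4 / 6"
proof -
  let ?f = "\<lambda>i. [g0, g1, g2, g3, g4] ! i"
  have "norm (?f 0 z - (\<Sum>i\<le>3. ?f i w * (z - w) ^ i / fact i)) \<le> B * norm (z - w) ^ Suc 3 / fact 3"
    by (rule field_Taylor[OF assms(1)])
       (use assms in \<open>auto simp: le_Suc_eq numeral_3_eq_3\<close>)
  then show ?thesis
    by (simp add: numeral_eq_Suc fact_numeral algebra_simps)
qed

text \<open>On unequal steps the first-order terms do not cancel; they are kept explicitly so that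
  the small mesh variation \<open>hr - hl\<close> can be used.\<close>

lemma centered_second_difference:
  fixes g g' g'' :: "real \<Rightarrow> real"
  assumes "convex S" and "\<And>x. x \<in> S \<Longrightarrow> (g has_real_derivative g' x) (at x within S)"
    and "\<And>x. x \<in> S \<Longrightarrow> (g' has_real_derivative g'' x) (at x within S)"
    and "\<And>x. x \<in> S \<Longrightarrow> \<bar>g'' x\<bar> \<le> B" and "x \<in> S" "x - hl \<in> S" "x + hr \<in> S"
  shows "\<bar>g (x - hl) - 2 * g x + g (x + hr) - (hr - hl) * g' x\<bar> \<le> B * (hl\<^sup>2 + hr\<^sup>2)"
proof -
  have "\<bar>g (x - hl) - g x - g' x * (x - hl - x)\<bar> \<le> B * (x - hl - x)\<^sup>2"
    and "\<bar>g (x + hr) - g x - g' x * (x + hr - x)\<bar> \<le> B * (x + hr - x)\<^sup>2"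
    using assms by (intro second_order_Taylor_bound[where S = S and g'' = g'']; auto)+
  then show ?thesis by (simp add: algebra_simps abs_le_iff)
qed

text \<open>A positive maximum would be interior, with vanishing slope and positive second
  derivative, which is absurd. Convexity is demanded only where \<open>w\<close> is positive,
  because only there does the lower bound on the reaction slope act in the right direction.\<close>

lemma second_order_maximum_principle:
  fixes w w' w'' :: "real \<Rightarrow> real"
  assumes w: "\<And>x. x \<in> {0..1} \<Longrightarrow> (w has_real_derivative w' x) (at x within {0..1})"
    and w': "\<And>x. x \<in> {0..1} \<Longrightarrow> (w' has_real_derivative w'' x) (at x within {0..1})"
    and "w 0 \<le> 0" "w 1 \<le> 0"
    and pos: "\<And>x. x \<in> {0<..<1} \<Longrightarrow> 0 < w x \<Longrightarrow> 0 < w'' x"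
    and "x \<in> {0..1}"
  shows "w x \<le> 0"
proof (rule ccontr)
  assume neg: "\<not> w x \<le> 0"
  have "continuous_on {0..1} w"
    using w by (meson DERIV_continuous continuous_on_eq_continuous_within)
  then obtain c where c: "c \<in> {0..1}" "\<forall>t\<in>{0..1}. w t \<le> w c"
    using continuous_attains_sup[of "{0..1::real}" w] by fastforce
  have wc: "0 < w c" using c neg \<open>x \<in> {0..1}\<close> by force
  then have ci: "c \<in> {0<..<1}" using c assms(3,4) by (cases "c = 0"; cases "c = 1") auto
  have at: "at t within {0..1} = at t" if "t \<in> {0<..<1}" for t :: real
    using that by (simp add: at_within_Icc_at)
  have d0: "(w has_real_derivative w' c) (at c)" and d1: "(w' has_real_derivative w'' c) (at c)"
    using w[of c] w'[of c] ci at[of c] c by auto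
  have "w' c = 0"
  proof (rule DERIV_local_max[OF d0, of "min c (1 - c)"])
    show "\<forall>t. \<bar>c - t\<bar> < min c (1 - c) \<longrightarrow> w t \<le> w c" using c by (auto simp: abs_if split: if_splits)
  qed (use ci in auto)
  \<comment> \<open>Positive second derivative at \<open>c\<close> and slope zero there make
    \<open>w'\<close> positive just to the right, so the mean value theorem yields a larger value
    than the maximum.\<close>
  obtain d where d: "d > 0" "\<forall>h>0. h < d \<longrightarrow> w' c < w' (c + h)"
    using DERIV_pos_inc_right[OF d1] pos[OF ci wc] by auto
  define t where "t = min d (1 - c) / 2"
  have t: "0 < t" "t < d" "c + t < 1" using d ci by (auto simp: t_def min_def field_simps)
  have "\<exists>z. c < z \<and> z < c + t \<and> w (c + t) - w c = (c + t - c) * w' z"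
  proof (rule MVT2)
    fix z assume "c \<le> z" "z \<le> c + t"
    then have "z \<in> {0<..<1}" using ci t by auto
    then show "(w has_real_derivative w' z) (at z)" using w[of z] at[of z] by auto
  qed (use t in auto)
  then obtain z where z: "c < z" "z < c + t" "w (c + t) - w c = t * w' z" by auto
  have "0 < w' z" using d(2)[rule_format, of "z - c"] z t \<open>w' c = 0\<close> by auto
  then have "w c < w (c + t)" using z t mult_pos_pos[of t "w' z"] by linarith
  then show False using c t ci by (smt (verit) atLeastAtMost_iff greaterThanLessThan_iff)
qed


section \<open>The reduced problem\<close>

lemma Ck_on_SucD: "Ck_on (Suc k) S g \<Longrightarrow> Ck_on k S g"
proof (induction k arbitrary: g)
  case 0
  then show ?case
    by (auto simp: continuous_on_eq_continuous_within dest!: bspec dest: has_derivative_continuous)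
next
  case (Suc k)
  obtain gx gy where
    "\<forall>p\<in>S. (g has_derivative (\<lambda>(u,v). gx p * u + gy p * v)) (at p within S)"
    "Ck_on (Suc k) S gx" "Ck_on (Suc k) S gy"
    using Suc.prems unfolding Ck_on.simps(2)[of "Suc k"] by blast
  then show ?case using Suc.IH unfolding Ck_on.simps(2)[of k] by blast
qed

lemma Ck_on_le: "j \<le> k \<Longrightarrow> Ck_on k S g \<Longrightarrow> Ck_on j S g"
  by (induction rule: inc_induct) (auto dest: Ck_on_SucD simp del: Ck_on.simps)

abbreviation (input) strip :: "(real \<times> real) set" where "strip \<equiv> {0..1} \<times> UNIV"

lemma derivative_along_graph:
  fixes g :: "real \<times> real \<Rightarrow> real" and y :: "real \<Rightarrow> real"
  assumes "(g has_derivative (\<lambda>(u,v). gx * u + gy * v)) (at (x, y x) within strip)"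
    and "(y has_real_derivative y') (at x within {0..1})"
  shows "((\<lambda>t. g (t, y t)) has_real_derivative gx + gy * y') (at x within {0..1})"
proof -
  have "((\<lambda>t. (t, y t)) has_derivative (\<lambda>t. (t, t * y'))) (at x within {0..1})"
    using assms(2) unfolding has_field_derivative_def
    by (auto intro!: derivative_eq_intros simp: mult.commute)
  moreover have "(g has_derivative (\<lambda>(u,v). gx * u + gy * v))
      (at (x, y x) within (\<lambda>t. (t, y t)) ` {0..1})"
    by (rule has_derivative_subset[OF assms(1)]) auto
  ultimately have "((\<lambda>t. g (t, y t)) has_derivative
      (\<lambda>t. (\<lambda>(u,v). gx * u + gy * v) (t, t * y'))) (at x within {0..1})"
    by (rule has_derivative_in_compose)
  then show ?thesis
    unfolding has_field_derivative_def by (rule has_derivative_eq_rhs) (auto simp: algebra_simps)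
qed

text \<open>The vertical fibre lies entirely in the strip, so the derivative in the second variable
  is two-sided even over \<open>x = 0\<close> and \<open>x = 1\<close>. This identifies
  \<open>fy\<close> with the \<open>deriv\<close> in the hypotheses of the theorem.\<close>

lemma derivative_along_fibre:
  fixes g :: "real \<times> real \<Rightarrow> real"
  assumes "(g has_derivative (\<lambda>(u,v). gx * u + gy * v)) (at (x, v) within strip)" "x \<in> {0..1}"
  shows "((\<lambda>t. g (x, t)) has_real_derivative gy) (at v)"
proof -
  have "((\<lambda>t. (x, t)) has_derivative (\<lambda>t. (0, t))) (at v)"
    by (auto intro!: derivative_eq_intros)
  moreover have "(g has_derivative (\<lambda>(u,v). gx * u + gy * v)) (at (x, v) within range (\<lambda>t. (x, t)))"
    by (rule has_derivative_subset[OF assms(1)]) (use assms(2) in auto)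
  ultimately have "((\<lambda>t. g (x, t)) has_derivative (\<lambda>t. (\<lambda>(u,v). gx * u + gy * v) (0, t))) (at v)"
    by (rule has_derivative_in_compose)
  then show ?thesis unfolding has_field_derivative_def by simp
qed

lemma continuous_on_strip_bounded:
  fixes g :: "real \<times> real \<Rightarrow> real"
  assumes "continuous_on strip g"
  obtains B where "0 < B" "\<And>x v. x \<in> {0..1} \<Longrightarrow> \<bar>v\<bar> \<le> R \<Longrightarrow> \<bar>g (x, v)\<bar> \<le> B"
proof -
  have "compact (g ` ({0..1} \<times> {-R..R}))"
    by (intro compact_continuous_image compact_Times continuous_on_subset[OF assms]) auto
  then obtain B where "0 < B" "\<forall>p\<in>{0..1} \<times> {-R..R}. \<bar>g p\<bar> \<le> B"
    using compact_imp_bounded bounded_pos by (metis image_eqI real_norm_def)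
  then show ?thesis by (intro that[of B]) (auto simp: abs_le_iff)
qed

lemma continuous_on_unit_interval_bounded:
  fixes g :: "real \<Rightarrow> real"
  assumes "continuous_on {0..1} g"
  obtains B where "0 < B" "\<And>x. x \<in> {0..1} \<Longrightarrow> \<bar>g x\<bar> \<le> B"
proof -
  have "compact (g ` {0..1})" by (intro compact_continuous_image assms) auto
  then obtain B where "0 < B" "\<forall>p\<in>{0..1}. \<bar>g p\<bar> \<le> B"
    using compact_imp_bounded bounded_pos by (metis image_eqI real_norm_def)
  then show ?thesis by (intro that[of B]) auto
qed

section \<open>The boundary layer function\<close>

definition layer :: "real \<Rightarrow> real \<Rightarrow> real \<Rightarrow> real" where
  "layer m eps x = exp (- (sqrt m * x / eps)) + exp (- (sqrt m * (1 - x) / eps))"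

lemma layer_pos: "0 < layer m eps x"
  by (simp add: layer_def add_pos_pos)

lemma layer_le_2:
  assumes "0 < eps" "0 \<le> m" "x \<in> {0..1}" shows "layer m eps x \<le> 2"
proof -
  have "exp (- (sqrt m * x / eps)) \<le> 1" "exp (- (sqrt m * (1 - x) / eps)) \<le> 1"
    using assms by auto
  then show ?thesis unfolding layer_def by linarith
qed

text \<open>Moving by a distance of order \<open>eps\<close> costs only a constant factor. It is
  applied with distance \<open>eps / 2\<close> in the derivative bound and with one fine mesh step
  in the layers.\<close>

lemma layer_shift:
  assumes "0 < eps" "0 \<le> m" "\<bar>x - z\<bar> \<le> d"
  shows "layer m eps z \<le> exp (sqrt m * d / eps) * layer m eps x"
proof -
  have "sqrt m * (x - z) / eps \<le> sqrt m * d / eps" "sqrt m * (z - x) / eps \<le> sqrt m * d / eps"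
    using assms by (auto intro!: divide_right_mono mult_left_mono)
  then have "exp (- (sqrt m * z / eps)) \<le> exp (sqrt m * d / eps + - (sqrt m * x / eps))"
    "exp (- (sqrt m * (1 - z) / eps)) \<le> exp (sqrt m * d / eps + - (sqrt m * (1 - x) / eps))"
    by (simp_all add: diff_divide_distrib right_diff_distrib)
  then show ?thesis unfolding layer_def exp_add distrib_left by linarith
qed

section \<open>Monotone reaction terms and the smoothness of the reduced solution\<close>

locale reaction_term =
  fixes f fx fy fxx fxy fyx fyy :: "real \<times> real \<Rightarrow> real" and m gam :: real
  assumes f_deriv: "p \<in> strip \<Longrightarrow> (f has_derivative (\<lambda>(u,v). fx p * u + fy p * v)) (at p within strip)"
    and fx_deriv: "p \<in> strip \<Longrightarrow> (fx has_derivative (\<lambda>(u,v). fxx p * u + fxy p * v)) (at p within strip)"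
    and fy_deriv: "p \<in> strip \<Longrightarrow> (fy has_derivative (\<lambda>(u,v). fyx p * u + fyy p * v)) (at p within strip)"
    and cont2: "continuous_on strip fxx" "continuous_on strip fxy"
      "continuous_on strip fyx" "continuous_on strip fyy"
    and m_pos: "0 < m"
    and fy_bounds: "p \<in> strip \<Longrightarrow> m \<le> fy p" "p \<in> strip \<Longrightarrow> fy p \<le> gam"
begin

lemma gam_pos: "0 < gam"
  using fy_bounds[of "(0,0)"] m_pos by auto

lemma m_le_gam: "m \<le> gam"
  using fy_bounds[of "(0,0)"] by auto

lemma cont: "continuous_on strip f" "continuous_on strip fx" "continuous_on strip fy"
  unfolding continuous_on_eq_continuous_within
  by (blast intro: has_derivative_continuous f_deriv fx_deriv fy_deriv)+

text \<open>The exact linearisation by the mean value theorem. It turns both the differential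
  equation for \<open>y - z\<close> and the discrete error equation into linear ones with
  coefficient between \<open>m\<close> and \<open>gam\<close>.\<close>

lemma difference_quotient:
  assumes "x \<in> {0..1}"
  obtains c where "m \<le> c" "c \<le> gam" "f (x, v) - f (x, w) = c * (v - w)"
proof -
  have d: "((\<lambda>t. f (x, t)) has_real_derivative fy (x, t)) (at t)" for t
    by (rule derivative_along_fibre[OF f_deriv]) (use assms in auto)
  have "\<exists>c. m \<le> c \<and> c \<le> gam \<and> f (x, b) - f (x, a) = c * (b - a)" if "a < b" for a b
  proof -
    have "\<exists>z>a. z < b \<and> f (x, b) - f (x, a) = (b - a) * fy (x, z)"
      by (rule MVT2[OF that]) (use d in auto)
    then show ?thesis using fy_bounds assms by (metis SigmaI UNIV_I mult.commute)
  qed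
  note quotient = this
  have "\<exists>c. m \<le> c \<and> c \<le> gam \<and> f (x, v) - f (x, w) = c * (v - w)"
  proof (cases v w rule: linorder_cases)
    case less
    then obtain c where "m \<le> c" "c \<le> gam" "f (x, w) - f (x, v) = c * (w - v)"
      using quotient by metis
    then show ?thesis by (intro exI[of _ c]) (auto simp: algebra_simps)
  qed (use quotient m_le_gam in auto)
  then show thesis using that by blast
qed

text \<open>Slope at least \<open>m\<close> forces \<open>f (x, v)\<close> to change sign between
  \<open>-R\<close> and \<open>R\<close> with \<open>R = |f (x, 0)| / m\<close>; the intermediate
  value theorem does the rest.\<close>

lemma reduced_solution_exists:
  assumes "x \<in> {0..1}"
  shows "\<exists>v. f (x, v) = 0 \<and> \<bar>v\<bar> \<le> \<bar>f (x, 0)\<bar> / m"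
proof -
  define R where "R = \<bar>f (x, 0)\<bar> / m"
  have R: "0 \<le> R" "m * R = \<bar>f (x, 0)\<bar>" using m_pos by (auto simp: R_def)
  have mono: "m * R \<le> c * R" if "m \<le> c" for c using that R by (intro mult_right_mono) auto
  obtain c where c: "m \<le> c" "f (x, R) - f (x, 0) = c * (R - 0)"
    using difference_quotient[OF assms] by metis
  obtain c' where c': "m \<le> c'" "f (x, 0) - f (x, -R) = c' * (0 - - R)"
    using difference_quotient[OF assms] by metis
  have "f (x, -R) \<le> 0" "0 \<le> f (x, R)" using mono[OF c(1)] mono[OF c'(1)] c c' R by auto
  moreover have "continuous_on {-R..R} (\<lambda>v. f (x, v))"
    by (rule continuous_on_compose2[OF cont(1)]) (use assms in \<open>auto intro!: continuous_intros\<close>)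
  ultimately obtain v where "-R \<le> v" "v \<le> R" "f (x, v) = 0"
    using IVT'[of "\<lambda>v. f (x, v)" "-R" 0 R] R by auto
  then show ?thesis unfolding R_def by auto
qed

text \<open>A global implicit function argument: the slope bound \<open>m\<close> makes
  \<open>z\<close> Lipschitz, this upgrades to differentiability with \<open>z' = - fx / fy\<close>,
  the quotient rule gives \<open>z''\<close>, and compactness of the interval bounds all
  three.\<close>

lemma reduced_solution_smooth:
  obtains K :: real and z z' z'' :: "real \<Rightarrow> real" where "0 < K"
    "\<And>x. x \<in> {0..1} \<Longrightarrow> f (x, z x) = 0"
    "\<And>x. x \<in> {0..1} \<Longrightarrow> (z has_real_derivative z' x) (at x within {0..1})"
    "\<And>x. x \<in> {0..1} \<Longrightarrow> (z' has_real_derivative z'' x) (at x within {0..1})"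
    "\<And>x. x \<in> {0..1} \<Longrightarrow> \<bar>z x\<bar> \<le> K \<and> \<bar>z' x\<bar> \<le> K \<and> \<bar>z'' x\<bar> \<le> K"
proof -
  obtain z where z: "\<And>x. x \<in> {0..1} \<Longrightarrow> f (x, z x) = 0 \<and> \<bar>z x\<bar> \<le> \<bar>f (x, 0)\<bar> / m"
    using reduced_solution_exists by metis
  obtain B0 where B0: "\<And>x v. x \<in> {0..1} \<Longrightarrow> \<bar>v\<bar> \<le> 0 \<Longrightarrow> \<bar>f (x, v)\<bar> \<le> B0"
    by (rule continuous_on_strip_bounded[OF cont(1)]) blast
  define R where "R = B0 / m"
  have zR: "\<bar>z x\<bar> \<le> R" if "x \<in> {0..1}" for x
    using z[OF that] B0[of x 0] that m_pos divide_right_mono[of "\<bar>f (x, 0)\<bar>" B0 m] by (auto simp: R_def)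
  obtain B1 where B1: "0 < B1" "\<And>x v. x \<in> {0..1} \<Longrightarrow> \<bar>v\<bar> \<le> R \<Longrightarrow> \<bar>fx (x, v)\<bar> \<le> B1"
    by (rule continuous_on_strip_bounded[OF cont(2)]) blast
  define L where "L = B1 / m"
  have L: "0 < L" using B1 m_pos by (simp add: L_def)
  have lip: "\<bar>z t - z x\<bar> \<le> L * \<bar>t - x\<bar>" if "t \<in> {0..1}" "x \<in> {0..1}" for t x
  proof -
    have "norm (f (t, z x) - f (x, z x)) \<le> B1 * norm (t - x)"
    proof (rule field_differentiable_bound[where S = "{0..1}" and f' = "\<lambda>s. fx (s, z x)"])
      fix s :: real assume s: "s \<in> {0..1}"
      have "((\<lambda>s. f (s, (\<lambda>_. z x) s)) has_real_derivative fx (s, z x) + fy (s, z x) * 0)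
          (at s within {0..1})"
        by (rule derivative_along_graph) (use f_deriv[of "(s, z x)"] s in auto)
      then show "((\<lambda>s. f (s, z x)) has_real_derivative fx (s, z x)) (at s within {0..1})" by simp
    qed (use that B1 zR in auto)
    moreover obtain c where c: "m \<le> c" "f (t, z t) - f (t, z x) = c * (z t - z x)"
      using difference_quotient[OF \<open>t \<in> {0..1}\<close>] by metis
    ultimately have "c * \<bar>z t - z x\<bar> \<le> B1 * \<bar>t - x\<bar>"
      using z that m_pos abs_mult[of c "z t - z x"] by auto
    moreover have "m * \<bar>z t - z x\<bar> \<le> c * \<bar>z t - z x\<bar>" using c by (intro mult_right_mono) auto
    ultimately have "m * \<bar>z t - z x\<bar> \<le> B1 * \<bar>t - x\<bar>" by linarith
    then show ?thesis using m_pos by (simp add: L_def field_simps)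
  qed
  define z' where "z' = (\<lambda>x. - fx (x, z x) / fy (x, z x))"
  have fy_pos: "0 < fy (x, v)" if "x \<in> {0..1}" for x v
    using fy_bounds(1)[of "(x,v)"] that m_pos by auto
  have dz: "(z has_real_derivative z' x) (at x within {0..1})" if x: "x \<in> {0..1}" for x
    unfolding has_field_derivative_def has_derivative_within_alt
  proof (intro conjI allI impI)
    fix e :: real assume "0 < e"
    \<comment> \<open>The factor \<open>1 + L\<close> converts distances along the graph into
      distances in \<open>x\<close>, and \<open>m\<close> is lost when dividing by
      \<open>fy\<close>.\<close>
    define e' where "e' = e * m / (1 + L)"
    have e': "0 < e'" "e' * (1 + L) = e * m"
      using \<open>0 < e\<close> m_pos L by (auto simp: e'_def)
    obtain d where d: "d > 0" "\<And>p. p \<in> strip \<Longrightarrow> norm (p - (x, z x)) < d \<Longrightarrow>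
        norm (f p - f (x, z x) - (\<lambda>(u,v). fx (x, z x) * u + fy (x, z x) * v) (p - (x, z x)))
          \<le> e' * norm (p - (x, z x))"
      using f_deriv[of "(x, z x)"] x e' unfolding has_derivative_within_alt by blast
    show "\<exists>d>0. \<forall>t\<in>{0..1}. norm (t - x) < d \<longrightarrow>
        norm (z t - z x - z' x * (t - x)) \<le> e * norm (t - x)"
    proof (intro exI conjI ballI impI)
      show "0 < d / (1 + L)" using d L by simp
      fix t :: real assume t: "t \<in> {0..1}" "norm (t - x) < d / (1 + L)"
      define q where "q = z t - z x"
      have n: "norm ((t, z t) - (x, z x)) \<le> (1 + L) * \<bar>t - x\<bar>"
        using norm_Pair_le[of "t - x" q] lip[OF t(1) x] by (simp add: algebra_simps q_def)
      also have "\<dots> < d" using t L by (simp add: field_simps)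
      finally have "norm ((t, z t) - (x, z x)) < d" .
      \<comment> \<open>\<open>f\<close> vanishes at both points of the graph of \<open>z\<close>,
        so the differentiability remainder reduces to the linear part alone.\<close>
      from d(2)[OF _ this] have "\<bar>fx (x, z x) * (t - x) + fy (x, z x) * q\<bar>
          \<le> e' * norm ((t, z t) - (x, z x))"
        using t z x by (auto simp: q_def)
      also have "\<dots> \<le> e' * ((1 + L) * \<bar>t - x\<bar>)" using n e' by (intro mult_left_mono) auto
      also have "\<dots> = e * m * \<bar>t - x\<bar>" using e' by (metis mult.assoc)
      finally have A: "\<bar>fx (x, z x) * (t - x) + fy (x, z x) * q\<bar> \<le> e * m * \<bar>t - x\<bar>" .
      have "fx (x, z x) * (t - x) + fy (x, z x) * q = fy (x, z x) * (q - z' x * (t - x))"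
        using fy_pos[OF x, of "z x"] by (simp add: z'_def field_simps)
      with A have "fy (x, z x) * \<bar>q - z' x * (t - x)\<bar> \<le> e * m * \<bar>t - x\<bar>"
        using fy_pos[OF x, of "z x"] by (simp add: abs_mult)
      moreover have "m * \<bar>q - z' x * (t - x)\<bar> \<le> fy (x, z x) * \<bar>q - z' x * (t - x)\<bar>"
        using fy_bounds(1)[of "(x, z x)"] x by (intro mult_right_mono) auto
      ultimately have "m * \<bar>q - z' x * (t - x)\<bar> \<le> m * (e * \<bar>t - x\<bar>)"
        by (simp add: mult_ac)
      then show "norm (z t - z x - z' x * (t - x)) \<le> e * norm (t - x)"
        using m_pos by (simp add: q_def)
    qed
  qed (rule bounded_linear_mult_right)
  define z'' where "z'' = (\<lambda>x. (- (fxx (x, z x) + fxy (x, z x) * z' x) * fy (x, z x)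
      + fx (x, z x) * (fyx (x, z x) + fyy (x, z x) * z' x)) / (fy (x, z x) * fy (x, z x)))"
  have dz': "(z' has_real_derivative z'' x) (at x within {0..1})" if x: "x \<in> {0..1}" for x
  proof -
    have a: "((\<lambda>t. fx (t, z t)) has_real_derivative fxx (x, z x) + fxy (x, z x) * z' x) (at x within {0..1})"
      and b: "((\<lambda>t. fy (t, z t)) has_real_derivative fyx (x, z x) + fyy (x, z x) * z' x) (at x within {0..1})"
      using x by (auto intro!: derivative_along_graph fx_deriv fy_deriv dz)
    have "((\<lambda>x. - fx (x, z x) / fy (x, z x)) has_real_derivative z'' x) (at x within {0..1})"
      by (rule DERIV_cong[OF DERIV_divide[OF DERIV_minus[OF a] b]])
         (use fy_pos[OF x, of "z x"] in \<open>auto simp: z''_def\<close>)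
    then show ?thesis by (simp add: z'_def)
  qed
  have cz: "continuous_on {0..1} z" and cz': "continuous_on {0..1} z'"
    using dz dz' by (meson DERIV_continuous continuous_on_eq_continuous_within)+
  have comp: "continuous_on {0..1} (\<lambda>x. g (x, z x))" if "continuous_on strip g" for g :: "real \<times> real \<Rightarrow> real"
    by (rule continuous_on_compose2[OF that]) (auto intro!: continuous_intros cz)
  have cz'': "continuous_on {0..1} z''"
    unfolding z''_def
    by (intro continuous_intros comp cont cont2 cz') (use fy_pos in \<open>auto simp: less_imp_neq[symmetric]\<close>)
  obtain K1 where K1: "0 < K1" "\<And>x. x \<in> {0..1} \<Longrightarrow> \<bar>z x\<bar> \<le> K1"
    by (rule continuous_on_unit_interval_bounded[OF cz]) blast
  obtain K2 where K2: "0 < K2" "\<And>x. x \<in> {0..1} \<Longrightarrow> \<bar>z' x\<bar> \<le> K2"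
    by (rule continuous_on_unit_interval_bounded[OF cz']) blast
  obtain K3 where K3: "0 < K3" "\<And>x. x \<in> {0..1} \<Longrightarrow> \<bar>z'' x\<bar> \<le> K3"
    by (rule continuous_on_unit_interval_bounded[OF cz'']) blast
  show thesis
  proof (rule that[of "K1 + K2 + K3" z z' z''])
    show "\<bar>z x\<bar> \<le> K1 + K2 + K3 \<and> \<bar>z' x\<bar> \<le> K1 + K2 + K3 \<and> \<bar>z'' x\<bar> \<le> K1 + K2 + K3"
      if "x \<in> {0..1}" for x
      using K1(2)[OF that] K2(2)[OF that] K3(2)[OF that] K1(1) K2(1) K3(1) by linarith
  qed (use K1 K2 K3 z dz dz' in auto)
qed

end

section \<open>A priori estimates\<close>

definition bvp_solution ::
  "(real \<times> real \<Rightarrow> real) \<Rightarrow> real \<Rightarrow> (real \<Rightarrow> real) \<Rightarrow> (real \<Rightarrow> real) \<Rightarrow> (real \<Rightarrow> real) \<Rightarrow> bool" where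
  "bvp_solution f eps y y' y'' \<longleftrightarrow>
     (\<forall>x\<in>{0..1}. (y has_real_derivative y' x) (at x within {0..1}) \<and>
                 (y' has_real_derivative y'' x) (at x within {0..1}) \<and>
                 eps\<^sup>2 * y'' x = f (x, y x)) \<and> y 0 = 0 \<and> y 1 = 0"

definition layer_slope :: "real \<Rightarrow> real \<Rightarrow> real \<Rightarrow> real" where
  "layer_slope m eps x =
     sqrt m / eps * (exp (- (sqrt m * (1 - x) / eps)) - exp (- (sqrt m * x / eps)))"

text \<open>In effect \<open>eps^2 * E'' = m * E\<close>: the layer function solves the homogeneous
  constant-coefficient equation, which is what qualifies it as a barrier.\<close>

lemma layer_derivatives:
  assumes "0 \<le> m" "eps \<noteq> 0"
  shows "(layer m eps has_real_derivative layer_slope m eps x) (at x within S)"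
    and "(layer_slope m eps has_real_derivative m / eps\<^sup>2 * layer m eps x) (at x within S)"
proof -
  show "(layer m eps has_real_derivative layer_slope m eps x) (at x within S)"
    unfolding layer_def[abs_def] layer_slope_def using assms(2)
    by (auto intro!: derivative_eq_intros simp: field_simps)
  have "(layer_slope m eps has_real_derivative
      sqrt m / eps * (exp (- (sqrt m * (1 - x) / eps)) * (sqrt m / eps)
        + exp (- (sqrt m * x / eps)) * (sqrt m / eps))) (at x within S)"
    unfolding layer_slope_def[abs_def] using assms(2)
    by (auto intro!: derivative_eq_intros)
  moreover have "sqrt m / eps * (exp (- (sqrt m * (1 - x) / eps)) * (sqrt m / eps)
        + exp (- (sqrt m * x / eps)) * (sqrt m / eps)) = sqrt m / eps * (sqrt m / eps) * layer m eps x"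
    unfolding layer_def by (simp only: distrib_left distrib_right mult_ac add_ac)
  moreover have "sqrt m / eps * (sqrt m / eps) = m / eps\<^sup>2"
    using assms(1) by (simp add: power2_eq_square)
  ultimately show "(layer_slope m eps has_real_derivative m / eps\<^sup>2 * layer m eps x) (at x within S)"
    by (simp only:)
qed

context reaction_term
begin

text \<open>In the barrier the layer part is at least 1 at both ends and covers the boundary
  mismatch \<open>|z| <= K\<close>, while the constant \<open>eps^2\<close> covers the defect
  \<open>eps^2 * z''\<close>. Accordingly \<open>K\<close> and \<open>K / m\<close> are the two
  summands of the constant.\<close>

lemma solution_near_reduced:
  assumes sol: "bvp_solution f eps y y' y''" and eps: "0 < eps"
    and z: "\<And>x. x \<in> {0..1} \<Longrightarrow> f (x, z x) = 0"
      "\<And>x. x \<in> {0..1} \<Longrightarrow> (z has_real_derivative z' x) (at x within {0..1})"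
      "\<And>x. x \<in> {0..1} \<Longrightarrow> (z' has_real_derivative z'' x) (at x within {0..1})"
      "\<And>x. x \<in> {0..1} \<Longrightarrow> \<bar>z x\<bar> \<le> K \<and> \<bar>z' x\<bar> \<le> K \<and> \<bar>z'' x\<bar> \<le> K"
    and "0 < K" and x: "x \<in> {0..1}"
  shows "\<bar>y x - z x\<bar> \<le> (K + K / m) * (eps\<^sup>2 + layer m eps x)"
proof -
  define M where "M = K + K / m"
  have M: "0 < M" "K \<le> M" "K \<le> M * m" using \<open>0 < K\<close> m_pos by (auto simp: M_def distrib_right add_pos_pos)
  \<comment> \<open>The sign \<open>sg\<close> handles the upper and the lower estimate in one
    run.\<close>
  have bound: "sg * (y x - z x) - M * (eps\<^sup>2 + layer m eps x) \<le> 0" if sg: "\<bar>sg\<bar> = 1" for sg :: real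
  proof (rule second_order_maximum_principle[OF _ _ _ _ _ x, where
        w' = "\<lambda>x. sg * (y' x - z' x) - M * layer_slope m eps x" and
        w'' = "\<lambda>x. sg * (y'' x - z'' x) - M * (m / eps\<^sup>2 * layer m eps x)"])
    fix t :: real assume t: "t \<in> {0..1}"
    note D = layer_derivatives[of m eps t "{0..1}"]
    show "((\<lambda>x. sg * (y x - z x) - M * (eps\<^sup>2 + layer m eps x)) has_real_derivative
          sg * (y' t - z' t) - M * layer_slope m eps t) (at t within {0..1})"
      using sol t z(2)[OF t] D(1) m_pos eps unfolding bvp_solution_def
      by (auto intro!: derivative_eq_intros)
    show "((\<lambda>x. sg * (y' x - z' x) - M * layer_slope m eps x) has_real_derivative
          sg * (y'' t - z'' t) - M * (m / eps\<^sup>2 * layer m eps t)) (at t within {0..1})"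
      using sol t z(3)[OF t] D(2) m_pos eps unfolding bvp_solution_def
      by (auto intro!: derivative_eq_intros)
  next
    have "1 \<le> eps\<^sup>2 + layer m eps 0" "1 \<le> eps\<^sup>2 + layer m eps 1"
      by (simp_all add: layer_def add_nonneg_nonneg)
    then have "M * 1 \<le> M * (eps\<^sup>2 + layer m eps 0)" "M * 1 \<le> M * (eps\<^sup>2 + layer m eps 1)"
      using M by (intro mult_left_mono; simp)+
    moreover have "sg * (y 0 - z 0) \<le> K" "sg * (y 1 - z 1) \<le> K"
      using z(4)[of 0] z(4)[of 1] sg sol unfolding bvp_solution_def
      by (auto simp: abs_if split: if_splits)
    ultimately show "sg * (y 0 - z 0) - M * (eps\<^sup>2 + layer m eps 0) \<le> 0"
      "sg * (y 1 - z 1) - M * (eps\<^sup>2 + layer m eps 1) \<le> 0"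
      using M by linarith+
  next
    fix t :: real assume "t \<in> {0<..<1}"
      and pos: "0 < sg * (y t - z t) - M * (eps\<^sup>2 + layer m eps t)"
    then have t: "t \<in> {0..1}" by auto
    obtain c where c: "m \<le> c" "f (t, y t) - f (t, z t) = c * (y t - z t)"
      using difference_quotient[OF t] by metis
    have ode: "eps\<^sup>2 * y'' t = c * (y t - z t)" using c z(1)[OF t] sol t unfolding bvp_solution_def by auto
    have "0 \<le> M * (eps\<^sup>2 + layer m eps t)"
      using M layer_pos[of m eps t] by (intro mult_nonneg_nonneg add_nonneg_nonneg) auto
    then have "m * (sg * (y t - z t)) \<le> c * (sg * (y t - z t))"
      using c pos by (intro mult_right_mono) auto
    moreover have "eps\<^sup>2 * (sg * z'' t) \<le> eps\<^sup>2 * K"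
      using z(4)[OF t] sg abs_mult[of sg "z'' t"] by (intro mult_left_mono) auto
    moreover have "eps\<^sup>2 * K \<le> eps\<^sup>2 * (M * m)" using M by (intro mult_left_mono) auto
    moreover have "0 < m * (sg * (y t - z t) - M * (eps\<^sup>2 + layer m eps t))" using pos m_pos by simp
    moreover have "eps\<^sup>2 * (sg * (y'' t - z'' t) - M * (m / eps\<^sup>2 * layer m eps t))
        = sg * (eps\<^sup>2 * y'' t) - eps\<^sup>2 * (sg * z'' t) - M * m * layer m eps t"
      using eps by (simp add: field_simps)
    ultimately have "0 < eps\<^sup>2 * (sg * (y'' t - z'' t) - M * (m / eps\<^sup>2 * layer m eps t))"
      unfolding ode by (simp add: algebra_simps)
    then show "0 < sg * (y'' t - z'' t) - M * (m / eps\<^sup>2 * layer m eps t)"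
      using eps by (simp add: zero_less_mult_iff)
  qed
  show ?thesis using bound[of 1] bound[of "-1"] unfolding M_def by (simp add: abs_le_iff)
qed

text \<open>The slope bound interpolates between the size of \<open>y - z\<close> and that of its
  second derivative over a step of length \<open>eps / 2\<close>. The last clause concerns
  \<open>y''''\<close>: since \<open>f (t, y t) = eps^2 * y'' t\<close>, the quantity
  \<open>eps^2 * F''\<close> is \<open>eps^4 * y''''\<close>.\<close>

lemma a_priori_estimates:
  obtains K z z' z'' where "0 < K"
    "\<And>x. x \<in> {0..1} \<Longrightarrow> (z has_real_derivative z' x) (at x within {0..1})"
    "\<And>x. x \<in> {0..1} \<Longrightarrow> (z' has_real_derivative z'' x) (at x within {0..1})"
    "\<And>x. x \<in> {0..1} \<Longrightarrow> \<bar>z' x\<bar> \<le> K \<and> \<bar>z'' x\<bar> \<le> K"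
    "\<And>eps y y' y'' x. 0 < eps \<Longrightarrow> eps < 1 \<Longrightarrow> bvp_solution f eps y y' y'' \<Longrightarrow> x \<in> {0..1} \<Longrightarrow>
       \<bar>y x - z x\<bar> \<le> K * (eps\<^sup>2 + layer m eps x) \<and>
       \<bar>f (x, y x)\<bar> \<le> K * (eps\<^sup>2 + layer m eps x) \<and>
       \<bar>y' x\<bar> \<le> K * (1 + layer m eps x / eps)"
    "\<And>eps y y' y''. 0 < eps \<Longrightarrow> eps < 1 \<Longrightarrow> bvp_solution f eps y y' y'' \<Longrightarrow>
       \<exists>F' F''. \<forall>x\<in>{0..1}. ((\<lambda>t. f (t, y t)) has_real_derivative F' x) (at x within {0..1}) \<and>
         (F' has_real_derivative F'' x) (at x within {0..1}) \<and>
         eps\<^sup>2 * \<bar>F'' x\<bar> \<le> K * (eps\<^sup>2 + layer m eps x)"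
proof -
  obtain K0 :: real and z z' z'' :: "real \<Rightarrow> real" where "0 < K0"
    and z: "\<And>x. x \<in> {0..1} \<Longrightarrow> f (x, z x) = 0"
      "\<And>x. x \<in> {0..1} \<Longrightarrow> (z has_real_derivative z' x) (at x within {0..1})"
      "\<And>x. x \<in> {0..1} \<Longrightarrow> (z' has_real_derivative z'' x) (at x within {0..1})"
      "\<And>x. x \<in> {0..1} \<Longrightarrow> \<bar>z x\<bar> \<le> K0 \<and> \<bar>z' x\<bar> \<le> K0 \<and> \<bar>z'' x\<bar> \<le> K0"
    by (fact reduced_solution_smooth)
  define K1 where "K1 = K0 + K0 / m"
  have K1: "0 < K1" using \<open>0 < K0\<close> m_pos by (simp add: K1_def add_pos_pos)
  define M where "M = exp (sqrt m / 2)"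
  have M: "1 \<le> M" using m_pos by (simp add: M_def)
  define G where "G = gam * K1 + K0"
  have G: "0 < G" "gam * K1 \<le> G" using K1 \<open>0 < K0\<close> gam_pos by (auto simp: G_def add_pos_pos)
  define K2 where "K2 = K0 + (4 * K1 + 2 * G) * M"
  have K2: "0 < K2" using K1 G M \<open>0 < K0\<close> by (auto simp: K2_def intro!: add_pos_pos mult_pos_pos)
  \<comment> \<open>An a priori bound for \<open>|y|\<close>: at most \<open>K0\<close> from
    \<open>z\<close>, plus \<open>K1 * (eps^2 + E)\<close> with \<open>eps^2 <= 1\<close> and
    \<open>E <= 2\<close>. It confines the second partial derivatives of \<open>f\<close> to a
    compact set.\<close>
  define R where "R = K0 + 3 * K1"
  obtain B1 where B1: "0 < B1" "\<And>x v. x \<in> {0..1} \<Longrightarrow> \<bar>v\<bar> \<le> R \<Longrightarrow> \<bar>fxx (x, v)\<bar> \<le> B1"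
    by (rule continuous_on_strip_bounded[OF cont2(1)]) blast
  obtain B2 where B2: "0 < B2" "\<And>x v. x \<in> {0..1} \<Longrightarrow> \<bar>v\<bar> \<le> R \<Longrightarrow> \<bar>fxy (x, v)\<bar> \<le> B2"
    by (rule continuous_on_strip_bounded[OF cont2(2)]) blast
  obtain B3 where B3: "0 < B3" "\<And>x v. x \<in> {0..1} \<Longrightarrow> \<bar>v\<bar> \<le> R \<Longrightarrow> \<bar>fyx (x, v)\<bar> \<le> B3"
    by (rule continuous_on_strip_bounded[OF cont2(3)]) blast
  obtain B4 where B4: "0 < B4" "\<And>x v. x \<in> {0..1} \<Longrightarrow> \<bar>v\<bar> \<le> R \<Longrightarrow> \<bar>fyy (x, v)\<bar> \<le> B4"
    by (rule continuous_on_strip_bounded[OF cont2(4)]) blast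
  define B where "B = B1 + B2 + B3 + B4"
  have Bb: "0 < B" "\<bar>fxx (x, v)\<bar> \<le> B" "\<bar>fxy (x, v)\<bar> \<le> B" "\<bar>fyx (x, v)\<bar> \<le> B" "\<bar>fyy (x, v)\<bar> \<le> B"
    if "x \<in> {0..1}" "\<bar>v\<bar> \<le> R" for x v
    using B1(2)[OF that] B2(2)[OF that] B3(2)[OF that] B4(2)[OF that] B1(1) B2(1) B3(1) B4(1)
    unfolding B_def by linarith+
  define K3 where "K3 = B * (1 + K2)\<^sup>2 * 4 + gam * (gam * K1)"
  have "0 < B" using B1 B2 B3 B4 by (simp add: B_def)
  then have K3: "0 < K3" using K2 gam_pos K1
    by (auto simp: K3_def intro!: add_pos_pos mult_pos_pos)
  define K where "K = K0 + K1 + G + K2 + K3"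
  have K: "0 < K" "K0 \<le> K" "K1 \<le> K" "gam * K1 \<le> K" "K2 \<le> K" "K3 \<le> K"
    using \<open>0 < K0\<close> K1 G K2 K3 unfolding K_def by linarith+
  have main: "\<bar>y x - z x\<bar> \<le> K1 * (eps\<^sup>2 + layer m eps x)"
      "\<bar>f (x, y x)\<bar> \<le> gam * K1 * (eps\<^sup>2 + layer m eps x)"
    if eps: "0 < eps" and sol: "bvp_solution f eps y y' y''" and x: "x \<in> {0..1}" for eps y y' y'' x
  proof -
    show v: "\<bar>y x - z x\<bar> \<le> K1 * (eps\<^sup>2 + layer m eps x)"
      unfolding K1_def by (rule solution_near_reduced[OF sol eps z \<open>0 < K0\<close> x])
    obtain c where c: "m \<le> c" "c \<le> gam" "f (x, y x) - f (x, z x) = c * (y x - z x)"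
      using difference_quotient[OF x] by metis
    have "\<bar>f (x, y x)\<bar> = c * \<bar>y x - z x\<bar>" using c z(1)[OF x] m_pos by (simp add: abs_mult)
    also have "\<dots> \<le> gam * (K1 * (eps\<^sup>2 + layer m eps x))"
      using v c gam_pos by (intro mult_mono) auto
    finally show "\<bar>f (x, y x)\<bar> \<le> gam * K1 * (eps\<^sup>2 + layer m eps x)" by (simp add: mult.assoc)
  qed
  have y': "\<bar>y' x\<bar> \<le> K2 * (1 + layer m eps x / eps)"
    if eps: "0 < eps" "eps < 1" and sol: "bvp_solution f eps y y' y''" and x: "x \<in> {0..1}"
    for eps y y' y'' x
  proof -
    \<comment> \<open>The step goes towards the farther end of the interval; \<open>eps < 1\<close>
      keeps it inside.\<close>
    obtain t where t: "t \<in> {0..1}" "\<bar>t - x\<bar> = eps / 2"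
    proof (cases "x \<le> 1/2")
      case True then show ?thesis using eps x by (intro that[of "x + eps / 2"]) auto
    next
      case False then show ?thesis using eps x by (intro that[of "x - eps / 2"]) auto
    qed
    define S where "S = closed_segment x t"
    have S: "convex S" "x \<in> S" "t \<in> S" by (auto simp: S_def)
    have S01: "s \<in> {0..1}" "\<bar>x - s\<bar> \<le> eps / 2" if "s \<in> S" for s
      using that x t by (auto simp: S_def closed_segment_eq_real_ivl split: if_splits)
    \<comment> \<open>A single bound for \<open>eps^2 + E\<close> along the whole segment;
      \<open>M\<close> is the shift factor for distance \<open>eps / 2\<close>.\<close>
    define H where "H = eps\<^sup>2 + M * layer m eps x"
    have H: "eps\<^sup>2 + layer m eps s \<le> H" if "s \<in> S" for s
      using layer_shift[of eps m x s "eps / 2"] eps m_pos S01[OF that] by (simp add: H_def M_def)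
    have "0 \<le> H" using H[OF S(2)] layer_pos[of m eps x] by (smt (verit) zero_le_power2)
    have vb: "\<bar>y s - z s\<bar> \<le> K1 * H" if "s \<in> S" for s
      using main(1)[OF eps(1) sol S01(1)[OF that]] mult_left_mono[OF H[OF that], of K1] K1 by linarith
    have fb: "\<bar>y'' s - z'' s\<bar> \<le> G * H / eps\<^sup>2" if "s \<in> S" for s
    proof -
      have "eps\<^sup>2 * \<bar>y'' s\<bar> = \<bar>f (s, y s)\<bar>"
        using sol S01(1)[OF that] abs_mult[of "eps\<^sup>2" "y'' s"] unfolding bvp_solution_def by auto
      also have "\<dots> \<le> gam * K1 * H"
        using main(2)[OF eps(1) sol S01(1)[OF that]] mult_left_mono[OF H[OF that], of "gam * K1"] K1 gam_pos
        by (smt (verit) mult_pos_pos)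
      finally have 1: "eps\<^sup>2 * \<bar>y'' s\<bar> \<le> gam * K1 * H" .
      have "eps\<^sup>2 * \<bar>z'' s\<bar> \<le> H * K0"
        using z(4)[OF S01(1)[OF that]] H[OF that] layer_pos[of m eps s] \<open>0 < K0\<close> \<open>0 \<le> H\<close>
        by (intro mult_mono) auto
      moreover have "eps\<^sup>2 * \<bar>y'' s - z'' s\<bar> \<le> eps\<^sup>2 * (\<bar>y'' s\<bar> + \<bar>z'' s\<bar>)"
        by (intro mult_left_mono) auto
      ultimately have "eps\<^sup>2 * \<bar>y'' s - z'' s\<bar> \<le> G * H" using 1 by (simp add: G_def algebra_simps)
      then show ?thesis using eps by (simp add: field_simps)
    qed
    have "\<bar>(\<lambda>x. y x - z x) t - (\<lambda>x. y x - z x) x - (y' x - z' x) * (t - x)\<bar> \<le> G * H / eps\<^sup>2 * (t - x)\<^sup>2"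
    proof (rule second_order_Taylor_bound[OF S(1) _ _ fb S(2,3)])
      fix s assume s: "s \<in> S"
      have sub: "S \<subseteq> {0..1}" using S01 by auto
      show "((\<lambda>x. y x - z x) has_real_derivative (y' s - z' s)) (at s within S)"
        "((\<lambda>x. y' x - z' x) has_real_derivative (y'' s - z'' s)) (at s within S)"
        using sol z(2,3)[OF S01(1)[OF s]] S01(1)[OF s] unfolding bvp_solution_def
        by (auto intro!: DERIV_diff DERIV_subset[OF _ sub])
    qed
    moreover have "(t - x)\<^sup>2 = eps\<^sup>2 / 4"
      unfolding power2_abs[of "t - x", symmetric] t(2) by (simp add: power_divide)
    ultimately have "\<bar>(y t - z t) - (y x - z x) - (y' x - z' x) * (t - x)\<bar> \<le> G * H / 4"
      using eps by (simp add: field_simps)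
    then have "\<bar>(y' x - z' x) * (t - x)\<bar> \<le> 2 * (K1 * H) + G * H / 4"
      using vb[OF S(2)] vb[OF S(3)] by linarith
    then have "\<bar>y' x - z' x\<bar> * eps \<le> (4 * K1 + G / 2) * H"
      unfolding abs_mult t(2) by (simp add: distrib_right)
    also have "\<dots> \<le> (4 * K1 + 2 * G) * H" using G \<open>0 \<le> H\<close> by (intro mult_right_mono) auto
    also have "\<dots> \<le> (4 * K1 + 2 * G) * (M * (eps + layer m eps x))"
    proof -
      have "eps\<^sup>2 \<le> 1 * eps" using eps unfolding power2_eq_square by (intro mult_right_mono) auto
      also have "\<dots> \<le> M * eps" using M eps by (intro mult_right_mono) auto
      finally show ?thesis using K1 G by (intro mult_left_mono) (auto simp: H_def algebra_simps)
    qed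
    finally have "\<bar>y' x - z' x\<bar> \<le> (4 * K1 + 2 * G) * M * (1 + layer m eps x / eps)"
      using eps by (simp add: field_simps)
    moreover have "\<bar>z' x\<bar> \<le> K0 * (1 + layer m eps x / eps)"
    proof -
      have "\<bar>z' x\<bar> \<le> K0 * 1" using z(4)[OF x] by simp
      also have "\<dots> \<le> K0 * (1 + layer m eps x / eps)"
        using \<open>0 < K0\<close> eps layer_pos[of m eps x] by (intro mult_left_mono) auto
      finally show ?thesis .
    qed
    ultimately show ?thesis unfolding K2_def by (simp add: distrib_right)
  qed
  show thesis
  proof (rule that[OF K(1) z(2,3)])
    show "\<bar>z' x\<bar> \<le> K \<and> \<bar>z'' x\<bar> \<le> K" if "x \<in> {0..1}" for x using z(4)[OF that] K by auto
  next
    fix eps x :: real and y y' y'' :: "real \<Rightarrow> real"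
    assume H: "0 < eps" "eps < (1::real)" "bvp_solution f eps y y' y''" "x \<in> {0..1}"
    have e: "0 \<le> eps\<^sup>2 + layer m eps x" "0 \<le> 1 + layer m eps x / eps"
      using layer_pos[of m eps x] H(1) by (auto intro!: add_nonneg_nonneg)
    show "\<bar>y x - z x\<bar> \<le> K * (eps\<^sup>2 + layer m eps x) \<and> \<bar>f (x, y x)\<bar> \<le> K * (eps\<^sup>2 + layer m eps x) \<and>
       \<bar>y' x\<bar> \<le> K * (1 + layer m eps x / eps)"
      using main[OF H(1,3,4)] y'[OF H] mult_right_mono[OF K(3) e(1)] mult_right_mono[OF K(4) e(1)]
        mult_right_mono[OF K(5) e(2)] by linarith
  next
    fix eps :: real and y y' y'' :: "real \<Rightarrow> real"
    assume H: "0 < eps" "eps < (1::real)" "bvp_solution f eps y y' y''"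
    have dy: "(y has_real_derivative y' x) (at x within {0..1})"
      "(y' has_real_derivative y'' x) (at x within {0..1})" if "x \<in> {0..1}" for x
      using H(3) that unfolding bvp_solution_def by auto
    let ?F' = "\<lambda>x. fx (x, y x) + fy (x, y x) * y' x"
    let ?F'' = "\<lambda>x. fxx (x, y x) + fxy (x, y x) * y' x
        + ((fyx (x, y x) + fyy (x, y x) * y' x) * y' x + y'' x * fy (x, y x))"
    show "\<exists>F' F''. \<forall>x\<in>{0..1}. ((\<lambda>t. f (t, y t)) has_real_derivative F' x) (at x within {0..1}) \<and>
         (F' has_real_derivative F'' x) (at x within {0..1}) \<and>
         eps\<^sup>2 * \<bar>F'' x\<bar> \<le> K * (eps\<^sup>2 + layer m eps x)"
    proof (rule exI[of _ ?F'], rule exI[of _ ?F''], intro ballI conjI)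
      fix x :: real assume x: "x \<in> {0..1}"
      then have p: "(x, y x) \<in> strip" by simp
      show "((\<lambda>t. f (t, y t)) has_real_derivative ?F' x) (at x within {0..1})"
        by (rule derivative_along_graph[OF f_deriv[OF p] dy(1)[OF x]])
      show "(?F' has_real_derivative ?F'' x) (at x within {0..1})"
        by (intro DERIV_add DERIV_mult derivative_along_graph[OF fx_deriv[OF p] dy(1)[OF x]]
            derivative_along_graph[OF fy_deriv[OF p] dy(1)[OF x]] dy(2)[OF x])
      define E where "E = layer m eps x"
      have E: "0 < E" "E \<le> 2" using layer_pos[of m eps x] layer_le_2[of eps m x] H m_pos x by (auto simp: E_def)
      have "eps\<^sup>2 \<le> 1" using H by (simp add: power_le_one)
      then have "K1 * (eps\<^sup>2 + E) \<le> K1 * 3" using E K1 by (intro mult_left_mono) auto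
      then have "\<bar>y x\<bar> \<le> R"
        using main(1)[OF H(1,3) x] z(4)[OF x] unfolding R_def E_def by linarith
      note b = Bb[OF x this]
      define a where "a = \<bar>y' x\<bar>"
      have a: "0 \<le> a" "a \<le> K2 * (1 + E / eps)" using y'[OF H x] by (auto simp: a_def E_def)
      have "\<bar>fxy (x, y x) * y' x\<bar> \<le> B * a" "\<bar>fyx (x, y x) * y' x\<bar> \<le> B * a"
        "\<bar>fyy (x, y x) * y' x * y' x\<bar> \<le> B * a * a" "\<bar>y'' x * fy (x, y x)\<bar> \<le> \<bar>y'' x\<bar> * gam"
        unfolding abs_mult a_def using b(3-5) fy_bounds[OF p] m_pos
        by (auto intro!: mult_right_mono mult_left_mono)
      moreover have "?F'' x = fxx (x, y x) + fxy (x, y x) * y' x + fyx (x, y x) * y' x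
          + fyy (x, y x) * y' x * y' x + y'' x * fy (x, y x)" by (simp add: algebra_simps)
      ultimately have "\<bar>?F'' x\<bar> \<le> B + B * a + B * a + B * a * a + \<bar>y'' x\<bar> * gam"
        using b(2) by linarith
      also have "\<dots> = B * (1 + a)\<^sup>2 + gam * \<bar>y'' x\<bar>" by (simp add: power2_eq_square algebra_simps)
      finally have "eps\<^sup>2 * \<bar>?F'' x\<bar> \<le> eps\<^sup>2 * (B * (1 + a)\<^sup>2 + gam * \<bar>y'' x\<bar>)"
        by (intro mult_left_mono) auto
      also have "\<dots> = B * (eps * (1 + a))\<^sup>2 + gam * (eps\<^sup>2 * \<bar>y'' x\<bar>)"
        unfolding power_mult_distrib by (simp only: distrib_left mult_ac)
      also have "\<dots> \<le> B * ((1 + K2)\<^sup>2 * (4 * (eps\<^sup>2 + E))) + gam * (gam * K1 * (eps\<^sup>2 + E))"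
      proof (intro add_mono mult_left_mono)
        have "1 + a \<le> 1 * (1 + E / eps) + K2 * (1 + E / eps)"
          using a(2) E H by (intro add_mono) auto
        then have "1 + a \<le> (1 + K2) * (1 + E / eps)" unfolding distrib_right .
        then have "eps * (1 + a) \<le> eps * ((1 + K2) * (1 + E / eps))" using H by (intro mult_left_mono) auto
        also have "\<dots> = (1 + K2) * (eps + E)" using H by (simp add: field_simps)
        finally have "(eps * (1 + a))\<^sup>2 \<le> ((1 + K2) * (eps + E))\<^sup>2"
          using a H by (intro power_mono) auto
        also have "\<dots> = (1 + K2)\<^sup>2 * (eps + E)\<^sup>2" by (simp add: power_mult_distrib)
        \<comment> \<open>Here the quadratic term in \<open>y'\<close> is tamed: the square of the
          layer function is again of the order of the layer function because
          \<open>E <= 2\<close>.\<close>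
        also have "\<dots> \<le> (1 + K2)\<^sup>2 * (4 * (eps\<^sup>2 + E))"
        proof (rule mult_left_mono)
          have "2 * (eps * E) \<le> eps * eps + E * E"
            using zero_le_square[of "eps - E"] by (simp add: algebra_simps)
          moreover have "E * E \<le> 2 * E" using E by (intro mult_right_mono) auto
          moreover have "0 \<le> eps * eps" by simp
          moreover have "(eps + E)\<^sup>2 = eps * eps + 2 * (eps * E) + E * E"
            by (simp add: power2_eq_square algebra_simps)
          ultimately show "(eps + E)\<^sup>2 \<le> 4 * (eps\<^sup>2 + E)"
            unfolding power2_eq_square[of eps] distrib_left by linarith
        qed simp
        finally show "(eps * (1 + a))\<^sup>2 \<le> (1 + K2)\<^sup>2 * (4 * (eps\<^sup>2 + E))" .
        have "eps\<^sup>2 * \<bar>y'' x\<bar> = \<bar>f (x, y x)\<bar>"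
          using H(3) x abs_mult[of "eps\<^sup>2" "y'' x"] unfolding bvp_solution_def by auto
        then show "eps\<^sup>2 * \<bar>y'' x\<bar> \<le> gam * K1 * (eps\<^sup>2 + E)"
          using main(2)[OF H(1,3) x] by (simp add: E_def)
      qed (use \<open>0 < B\<close> gam_pos in auto)
      also have "\<dots> = K3 * (eps\<^sup>2 + E)" by (simp add: K3_def algebra_simps)
      also have "\<dots> \<le> K * (eps\<^sup>2 + E)" using K E by (intro mult_right_mono) auto
      finally show "eps\<^sup>2 * \<bar>?F'' x\<bar> \<le> K * (eps\<^sup>2 + layer m eps x)" by (simp add: E_def)
    qed
  qed
qed

end

section \<open>The difference operator\<close>

text \<open>With \<open>h\<close> the step on the own side and \<open>h'\<close> the opposite one,
  this is \<open>4 * a / (Delta d + Delta d')\<close> of the scheme, written through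
  \<open>Delta d = tanh (b * h / 2)\<close>.\<close>

definition wgt :: "real \<Rightarrow> real \<Rightarrow> real \<Rightarrow> real" where
  "wgt b h h' = 4 / (sinh (b * h) * (tanh (b * h / 2) + tanh (b * h' / 2)))"

text \<open>The summand 1 arises from
  \<open>3 * a + d + Delta d' = 4 * a + (Delta d + Delta d')\<close> after division by the bracket.
  It is what compensates the reaction terms at the two neighbours, whose slopes divided by
  \<open>gam\<close> are at most 1.\<close>

definition disc_op :: "real \<Rightarrow> real \<Rightarrow> real \<Rightarrow> real \<Rightarrow> real \<Rightarrow> real \<Rightarrow> real" where
  "disc_op b hl hr u v w = (wgt b hl hr + 1) * (u - v) + (wgt b hr hl + 1) * (w - v)"

lemma wgt_pos: "0 < b \<Longrightarrow> 0 < h \<Longrightarrow> 0 < h' \<Longrightarrow> 0 < wgt b h h'"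
  by (simp add: wgt_def add_pos_pos)

lemma disc_op_commute: "disc_op b hl hr u v w = disc_op b hr hl w v u"
  by (simp add: disc_op_def)

lemma disc_op_uniform:
  assumes "0 < b" "0 < h"
  shows "disc_op b h h u v w = (1 + 1 / (sinh (b * h / 2))\<^sup>2) * (u - 2 * v + w)"
proof -
  have "wgt b h h = 2 / (sinh (b * h) * tanh (b * h / 2))" by (simp add: wgt_def)
  also have "\<dots> = 1 / (sinh (b * h / 2))\<^sup>2" unfolding sinh_mult_tanh_half by simp
  finally have *: "wgt b h h = 1 / (sinh (b * h / 2))\<^sup>2" .
  show ?thesis unfolding disc_op_def * by algebra
qed

lemma wgt_le:
  assumes "0 < b" "0 < h" "0 < h'"
  shows "wgt b h h' \<le> 2 / (sinh (b * h / 2))\<^sup>2"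
proof -
  have "wgt b h h' \<le> 4 / (sinh (b * h) * tanh (b * h / 2))"
    unfolding wgt_def using assms by (intro divide_left_mono mult_left_mono mult_pos_pos add_pos_pos) auto
  then show ?thesis unfolding sinh_mult_tanh_half by simp
qed

text \<open>Uniform in the ratio of \<open>h\<close> to \<open>eps\<close>: with
  \<open>b = sqrt gam / eps\<close> the right-hand side is \<open>8 * eps^2 / gam\<close>, just
  enough to cancel the \<open>1 / eps^2\<close> in bounds on \<open>y''\<close>.\<close>

lemma wgt_square_le:
  assumes "0 < b" "0 < h" "0 < h'"
  shows "wgt b h h' * h\<^sup>2 \<le> 8 / b\<^sup>2"
proof -
  have "(b * h / 2)\<^sup>2 \<le> (sinh (b * h / 2))\<^sup>2"
    using le_sinh[of "b * h / 2"] assms by (intro power_mono) auto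
  then have "2 / (sinh (b * h / 2))\<^sup>2 \<le> 2 / (b * h / 2)\<^sup>2"
    using assms by (intro divide_left_mono) auto
  then have "wgt b h h' * h\<^sup>2 \<le> 2 / (b * h / 2)\<^sup>2 * h\<^sup>2"
    using wgt_le[OF assms] by (intro mult_right_mono) auto
  also have "\<dots> = 8 / b\<^sup>2" using assms by (simp add: field_simps power2_eq_square)
  finally show ?thesis .
qed

text \<open>This moment multiplies \<open>y'\<close>. The first bound serves the regular part of
  \<open>y'\<close>, which is O(1), the second the layer part, which carries a factor
  \<open>1 / eps\<close>.\<close>

lemma wgt_first_moment:
  assumes "0 < b" "0 < hl" "0 < hr"
  shows "\<bar>wgt b hr hl * hr - wgt b hl hr * hl\<bar> \<le> 4 * \<bar>hr - hl\<bar>"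
    and "b * \<bar>wgt b hr hl * hr - wgt b hl hr * hl\<bar> \<le> 16"
proof -
  define D where "D = tanh (b * hl / 2) + tanh (b * hr / 2)"
  define T where "T = \<bar>b * hr / sinh (b * hr) - b * hl / sinh (b * hl)\<bar>"
  have D: "0 < D" using assms by (simp add: D_def add_pos_pos)
  have "wgt b hr hl * hr - wgt b hl hr * hl
      = 4 / (b * D) * (b * hr / sinh (b * hr) - b * hl / sinh (b * hl))"
  proof -
    have "wgt b hr hl * hr = 4 / (b * D) * (b * hr / sinh (b * hr))"
      "wgt b hl hr * hl = 4 / (b * D) * (b * hl / sinh (b * hl))"
      using assms unfolding wgt_def D_def by (simp_all add: add.commute mult.commute)
    then show ?thesis by (simp only: right_diff_distrib)
  qed
  then have eq: "\<bar>wgt b hr hl * hr - wgt b hl hr * hl\<bar> = 4 * T / (b * D)"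
    using assms D by (simp only: abs_mult T_def) simp
  have "T \<le> D * \<bar>b * hr - b * hl\<bar>"
    unfolding T_def by (rule csch_quotient_diff) (use assms in \<open>auto simp: D_def\<close>)
  also have "\<dots> = D * (b * \<bar>hr - hl\<bar>)"
    using assms by (simp add: abs_mult flip: right_diff_distrib)
  finally have T1: "T \<le> D * (b * \<bar>hr - hl\<bar>)" .
  then show first: "\<bar>wgt b hr hl * hr - wgt b hl hr * hl\<bar> \<le> 4 * \<bar>hr - hl\<bar>"
    unfolding eq using assms D by (simp add: field_simps)
  have T2: "T \<le> 1"
    using csch_quotient_bounds[OF mult_pos_pos[OF assms(1,2)]]
      csch_quotient_bounds[OF mult_pos_pos[OF assms(1,3)]]
    unfolding T_def by linarith
  show "b * \<bar>wgt b hr hl * hr - wgt b hl hr * hl\<bar> \<le> 16"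
  \<comment> \<open>For small arguments the first bound suffices. Otherwise the denominator
    \<open>D\<close> is at least \<open>tanh (1 / 2) >= 1 / 4\<close>, while the numerator
    \<open>T\<close> never exceeds 1.\<close>
  proof (cases "b * max hl hr \<le> 1")
    case True
    have "b * \<bar>wgt b hr hl * hr - wgt b hl hr * hl\<bar> \<le> b * (4 * max hl hr)"
      using first assms by (intro mult_left_mono) (auto simp: max_def)
    then show ?thesis using True by linarith
  next
    case False
    have "1 / 4 \<le> tanh (1 / 2 :: real)" using tanh_ge_quadratic[of "1/2"] by (simp add: power2_eq_square)
    also have "\<dots> \<le> tanh (b * max hl hr / 2)" using False by simp
    also have "\<dots> \<le> D" using assms by (auto simp: D_def max_def)
    finally have "1 / 4 \<le> D" .
    then have "T * 4 \<le> 16 * D" using T2 by linarith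
    then show ?thesis unfolding eq using assms D by (simp add: field_simps)
  qed
qed

text \<open>The operator splits into the first moment times \<open>y'\<close>, the weighted Taylor
  remainders, and a plain second difference from the two summands 1. Each is bounded by itself;
  \<open>A\<close> stands for the layer contribution, of order \<open>1 / N^2\<close> in the
  application.\<close>

lemma coarse_consistency:
  fixes y y' y'' z z' z'' :: "real \<Rightarrow> real"
  assumes pos: "0 < gam" "0 < eps" "0 < hl" "0 < hr"
    and y: "\<And>t. t \<in> {x - hl..x + hr} \<Longrightarrow> (y has_real_derivative y' t) (at t within {x - hl..x + hr})"
      "\<And>t. t \<in> {x - hl..x + hr} \<Longrightarrow> (y' has_real_derivative y'' t) (at t within {x - hl..x + hr})"
      "\<And>t. t \<in> {x - hl..x + hr} \<Longrightarrow> eps\<^sup>2 * \<bar>y'' t\<bar> \<le> A"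
    and z: "\<And>t. t \<in> {x - hl..x + hr} \<Longrightarrow> (z has_real_derivative z' t) (at t within {x - hl..x + hr})"
      "\<And>t. t \<in> {x - hl..x + hr} \<Longrightarrow> (z' has_real_derivative z'' t) (at t within {x - hl..x + hr})"
      "\<And>t. t \<in> {x - hl..x + hr} \<Longrightarrow> \<bar>z' t\<bar> \<le> K \<and> \<bar>z'' t\<bar> \<le> K"
    and yz: "\<And>t. t \<in> {x - hl..x + hr} \<Longrightarrow> \<bar>y t - z t\<bar> \<le> A"
    and y'x: "\<bar>y' x\<bar> \<le> K + A / eps"
  shows "\<bar>disc_op (sqrt gam / eps) hl hr (y (x - hl)) (y x) (y (x + hr))\<bar>
      \<le> K * (5 * \<bar>hr - hl\<bar> + hl\<^sup>2 + hr\<^sup>2) + (4 + 16 / gam + 16 / sqrt gam) * A"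
proof -
  define b where "b = sqrt gam / eps"
  have b: "0 < b" "b\<^sup>2 = gam / eps\<^sup>2" using pos by (auto simp: b_def power_divide)
  define S where "S = {x - hl..x + hr}"
  have S: "convex S" "x \<in> S" "x - hl \<in> S" "x + hr \<in> S" using pos by (auto simp: S_def)
  note yS = y[folded S_def] and zS = z[folded S_def] and yzS = yz[folded S_def]
  have K: "0 \<le> K" using zS(3)[OF S(2)] by linarith
  have A: "0 \<le> A" using yzS[OF S(2)] by linarith
  have y''A: "\<bar>y'' t\<bar> \<le> A / eps\<^sup>2" if "t \<in> S" for t
    using yS(3)[OF that] pos by (simp add: field_simps)
  define Rl where "Rl = y (x - hl) - y x + hl * y' x"
  define Rr where "Rr = y (x + hr) - y x - hr * y' x"
  have Rl: "\<bar>Rl\<bar> \<le> A / eps\<^sup>2 * hl\<^sup>2"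
    using second_order_Taylor_bound[OF S(1) yS(1,2) y''A S(2) S(3)] by (simp add: Rl_def mult.commute)
  have Rr: "\<bar>Rr\<bar> \<le> A / eps\<^sup>2 * hr\<^sup>2"
    using second_order_Taylor_bound[OF S(1) yS(1,2) y''A S(2) S(4)] by (simp add: Rr_def mult.commute)
  have wR: "\<bar>wgt b h h' * R\<bar> \<le> 8 * A / gam" if "0 < h" "0 < h'" "\<bar>R\<bar> \<le> A / eps\<^sup>2 * h\<^sup>2" for h h' R
  proof -
    have "\<bar>wgt b h h' * R\<bar> \<le> wgt b h h' * (A / eps\<^sup>2 * h\<^sup>2)"
      unfolding abs_mult using that wgt_pos[of b h h'] b by (intro mult_mono) auto
    also have "\<dots> = A / eps\<^sup>2 * (wgt b h h' * h\<^sup>2)" by simp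
    also have "\<dots> \<le> A / eps\<^sup>2 * (8 / b\<^sup>2)"
      using wgt_square_le[of b h h'] that b A by (intro mult_left_mono) auto
    also have "\<dots> = 8 * A / gam" using pos b by simp
    finally show ?thesis .
  qed
  define W where "W = wgt b hr hl * hr - wgt b hl hr * hl"
  have W: "\<bar>W\<bar> \<le> 4 * \<bar>hr - hl\<bar>" "b * \<bar>W\<bar> \<le> 16"
    using wgt_first_moment[of b hl hr] b pos by (auto simp: W_def)
  have Wy: "\<bar>W * y' x\<bar> \<le> 4 * \<bar>hr - hl\<bar> * K + 16 / sqrt gam * A"
  proof -
    have "\<bar>W * y' x\<bar> \<le> \<bar>W\<bar> * (K + A / eps)"
      unfolding abs_mult using y'x by (intro mult_left_mono) auto
    also have "\<dots> = \<bar>W\<bar> * K + b * \<bar>W\<bar> * (A / sqrt gam)"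
      using pos by (simp add: b_def field_simps)
    also have "\<dots> \<le> 4 * \<bar>hr - hl\<bar> * K + 16 * (A / sqrt gam)"
      using W K A pos by (intro add_mono mult_right_mono) auto
    finally show ?thesis by simp
  qed
  \<comment> \<open>The plain second difference is taken of \<open>z\<close>, since a Taylor bound
    through \<open>y''\<close> would produce the unbounded ratio \<open>h^2 / eps^2\<close>.
    Exchanging \<open>y\<close> for \<open>z\<close> costs \<open>4 * A\<close>.\<close>
  have dz: "\<bar>z (x - hl) - 2 * z x + z (x + hr) - (hr - hl) * z' x\<bar> \<le> K * (hl\<^sup>2 + hr\<^sup>2)"
    by (rule centered_second_difference[OF S(1) zS(1,2)]) (use zS(3) S in auto)
  have "\<bar>(hr - hl) * z' x\<bar> \<le> \<bar>hr - hl\<bar> * K"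
    unfolding abs_mult using zS(3)[OF S(2)] by (intro mult_left_mono) auto
  then have dy: "\<bar>y (x - hl) - 2 * y x + y (x + hr)\<bar> \<le> K * (hl\<^sup>2 + hr\<^sup>2) + \<bar>hr - hl\<bar> * K + 4 * A"
    using dz yzS[OF S(2)] yzS[OF S(3)] yzS[OF S(4)] by linarith
  have "disc_op b hl hr (y (x - hl)) (y x) (y (x + hr))
      = W * y' x + wgt b hl hr * Rl + wgt b hr hl * Rr + (y (x - hl) - 2 * y x + y (x + hr))"
    by (simp add: disc_op_def W_def Rl_def Rr_def algebra_simps)
  then have "\<bar>disc_op b hl hr (y (x - hl)) (y x) (y (x + hr))\<bar>
      \<le> \<bar>W * y' x\<bar> + \<bar>wgt b hl hr * Rl\<bar> + \<bar>wgt b hr hl * Rr\<bar> + \<bar>y (x - hl) - 2 * y x + y (x + hr)\<bar>"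
    by linarith
  also have "\<dots> \<le> (4 * \<bar>hr - hl\<bar> * K + 16 / sqrt gam * A) + 8 * A / gam + 8 * A / gam
      + (K * (hl\<^sup>2 + hr\<^sup>2) + \<bar>hr - hl\<bar> * K + 4 * A)"
    by (intro add_mono Wy wR Rl Rr dy pos)
  also have "\<dots> = K * (5 * \<bar>hr - hl\<bar> + hl\<^sup>2 + hr\<^sup>2) + (4 + 16 / gam + 16 / sqrt gam) * A"
    by (simp add: algebra_simps add_divide_distrib)
  finally show ?thesis unfolding b_def .
qed

text \<open>On equal steps the operator is \<open>c = (coth s)^2\<close> times the second
  difference. Its leading term \<open>c * h^2 * y2 x\<close> nearly cancels against
  \<open>4 * eps^2 / gam * y2 x\<close>, because \<open>c * s^2\<close> lies between 1 and
  \<open>1 + s^2\<close>; the other terms are fourth-derivative remainders.\<close>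

lemma fine_consistency:
  fixes y y1 y2 y3 y4 :: "real \<Rightarrow> real"
  assumes pos: "0 < gam" "0 < eps" "0 < h"
    and y: "\<And>t. t \<in> {x - h..x + h} \<Longrightarrow> (y has_real_derivative y1 t) (at t within {x - h..x + h})"
      "\<And>t. t \<in> {x - h..x + h} \<Longrightarrow> (y1 has_real_derivative y2 t) (at t within {x - h..x + h})"
      "\<And>t. t \<in> {x - h..x + h} \<Longrightarrow> (y2 has_real_derivative y3 t) (at t within {x - h..x + h})"
      "\<And>t. t \<in> {x - h..x + h} \<Longrightarrow> (y3 has_real_derivative y4 t) (at t within {x - h..x + h})"
    and y2: "eps\<^sup>2 * \<bar>y2 x\<bar> \<le> A"
    and y4: "\<And>t. t \<in> {x - h..x + h} \<Longrightarrow> eps ^ 4 * \<bar>y4 t\<bar> \<le> A"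
  defines "s \<equiv> sqrt gam / eps * h / 2"
  shows "\<bar>disc_op (sqrt gam / eps) h h (y (x - h)) (y x) (y (x + h))
        - eps\<^sup>2 / gam * (y2 (x - h) + 2 * y2 x + y2 (x + h))\<bar>
      \<le> h\<^sup>2 / eps\<^sup>2 * (1 + (4 + 2 * s\<^sup>2) / gam) * A"
proof -
  define b where "b = sqrt gam / eps"
  have b: "0 < b" "b\<^sup>2 = gam / eps\<^sup>2" using pos by (auto simp: b_def power_divide)
  have s: "0 < s" "h = 2 * s / b" using pos by (auto simp: s_def b_def)
  define S where "S = {x - h..x + h}"
  have S: "convex S" "x \<in> S" "x - h \<in> S" "x + h \<in> S" using pos by (auto simp: S_def)
  note yS = y[folded S_def]
  define B where "B = A / eps ^ 4"
  have y4B: "\<bar>y4 t\<bar> \<le> B" if "t \<in> S" for t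
    using y4[folded S_def, OF that] pos by (simp add: B_def field_simps)
  have B0: "0 \<le> B" using y4B[OF S(2)] by linarith
  have "\<bar>y (x + h) - (y x + y1 x * h + y2 x * h\<^sup>2 / 2 + y3 x * h ^ 3 / 6)\<bar> \<le> B * h ^ 4 / 6"
    using fourth_order_Taylor_bound[OF S(1) yS y4B S(2) S(4)] by simp
  moreover have "\<bar>y (x - h) - (y x - y1 x * h + y2 x * h\<^sup>2 / 2 - y3 x * h ^ 3 / 6)\<bar> \<le> B * h ^ 4 / 6"
    using fourth_order_Taylor_bound[OF S(1) yS y4B S(2) S(3)] by simp
  ultimately have R1: "\<bar>y (x - h) - 2 * y x + y (x + h) - h\<^sup>2 * y2 x\<bar> \<le> B * h ^ 4 / 3"
    unfolding mult.commute[of "h\<^sup>2" "y2 x"] by linarith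
  have R2: "\<bar>y2 (x - h) - 2 * y2 x + y2 (x + h)\<bar> \<le> B * (2 * h\<^sup>2)"
    using centered_second_difference[OF S(1) yS(3,4) y4B S(2) S(3) S(4)] by simp
  define c where "c = 1 + 1 / (sinh s)\<^sup>2"
  have sh: "0 < sinh s" "s\<^sup>2 \<le> (sinh s)\<^sup>2" using s le_sinh[of s] by (auto intro!: power_mono)
  have c0: "0 < c" by (simp add: c_def add_pos_nonneg)
  have cle: "c * s\<^sup>2 \<le> 1 + s\<^sup>2" using sh by (simp add: c_def field_simps)
  \<comment> \<open>Here \<open>c * s^2\<close> is the square of \<open>s / tanh s\<close>, so the
    claim is \<open>tanh s <= s\<close>.\<close>
  have cge: "1 \<le> c * s\<^sup>2"
  proof -
    have "sinh s \<le> s * cosh s" using tanh_le[of s] s by (simp add: tanh_def field_simps)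
    then have "(sinh s)\<^sup>2 \<le> (s * cosh s)\<^sup>2" using sh by (intro power_mono) auto
    also have "\<dots> = s\<^sup>2 * (1 + (sinh s)\<^sup>2)" by (simp add: power_mult_distrib cosh_square_eq add.commute)
    finally show ?thesis using sh by (simp add: c_def field_simps)
  qed
  define r1 where "r1 = y (x - h) - 2 * y x + y (x + h) - h\<^sup>2 * y2 x"
  define r2 where "r2 = y2 (x - h) - 2 * y2 x + y2 (x + h)"
  have h2: "h\<^sup>2 = 4 / b\<^sup>2 * s\<^sup>2" using s by (simp add: power_divide power_mult_distrib)
  have eb: "eps\<^sup>2 / gam = 1 / b\<^sup>2" using b pos by simp
  have "disc_op b h h (y (x - h)) (y x) (y (x + h)) - eps\<^sup>2 / gam * (y2 (x - h) + 2 * y2 x + y2 (x + h))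
      = c * (h\<^sup>2 * y2 x + r1) - 1 / b\<^sup>2 * (4 * y2 x + r2)"
    unfolding eb using disc_op_uniform[OF b(1) pos(3)]
    by (simp add: c_def s_def b_def r1_def r2_def algebra_simps)
  also have "\<dots> = 4 / b\<^sup>2 * (c * s\<^sup>2 - 1) * y2 x + c * r1 - r2 / b\<^sup>2"
    unfolding h2 by (simp add: algebra_simps diff_divide_distrib)
  finally have eq: "disc_op b h h (y (x - h)) (y x) (y (x + h))
      - eps\<^sup>2 / gam * (y2 (x - h) + 2 * y2 x + y2 (x + h))
      = 4 / b\<^sup>2 * (c * s\<^sup>2 - 1) * y2 x + c * r1 - r2 / b\<^sup>2" .
  have t1: "\<bar>4 / b\<^sup>2 * (c * s\<^sup>2 - 1) * y2 x\<bar> \<le> h\<^sup>2 * (A / eps\<^sup>2)"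
  proof -
    have "\<bar>4 / b\<^sup>2 * (c * s\<^sup>2 - 1) * y2 x\<bar> = 4 / b\<^sup>2 * (c * s\<^sup>2 - 1) * \<bar>y2 x\<bar>"
      using cge by (simp add: abs_mult)
    also have "\<dots> \<le> 4 / b\<^sup>2 * s\<^sup>2 * (A / eps\<^sup>2)"
      using cle cge y2 pos by (intro mult_mono) (auto simp: field_simps)
    finally show ?thesis using h2 by simp
  qed
  have t2: "\<bar>c * r1\<bar> \<le> 4 * (1 + s\<^sup>2) / (3 * b\<^sup>2) * h\<^sup>2 * B"
  proof -
    have "\<bar>c * r1\<bar> \<le> c * (B * h ^ 4 / 3)"
      unfolding abs_mult using c0 R1 by (simp add: r1_def)
    also have "h ^ 4 = 4 / b\<^sup>2 * s\<^sup>2 * h\<^sup>2" unfolding h2[symmetric] by (simp add: power4_eq_xxxx power2_eq_square)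
    also have "c * (B * (4 / b\<^sup>2 * s\<^sup>2 * h\<^sup>2) / 3) = c * s\<^sup>2 * (4 / (3 * b\<^sup>2) * h\<^sup>2 * B)"
      by (simp add: mult_ac)
    also have "\<dots> \<le> (1 + s\<^sup>2) * (4 / (3 * b\<^sup>2) * h\<^sup>2 * B)"
      using cle B0 by (intro mult_right_mono) auto
    also have "\<dots> = 4 * (1 + s\<^sup>2) / (3 * b\<^sup>2) * h\<^sup>2 * B" by (simp add: mult_ac)
    finally show ?thesis .
  qed
  have t3: "\<bar>r2 / b\<^sup>2\<bar> \<le> 2 / b\<^sup>2 * h\<^sup>2 * B"
    using divide_right_mono[OF R2, of "b\<^sup>2"] by (simp add: r2_def mult_ac)
  have "\<bar>4 / b\<^sup>2 * (c * s\<^sup>2 - 1) * y2 x + c * r1 - r2 / b\<^sup>2\<bar>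
      \<le> h\<^sup>2 * (A / eps\<^sup>2) + 4 * (1 + s\<^sup>2) / (3 * b\<^sup>2) * h\<^sup>2 * B + 2 / b\<^sup>2 * h\<^sup>2 * B"
    using t1 t2 t3 by linarith
  also have "\<dots> = h\<^sup>2 * (A / eps\<^sup>2) + (10 / 3 + 4 / 3 * s\<^sup>2) * (h\<^sup>2 * B / b\<^sup>2)"
    using b(1) by (simp add: field_simps)
  also have "\<dots> \<le> h\<^sup>2 * (A / eps\<^sup>2) + (4 + 2 * s\<^sup>2) * (h\<^sup>2 * B / b\<^sup>2)"
    using B0 by (intro add_left_mono mult_right_mono) (use zero_le_power2[of s] in \<open>linarith | simp\<close>)+
  also have "h\<^sup>2 * B / b\<^sup>2 = h\<^sup>2 * A / (eps\<^sup>2 * gam)"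
    using b pos by (simp add: B_def field_simps power4_eq_xxxx power2_eq_square)
  also have "h\<^sup>2 * (A / eps\<^sup>2) + (4 + 2 * s\<^sup>2) * (h\<^sup>2 * A / (eps\<^sup>2 * gam))
      = h\<^sup>2 / eps\<^sup>2 * (1 + (4 + 2 * s\<^sup>2) / gam) * A"
    using pos by (simp add: field_simps)
  finally show ?thesis unfolding b_def[symmetric] eq .
qed

text \<open>A discrete maximum principle for \<open>e - w\<close>. The barrier is tested only
  against the constant slope \<open>m\<close>, although the actual slopes \<open>c\<close> vary;
  nonnegativity of \<open>w\<close> bridges the two.\<close>

lemma discrete_comparison_upper:
  fixes e w c h tau :: "nat \<Rightarrow> real"
  assumes b: "0 < b" and m: "0 < m" and h: "\<And>i. i < N \<Longrightarrow> 0 < h i"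
    and c: "\<And>i. i \<le> N \<Longrightarrow> m \<le> c i \<and> c i \<le> gam"
    and w: "\<And>i. i \<le> N \<Longrightarrow> 0 \<le> w i"
    and bdry: "e 0 \<le> w 0" "e N \<le> w N"
    and e: "\<And>i. 0 < i \<Longrightarrow> i < N \<Longrightarrow> - tau i \<le> disc_op b (h (i - 1)) (h i) (e (i - 1)) (e i) (e (i + 1))
        - (c (i - 1) * e (i - 1) + 2 * (c i * e i) + c (i + 1) * e (i + 1)) / gam"
    and barrier: "\<And>i. 0 < i \<Longrightarrow> i < N \<Longrightarrow> disc_op b (h (i - 1)) (h i) (w (i - 1)) (w i) (w (i + 1))
        - m / gam * (w (i - 1) + 2 * w i + w (i + 1)) \<le> - tau i"
    and "i \<le> N"
  shows "e i \<le> w i"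
proof (rule ccontr)
  assume neg: "\<not> e i \<le> w i"
  define u where "u = (\<lambda>i. e i - w i)"
  have "finite {..N}" "{..N} \<noteq> {}" by auto
  then obtain j where j: "j \<le> N" "\<And>i. i \<le> N \<Longrightarrow> u i \<le> u j"
    using obtains_MAX[of "{..N}" u] by (metis Max_ge atMost_iff finite_imageI image_eqI)
  have uj: "0 < u j" using j(2)[OF \<open>i \<le> N\<close>] neg by (simp add: u_def)
  then have jN: "0 < j" "j < N" using bdry j(1) by (auto simp: u_def intro!: Nat.gr0I le_neq_implies_less)
  have gam: "0 < gam" using c[of 0] m by simp
  define al ar where "al = wgt b (h (j - 1)) (h j)" and "ar = wgt b (h j) (h (j - 1))"
  have al: "0 < al" "0 < ar" using h[of j] h[of "j - 1"] jN b by (auto simp: al_def ar_def intro!: wgt_pos)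
  have cs: "m \<le> c (j - 1)" "c (j - 1) \<le> gam" "m \<le> c j" "c j \<le> gam" "m \<le> c (j + 1)" "c (j + 1) \<le> gam"
    using c[of "j - 1"] c[of j] c[of "j + 1"] jN by auto
  have us: "u (j - 1) \<le> u j" "u (j + 1) \<le> u j" using j(2)[of "j - 1"] j(2)[of "j + 1"] jN by auto
  have ws: "0 \<le> w (j - 1)" "0 \<le> w j" "0 \<le> w (j + 1)" using w jN by auto
  have "m * (w (j - 1) + 2 * w j + w (j + 1)) \<le> c (j - 1) * w (j - 1) + 2 * (c j * w j) + c (j + 1) * w (j + 1)"
    using mult_right_mono[OF cs(1) ws(1)] mult_right_mono[OF cs(3) ws(2)]
      mult_right_mono[OF cs(5) ws(3)] by (simp add: distrib_left)
  then have "m / gam * (w (j - 1) + 2 * w j + w (j + 1))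
      \<le> (c (j - 1) * w (j - 1) + 2 * (c j * w j) + c (j + 1) * w (j + 1)) / gam"
    using gam divide_right_mono[of _ _ gam] by fastforce
  then have "0 \<le> disc_op b (h (j - 1)) (h j) (e (j - 1)) (e j) (e (j + 1))
      - disc_op b (h (j - 1)) (h j) (w (j - 1)) (w j) (w (j + 1))
      - (c (j - 1) * e (j - 1) + 2 * (c j * e j) + c (j + 1) * e (j + 1)) / gam
      + (c (j - 1) * w (j - 1) + 2 * (c j * w j) + c (j + 1) * w (j + 1)) / gam"
    using e[OF jN] barrier[OF jN] by linarith
  \<comment> \<open>Regrouped around the maximising index: \<open>c <= gam\<close> makes the
    coefficients of the neighbour differences nonnegative, and \<open>c >= m > 0\<close> makes the
    last term strictly negative.\<close>
  also have "\<dots> = (al + (1 - c (j - 1) / gam)) * (u (j - 1) - u j)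
      + (ar + (1 - c (j + 1) / gam)) * (u (j + 1) - u j)
      - (c (j - 1) + 2 * c j + c (j + 1)) / gam * u j"
    using gam by (simp add: disc_op_def al_def ar_def u_def field_simps)
  also have "\<dots> < 0"
  proof -
    have "(al + (1 - c (j - 1) / gam)) * (u (j - 1) - u j) \<le> 0"
      "(ar + (1 - c (j + 1) / gam)) * (u (j + 1) - u j) \<le> 0"
      using al us cs gam by (auto intro!: mult_nonneg_nonpos add_nonneg_nonneg simp: divide_le_eq_1)
    moreover have "0 < (c (j - 1) + 2 * c j + c (j + 1)) / gam * u j"
      using cs m gam uj by (intro mult_pos_pos divide_pos_pos) auto
    ultimately show ?thesis by linarith
  qed
  finally show False by simp
qed

lemma disc_op_uminus: "disc_op b hl hr (- u) (- v) (- w) = - disc_op b hl hr u v w"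
  by (simp add: disc_op_def algebra_simps)

lemma discrete_comparison:
  fixes e w c h tau :: "nat \<Rightarrow> real"
  assumes b: "0 < b" and m: "0 < m" and h: "\<And>i. i < N \<Longrightarrow> 0 < h i"
    and c: "\<And>i. i \<le> N \<Longrightarrow> m \<le> c i \<and> c i \<le> gam"
    and w: "\<And>i. i \<le> N \<Longrightarrow> 0 \<le> w i"
    and bdry: "e 0 = 0" "e N = 0"
    and e: "\<And>i. 0 < i \<Longrightarrow> i < N \<Longrightarrow> \<bar>disc_op b (h (i - 1)) (h i) (e (i - 1)) (e i) (e (i + 1))
        - (c (i - 1) * e (i - 1) + 2 * (c i * e i) + c (i + 1) * e (i + 1)) / gam\<bar> \<le> tau i"
    and barrier: "\<And>i. 0 < i \<Longrightarrow> i < N \<Longrightarrow> disc_op b (h (i - 1)) (h i) (w (i - 1)) (w i) (w (i + 1))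
        - m / gam * (w (i - 1) + 2 * w i + w (i + 1)) \<le> - tau i"
    and "i \<le> N"
  shows "\<bar>e i\<bar> \<le> w i"
proof -
  have "e i \<le> w i"
  proof (rule discrete_comparison_upper[OF b m h c w _ _ _ barrier \<open>i \<le> N\<close>])
    fix i assume i: "0 < i" "i < N"
    show "- tau i \<le> disc_op b (h (i - 1)) (h i) (e (i - 1)) (e i) (e (i + 1)) -
        (c (i - 1) * e (i - 1) + 2 * (c i * e i) + c (i + 1) * e (i + 1)) / gam"
      using e[OF i] by linarith
  qed (use w bdry in auto)
  moreover have "- e i \<le> w i"
  proof (rule discrete_comparison_upper[OF b m h c w _ _ _ barrier \<open>i \<le> N\<close>, where e = "\<lambda>i. - e i"])
    fix i assume i: "0 < i" "i < N"
    have "(c (i - 1) * - e (i - 1) + 2 * (c i * - e i) + c (i + 1) * - e (i + 1)) / gam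
        = - ((c (i - 1) * e (i - 1) + 2 * (c i * e i) + c (i + 1) * e (i + 1)) / gam)"
      by (simp add: minus_divide_left del: minus_divide_left[symmetric])
    then show "- tau i \<le> disc_op b (h (i - 1)) (h i) (- e (i - 1)) (- e i) (- e (i + 1)) -
        (c (i - 1) * - e (i - 1) + 2 * (c i * - e i) + c (i + 1) * - e (i + 1)) / gam"
      unfolding disc_op_uminus using e[OF i] by linarith
  qed (use w bdry in auto)
  ultimately show ?thesis by (simp add: abs_le_iff)
qed


section \<open>The smoothed Shishkin mesh and the barrier\<close>

locale shishkin_mesh =
  fixes m gam eps :: real and N :: nat
  assumes m_pos: "0 < m" and m_le_gam: "m \<le> gam" and eps_pos: "0 < eps"
    and N_pos: "0 < N" and N_dvd: "4 dvd N" and lam_le: "lam_mesh m eps N \<le> q_mesh"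
begin

definition n :: nat where "n = N div 4"
definition lam :: real where "lam = lam_mesh m eps N"
definition h0 :: real where "h0 = lam / real n"
definition L :: real where "L = ln (real N)"

abbreviation x :: "nat \<Rightarrow> real" where "x i \<equiv> xm m eps N i"
abbreviation h :: "nat \<Rightarrow> real" where "h i \<equiv> hm m eps N i"

lemma N_eq: "N = 4 * n" using N_dvd by (simp add: n_def)

lemma n_pos: "0 < n" using N_pos N_eq by auto

lemma N_real: "real N = 4 * real n" using N_eq by simp

lemma N_ge: "4 \<le> real N" using n_pos N_eq by simp

lemma L_gt_1: "1 < L"
proof -
  have "exp 1 < real N" using exp_le N_ge by linarith
  then show ?thesis unfolding L_def using N_ge ln_less_cancel_iff[of "exp 1" "real N"] by simp
qed

lemma exp_L: "exp L = real N" using N_ge by (simp add: L_def)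

lemma L_le_N: "L \<le> real N"
  using exp_ge_add_one_self[of L] exp_L by linarith

text \<open>Since \<open>s\<close> is of order \<open>L / N\<close>, this keeps the product
  \<open>L * s\<close> bounded, which is the correction incurred when \<open>tanh s\<close> is
  replaced by \<open>s\<close>.\<close>

lemma L_square_le: "L\<^sup>2 \<le> 4 * real N"
proof -
  have "L\<^sup>2 \<le> (2 * sqrt (real N))\<^sup>2"
    using L_gt_1 ln_le_sqrt[of "real N"] N_ge by (intro power_mono) (auto simp: L_def)
  then show ?thesis by (simp add: power_mult_distrib)
qed

lemma lam_eq: "lam = 2 * eps / sqrt m * L" by (simp add: lam_def lam_mesh_def L_def)

lemma lam_bounds: "0 < lam" "lam \<le> 1 / 4"
  using lam_le L_gt_1 eps_pos m_pos by (auto simp: lam_eq q_mesh_def lam_def[symmetric])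

lemma h0_pos: "0 < h0" using lam_bounds n_pos by (simp add: h0_def)

lemma h0_eq: "h0 = 8 * eps * L / (sqrt m * real N)"
  by (simp add: h0_def lam_eq N_real)

definition p :: real where "p = 32 * (1 - 4 * lam)"

lemma p_bounds: "0 \<le> p" "p \<le> 32" using lam_bounds by (auto simp: p_def)

lemma p_mesh_eq: "p_mesh lam = p"
proof -
  have "(1 / 4 :: real) powr (-3) = 64"
    by (simp add: powr_minus powr_numeral power_divide)
  then show ?thesis by (simp add: p_mesh_def q_mesh_def p_def)
qed

lemma x_left: assumes "i \<le> n" shows "x i = real i * h0"
proof -
  have "real i / real N \<le> 1 / 4" using assms n_pos by (simp add: N_real)
  then show ?thesis using n_pos
    by (simp add: xm_def phi_mesh_def phi0_def q_mesh_def lam_def[symmetric] h0_def N_real)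
qed

lemma x_mid:
  assumes "n \<le> i" "i \<le> 2 * n"
  shows "x i = real i * h0 + p * ((real i - real n) / real N) ^ 3"
proof (cases "i = n")
  case True
  then show ?thesis using x_left by simp
next
  case False
  then have "n < i" using assms by simp
  then have "1 / 4 < real i / real N" "real i / real N \<le> 1 / 2"
    using assms n_pos by (auto simp: N_real field_simps)
  moreover have "real i / real N - 1 / 4 = (real i - real n) / real N"
    using n_pos by (simp add: N_real field_simps)
  ultimately show ?thesis using n_pos
    by (simp add: xm_def phi_mesh_def phi0_def q_mesh_def lam_def[symmetric] h0_def N_real p_mesh_eq)
qed

text \<open>The coefficient \<open>p\<close> is chosen for exactly this: the linear part contributes
  \<open>2 * lam\<close>, the cubic the rest, so the mesh function meets its reflection at the
  midpoint.\<close>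

lemma x_half: "x (2 * n) = 1 / 2"
proof -
  have "(real n / real N) ^ 3 = 1 / 64" using n_pos by (simp add: N_real power_divide)
  then show ?thesis using x_mid[of "2 * n"] n_pos by (simp add: p_def h0_def field_simps)
qed

lemma x_sym: assumes "i \<le> N" shows "x (N - i) = 1 - x i"
proof -
  have *: "x (N - j) = 1 - x j" if "j < 2 * n" for j
  proof -
    have 1: "real (N - j) / real N = 1 - real j / real N" using that n_pos N_eq by (simp add: field_simps)
    have 2: "real j / real N < 1 / 2" using that n_pos by (simp add: N_real field_simps)
    then have "\<not> 1 - real j / real N \<le> 1 / 2" by linarith
    with 2 show ?thesis unfolding xm_def phi_mesh_def 1 by (simp only: if_False if_True less_imp_le) simp
  qed
  consider "i < 2 * n" | "i = 2 * n" | "2 * n < i" by linarith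
  then show ?thesis
  proof cases
    case 2
    then have "N - i = 2 * n" using N_eq by simp
    then show ?thesis using 2 x_half by simp
  next
    case 3
    then show ?thesis using *[of "N - i"] assms N_eq by simp
  qed (use * in auto)
qed

lemma h_left: "i < n \<Longrightarrow> h i = h0"
  using x_left[of i] x_left[of "i + 1"] by (simp add: hm_def algebra_simps)

lemma h_mid:
  assumes "n \<le> i" "i < 2 * n"
  shows "h i = h0 + p * (3 * (real i - real n)\<^sup>2 + 3 * (real i - real n) + 1) / real N ^ 3"
proof -
  define a where "a = real i - real n"
  have "h i = h0 + p * (((a + 1) / real N) ^ 3 - (a / real N) ^ 3)"
    using x_mid[of i] x_mid[of "i + 1"] assms by (simp add: hm_def a_def algebra_simps)
  moreover have "((a + 1) / real N) ^ 3 - (a / real N) ^ 3 = ((a + 1) ^ 3 - a ^ 3) / real N ^ 3"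
    by (simp only: power_divide diff_divide_distrib)
  moreover have "(a + 1) ^ 3 - a ^ 3 = 3 * a\<^sup>2 + 3 * a + 1"
    by (simp add: power2_eq_square power3_eq_cube algebra_simps)
  ultimately show ?thesis by (simp add: a_def)
qed

lemma h_sym: assumes "i < N" shows "h (N - 1 - i) = h i"
proof -
  have "N - 1 - i + 1 = N - i" "N - 1 - i = N - (i + 1)" using assms by auto
  then have "h (N - 1 - i) = x (N - i) - x (N - (i + 1))" unfolding hm_def by metis
  then show ?thesis using x_sym[of i] x_sym[of "i + 1"] assms by (simp add: hm_def)
qed

text \<open>A reflection principle: a property of step sizes need only be verified on the left half
  of the mesh.\<close>

lemma half_induct:
  assumes "\<And>i. i < 2 * n \<Longrightarrow> P (h i)" and "i < N" shows "P (h i)"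
proof (cases "i < 2 * n")
  case False
  then show ?thesis using assms(1)[of "N - 1 - i"] h_sym[of i] assms(2) N_eq by auto
qed (use assms in auto)

lemma h_ge: assumes "i < N" shows "h0 \<le> h i"
proof (rule half_induct[OF _ assms])
  fix i assume "i < 2 * n"
  then show "h0 \<le> h i"
    using h_left[of i] h_mid[of i] p_bounds by (cases "i < n") auto
qed

lemma h_pos: "i < N \<Longrightarrow> 0 < h i" using h_ge h0_pos by force

lemma h_le: assumes "i < N" shows "h i \<le> 7 / real N"
proof (rule half_induct[OF _ assms])
  fix i assume i: "i < 2 * n"
  \<comment> \<open>The 7 is composed of 1 from this linear part and 6 from the cubic part, where
    \<open>p <= 32\<close> and \<open>n = N / 4\<close>.\<close>
  have h0: "h0 \<le> 1 / real N" using lam_bounds n_pos by (simp add: h0_def N_real field_simps)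
  show "h i \<le> 7 / real N"
  proof (cases "i < n")
    case True
    have "1 / real N \<le> 7 / real N" by (intro divide_right_mono) auto
    then show ?thesis using True h_left h0 by simp
  next
    case False
    define j where "j = real i - real n"
    have j: "0 \<le> j" "j + 1 \<le> real n" using i False by (auto simp: j_def)
    have "3 * j\<^sup>2 + 3 * j + 1 \<le> 3 * (j + 1)\<^sup>2" using j by (simp add: power2_eq_square algebra_simps)
    also have "\<dots> \<le> 3 * (real n)\<^sup>2" using j by (intro mult_left_mono power_mono) auto
    finally have "p * (3 * j\<^sup>2 + 3 * j + 1) \<le> 32 * (3 * (real n)\<^sup>2)"
      using p_bounds j by (intro mult_mono) auto
    then have "p * (3 * j\<^sup>2 + 3 * j + 1) / real N ^ 3 \<le> 32 * (3 * (real n)\<^sup>2) / real N ^ 3"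
      by (intro divide_right_mono) auto
    also have "\<dots> = 6 / real N" using n_pos by (simp add: N_real power2_eq_square power3_eq_cube)
    finally show ?thesis using h_mid[of i] i False h0 by (simp add: j_def)
  qed
qed

text \<open>Second differences of a cubic are linear: \<open>6 * p * j / N^3\<close> with
  \<open>j <= N / 4\<close> and \<open>p <= 32\<close>. At the transition the pieces agree to second
  order, leaving a jump of only \<open>p / N^3\<close>, and at the midpoint both steps coincide by
  symmetry.\<close>

lemma h_diff: assumes "n \<le> i" "i \<le> 3 * n" shows "\<bar>h i - h (i - 1)\<bar> \<le> 48 / (real N)\<^sup>2"
proof -
  have *: "\<bar>h i - h (i - 1)\<bar> \<le> 48 / (real N)\<^sup>2" if "n \<le> i" "i < 2 * n" for i
  proof (cases "i = n")
    case True
    then have "h i - h (i - 1) = p / real N ^ 3" using h_mid[of i] h_left[of "i - 1"] n_pos by simp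
    moreover have "p / real N ^ 3 \<le> 48 / (real N)\<^sup>2"
    proof -
      have "p * 1 \<le> 48 * real N" using p_bounds N_ge by linarith
      then have "p / real N ^ 3 \<le> 48 * real N / real N ^ 3" by (intro divide_right_mono) auto
      then show ?thesis using N_pos by (simp add: power2_eq_square power3_eq_cube)
    qed
    ultimately show ?thesis using p_bounds by simp
  next
    case False
    define j where "j = real i - real n"
    have j: "0 \<le> j" "j \<le> real n" using that by (auto simp: j_def)
    have "real (i - 1) - real n = j - 1" using that False by (auto simp: j_def)
    then have "h i - h (i - 1) = p * (3 * j\<^sup>2 + 3 * j + 1) / real N ^ 3
        - p * (3 * (j - 1)\<^sup>2 + 3 * (j - 1) + 1) / real N ^ 3"
      using h_mid[of i] h_mid[of "i - 1"] that False by (simp add: j_def)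
    also have "\<dots> = p * (6 * j) / real N ^ 3"
      by (simp add: diff_divide_distrib[symmetric] power2_eq_square algebra_simps)
    finally have eq: "h i - h (i - 1) = p * (6 * j) / real N ^ 3" .
    have "p * (6 * j) \<le> 32 * (6 * real n)" using p_bounds j by (intro mult_mono) auto
    then have "p * (6 * j) / real N ^ 3 \<le> 32 * (6 * real n) / real N ^ 3"
      by (intro divide_right_mono) auto
    also have "\<dots> = 48 / (real N)\<^sup>2" using n_pos by (simp add: N_real power2_eq_square power3_eq_cube)
    finally show ?thesis using eq p_bounds j by simp
  qed
  consider "i < 2 * n" | "i = 2 * n" | "2 * n < i" by linarith
  then show ?thesis
  proof cases
    case 1 then show ?thesis using * assms by simp
  next
    case 2
    then have "N - 1 - i = i - 1" using N_eq by simp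
    then have "h (i - 1) = h i" using 2 h_sym[of i] N_eq n_pos by simp
    then show ?thesis by simp
  next
    case 3
    have "h (N - i) = h (i - 1)" "h (N - i - 1) = h i"
      using h_sym[of i] h_sym[of "i - 1"] 3 assms N_eq n_pos by (auto simp: diff_commute)
    then show ?thesis using *[of "N - i"] 3 assms N_eq by (simp add: abs_minus_commute)
  qed
qed

lemma h_outer: assumes "i < n \<or> 3 * n \<le> i" "i < N" shows "h i = h0"
  using assms h_left[of i] h_left[of "N - 1 - i"] h_sym[of i] N_eq by auto

lemma x_mono: assumes "i \<le> j" "j \<le> N" shows "x i \<le> x j"
  using assms
proof (induction j rule: dec_induct)
  case (step j)
  then show ?case using h_pos[of j] by (simp add: hm_def)
qed simp

lemma x_0: "x 0 = 0" using x_left[of 0] by simp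
lemma x_N: "x N = 1" using x_sym[of 0] x_0 by simp

lemma x_01: "i \<le> N \<Longrightarrow> x i \<in> {0..1}"
  using x_mono[of 0 i] x_mono[of i N] x_0 x_N by auto

lemma x_pred: "0 < i \<Longrightarrow> x (i - 1) = x i - h (i - 1)" by (simp add: hm_def)
lemma x_succ: "x (i + 1) = x i + h i" by (simp add: hm_def)

text \<open>The transition nodes \<open>n\<close> and \<open>3 * n\<close> are treated as coarse,
  and their stencils reach one step into the layers; hence \<open>lam - h0\<close> instead of
  \<open>lam\<close>.\<close>

lemma x_stencil_coarse:
  assumes "n \<le> i" "i \<le> 3 * n"
  shows "lam - h0 \<le> x (i - 1)" "x (i + 1) \<le> 1 - (lam - h0)"
proof -
  have "x (n - 1) = lam - h0" using x_left[of "n - 1"] n_pos by (simp add: h0_def field_simps)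
  moreover have "x (n - 1) \<le> x (i - 1)" using assms N_eq by (intro x_mono) auto
  moreover have "x (i + 1) \<le> x (N - (n - 1))" using assms N_eq n_pos by (intro x_mono) auto
  moreover have "x (N - (n - 1)) = 1 - x (n - 1)" using N_eq by (intro x_sym) auto
  ultimately show "lam - h0 \<le> x (i - 1)" "x (i + 1) \<le> 1 - (lam - h0)" by auto
qed

lemma exp_lam: "exp (- (sqrt m * lam / eps)) = 1 / (real N)\<^sup>2"
proof -
  have "sqrt m * lam / eps = 2 * L" using m_pos eps_pos by (simp add: lam_eq)
  then have "exp (- (sqrt m * lam / eps)) = 1 / (exp L)\<^sup>2"
    by (simp add: exp_minus exp_double inverse_eq_divide)
  then show ?thesis by (simp add: exp_L)
qed

lemma h0_scaled_le: "sqrt m * h0 / eps \<le> 8"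
proof -
  have "sqrt m * h0 / eps = 8 * (L / real N)" using m_pos eps_pos by (simp add: h0_eq)
  moreover have "L / real N \<le> 1" using L_le_N N_pos by (simp add: divide_le_eq_1)
  ultimately show ?thesis by linarith
qed

text \<open>The factor \<open>exp 8\<close> is the price of that one step \<open>h0\<close> beyond
  the transition point; the 2 counts the two exponentials.\<close>

lemma layer_coarse:
  assumes "lam - h0 \<le> t" "t \<le> 1 - (lam - h0)"
  shows "layer m eps t \<le> 2 * exp 8 / (real N)\<^sup>2"
proof -
  have *: "exp (- (sqrt m * r / eps)) \<le> exp 8 / (real N)\<^sup>2" if "lam - h0 \<le> r" for r
  proof -
    have "sqrt m * (lam - h0) / eps \<le> sqrt m * r / eps"
      using that m_pos eps_pos by (intro divide_right_mono mult_left_mono) auto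
    then have "- (sqrt m * r / eps) \<le> 8 + - (sqrt m * lam / eps)"
      using h0_scaled_le by (simp add: right_diff_distrib diff_divide_distrib)
    then have "exp (- (sqrt m * r / eps)) \<le> exp (8 + - (sqrt m * lam / eps))" by simp
    then show ?thesis unfolding exp_add exp_lam by simp
  qed
  show ?thesis using *[of t] *[of "1 - t"] assms by (simp add: layer_def)
qed

text \<open>On the uniform part of the mesh \<open>mu ^ i\<close> is an eigenfunction of the difference operator. The
  factor \<open>3 / 4\<close> in \<open>r\<close> leaves room for a strictly negative value; anything strictly between
  \<open>1 / 2\<close> and \<open>1\<close> would do, the lower limit being needed for the decay up to \<open>i = n\<close>.\<close>

definition kap :: real where "kap = sqrt m / sqrt gam"
definition s :: real where "s = sqrt gam / eps * h0 / 2"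
definition r :: real where "r = 3 / 4 * (kap * tanh s)"
definition mu :: real where "mu = (1 - r) / (1 + r)"

lemma gam_pos: "0 < gam" using m_pos m_le_gam by simp

lemma kap_bounds: "0 < kap" "kap \<le> 1" "kap\<^sup>2 = m / gam"
  using m_pos m_le_gam gam_pos by (auto simp: kap_def power_divide)

lemma s_pos: "0 < s" using h0_pos eps_pos gam_pos by (simp add: s_def)

lemma s_eq: "s = 4 * L / (kap * real N)"
  using eps_pos m_pos gam_pos by (simp add: s_def h0_eq kap_def field_simps)

lemma s_le: "s \<le> 4 / kap"
proof -
  have "s = 4 / kap * (L / real N)" by (simp add: s_eq)
  also have "\<dots> \<le> 4 / kap * 1" using L_le_N N_pos kap_bounds by (intro mult_left_mono) auto
  finally show ?thesis by simp
qed

text \<open>The bound 3/4 keeps \<open>mu\<close> away from 0, \<open>r <= s\<close> limits the kink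
  of the barrier, and \<open>r <= tanh (kap * s)\<close> makes the barrier dominate the layer
  exponential.\<close>

lemma r_bounds: "0 < r" "r \<le> 3 / 4" "r \<le> s" "r \<le> tanh (kap * s)"
proof -
  have t: "0 < tanh s" "tanh s < 1" "tanh s \<le> s" using s_pos tanh_real_lt_1 tanh_le[of s] by auto
  have k: "kap * tanh s \<le> 1 * tanh s" using kap_bounds t by (intro mult_right_mono) auto
  have k': "0 < kap * tanh s" using kap_bounds t by simp
  show "0 < r" "r \<le> 3 / 4" "r \<le> s" using t k k' by (auto simp: r_def)
  show "r \<le> tanh (kap * s)"
    using tanh_scale_ge[of kap s] kap_bounds s_pos k' unfolding r_def by linarith
qed

lemma mu_bounds: "0 < mu" "mu \<le> 1" using r_bounds by (auto simp: mu_def)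

text \<open>Over one fine step the exponential shrinks by \<open>exp (- 2 * (kap * s))\<close>,
  which is at most \<open>mu\<close>.\<close>

lemma exp_le_mu_power: assumes "i \<le> n" shows "exp (- (sqrt m * x i / eps)) \<le> mu ^ i"
proof -
  have e: "sqrt m * h0 / eps = 2 * (kap * s)" using gam_pos by (simp add: kap_def s_def)
  have "sqrt m * x i / eps = real i * (sqrt m * h0 / eps)" using x_left[OF assms] by simp
  then have "exp (- (sqrt m * x i / eps)) = exp (real i * (- 2 * (kap * s)))" unfolding e by simp
  also have "\<dots> = exp (- 2 * (kap * s)) ^ i" by (rule exp_of_nat_mult)
  also have "\<dots> \<le> mu ^ i"
    unfolding mu_def using exp_le_moebius[of r "kap * s"] r_bounds by (intro power_mono) auto
  finally show ?thesis .
qed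

definition W :: "nat \<Rightarrow> real" where "W i = mu ^ min (min i (N - i)) n"

lemma W_sym: "i \<le> N \<Longrightarrow> W (N - i) = W i"
  by (simp add: W_def min.commute)

lemma W_bounds: "0 < W i" "W i \<le> 1"
  using mu_bounds by (auto simp: W_def power_le_one)

lemma W_left: assumes "i \<le> n" shows "W i = mu ^ i"
proof -
  have "min (min i (N - i)) n = i" using assms N_eq by linarith
  then show ?thesis by (simp add: W_def)
qed

lemma W_mid: assumes "n \<le> i" "i \<le> 3 * n" shows "W i = mu ^ n"
proof -
  have "min (min i (N - i)) n = n" using assms N_eq by linarith
  then show ?thesis by (simp add: W_def)
qed

lemma layer_sym: "layer m eps (1 - t) = layer m eps t" by (simp add: layer_def)

text \<open>The nearby exponential is covered by \<open>W\<close>; the one from the opposite end has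
  at least \<open>lam\<close> to decay, hence the additional \<open>1 / N^2\<close>.\<close>

lemma layer_fine:
  assumes "i \<le> n \<or> 3 * n \<le> i" "i \<le> N"
  shows "layer m eps (x i) \<le> W i + 1 / (real N)\<^sup>2"
proof -
  have *: "layer m eps (x j) \<le> W j + 1 / (real N)\<^sup>2" if "j \<le> n" for j
  proof -
    have "x j \<le> x n" using that N_eq by (intro x_mono) auto
    also have "x n = lam" using x_left[of n] n_pos by (simp add: h0_def)
    finally have "lam \<le> 1 - x j" using lam_bounds by linarith
    then have "sqrt m * lam / eps \<le> sqrt m * (1 - x j) / eps"
      using m_pos eps_pos by (intro divide_right_mono mult_left_mono) auto
    then have "exp (- (sqrt m * (1 - x j) / eps)) \<le> 1 / (real N)\<^sup>2" unfolding exp_lam[symmetric] by simp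
    then show ?thesis using exp_le_mu_power[OF that] W_left[OF that] by (simp add: layer_def)
  qed
  show ?thesis
  proof (cases "i \<le> n")
    case False
    then have "N - i \<le> n" using assms N_eq by auto
    from *[OF this] show ?thesis using W_sym[OF assms(2)] x_sym[OF assms(2)] by (simp add: layer_sym)
  qed (use * in auto)
qed

section \<open>The difference operator applied to the barrier\<close>

abbreviation barrier_op :: "(nat \<Rightarrow> real) \<Rightarrow> nat \<Rightarrow> real" where
  "barrier_op w i \<equiv> disc_op (sqrt gam / eps) (h (i - 1)) (h i) (w (i - 1)) (w i) (w (i + 1))
     - m / gam * (w (i - 1) + 2 * w i + w (i + 1))"

lemma barrier_op_sym:
  assumes "\<And>j. j \<le> N \<Longrightarrow> w (N - j) = w j" "0 < i" "i < N"
  shows "barrier_op w (N - i) = barrier_op w i"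
proof -
  have "N - i - 1 = N - 1 - i" "N - i = N - 1 - (i - 1)" using assms(2,3) by auto
  then have hs: "h (N - i - 1) = h i" "h (N - i) = h (i - 1)"
    using h_sym[of i] h_sym[of "i - 1"] assms(2,3) by (simp_all only: less_imp_diff_less)
  have ws: "w (N - i - 1) = w (i + 1)" "w (N - i) = w i" "w (N - i + 1) = w (i - 1)"
  proof -
    have "N - i - 1 = N - (i + 1)" "N - i + 1 = N - (i - 1)" using assms by auto
    then show "w (N - i - 1) = w (i + 1)" "w (N - i) = w i" "w (N - i + 1) = w (i - 1)"
      using assms(1)[of "i + 1"] assms(1)[of i] assms(1)[of "i - 1"] assms(2,3) by auto
  qed
  show ?thesis unfolding hs ws by (subst disc_op_commute) (simp add: add_ac)
qed

text \<open>The origin of \<open>r\<close> and \<open>mu\<close>: they satisfy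
  \<open>(1 - mu) / (1 + mu) = r\<close>, so multiplication by \<open>(coth s)^2\<close> turns
  \<open>(1 - mu)^2\<close> into \<open>9 / 16 * (m / gam) * (1 + mu)^2\<close>. Against the
  reaction part \<open>m / gam * (1 + mu)^2\<close> a gap of 7/16 remains, and
  \<open>(1 + mu)^2 >= 4 * mu\<close> makes it 7/4.\<close>

lemma barrier_fine:
  assumes "0 < i" "i < N" "i < n \<or> 3 * n < i"
  shows "barrier_op W i \<le> - (7 / 4 * (m / gam)) * W i"
proof -
  have *: "barrier_op W i \<le> - (7 / 4 * (m / gam)) * W i" if i: "0 < i" "i < n" for i
  proof -
    have Wi: "W i = mu * mu ^ (i - 1)" "W (i - 1) = mu ^ (i - 1)" "W (i + 1) = mu * mu * mu ^ (i - 1)"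
      using i W_left[of i] W_left[of "i - 1"] W_left[of "i + 1"]
      by (auto simp: power_eq_if[of mu i])
    define M where "M = mu ^ (i - 1)"
    have M: "0 < M" using mu_bounds by (simp add: M_def)
    have sh: "0 < sinh s" using s_pos by simp
    have co: "1 + 1 / (sinh s)\<^sup>2 = 1 / (tanh s)\<^sup>2"
      using sh by (simp add: tanh_def power_divide cosh_square_eq field_simps)
    have t: "0 < tanh s" using s_pos by simp
    have diff: "1 - mu = r * (1 + mu)" using r_bounds by (simp add: mu_def field_simps)
    have hi: "h (i - 1) = h0" "h i = h0" using i h_left by auto
    have b: "0 < sqrt gam / eps" using gam_pos eps_pos by simp
    have sq: "M - 2 * (mu * M) + mu * mu * M = (1 - mu)\<^sup>2 * M" "M + 2 * (mu * M) + mu * mu * M = (1 + mu)\<^sup>2 * M"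
      by (simp_all add: power2_eq_square algebra_simps)
    have "barrier_op W i = 1 / (tanh s)\<^sup>2 * ((1 - mu)\<^sup>2 * M) - m / gam * ((1 + mu)\<^sup>2 * M)"
      unfolding Wi hi disc_op_uniform[OF b h0_pos] s_def[symmetric] co M_def[symmetric] sq ..
    also have "1 / (tanh s)\<^sup>2 * ((1 - mu)\<^sup>2 * M) = 9 / 16 * (m / gam) * ((1 + mu)\<^sup>2 * M)"
      unfolding diff kap_bounds(3)[symmetric] using t by (simp add: r_def power_mult_distrib power_divide)
    also have "9 / 16 * (m / gam) * ((1 + mu)\<^sup>2 * M) - m / gam * ((1 + mu)\<^sup>2 * M)
        = - (7 / 16 * (m / gam)) * ((1 + mu)\<^sup>2 * M)" by (simp add: algebra_simps)
    also have "\<dots> \<le> - (7 / 16 * (m / gam)) * (4 * (mu * M))"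
    proof -
      have "0 \<le> (1 - mu)\<^sup>2 * M" using M by simp
      then have "4 * (mu * M) \<le> (1 + mu)\<^sup>2 * M" by (simp add: power2_eq_square algebra_simps)
      then have "7 / 16 * (m / gam) * (4 * (mu * M)) \<le> 7 / 16 * (m / gam) * ((1 + mu)\<^sup>2 * M)"
        using m_pos gam_pos by (intro mult_left_mono) auto
      then show ?thesis by simp
    qed
    finally show ?thesis by (simp add: Wi M_def)
  qed
  show ?thesis
  proof (cases "i < n")
    case False
    then have "0 < N - i" "N - i < n" using assms N_eq by auto
    from *[OF this] show ?thesis using barrier_op_sym[of W i] W_sym assms by auto
  qed (use * assms in auto)
qed

text \<open>Towards the middle \<open>W\<close> is flat, so only the difference on the layer side is
  harmful. Its coefficient is at most \<open>2 / s^2 + 1\<close>, while the difference itself is at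
  most \<open>8 * s * mu ^ n\<close>.\<close>

lemma barrier_transition:
  assumes "i = n \<or> i = 3 * n"
  shows "barrier_op W i \<le> (16 / s + 8 * s) * mu ^ n"
proof -
  have base: "barrier_op W n \<le> (16 / s + 8 * s) * mu ^ n"
  proof -
    define M where "M = mu ^ (n - 1)"
    have M: "0 < M" using mu_bounds by (simp add: M_def)
    have Wn: "W n = mu * M" "W (n - 1) = M" "W (n + 1) = mu * M"
      using n_pos W_left[of n] W_left[of "n - 1"] W_mid[of "n + 1"]
      by (auto simp: M_def power_eq_if[of mu n])
    define a where "a = wgt (sqrt gam / eps) (h (n - 1)) (h n)"
    have hn: "h (n - 1) = h0" "0 < h n" using h_left[of "n - 1"] n_pos h_pos[of n] N_eq by auto
    have a: "0 \<le> a" "a \<le> 2 / s\<^sup>2"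
    proof -
      have b: "0 < sqrt gam / eps" using gam_pos eps_pos by simp
      show "0 \<le> a" unfolding a_def using wgt_pos[OF b] hn h0_pos by (simp add: less_imp_le)
      have "a \<le> 2 / (sinh s)\<^sup>2" using wgt_le[OF b h0_pos hn(2)] unfolding a_def hn s_def .
      also have "\<dots> \<le> 2 / s\<^sup>2"
        using s_pos le_sinh[of s] by (intro divide_left_mono power_mono) auto
      finally show "a \<le> 2 / s\<^sup>2" .
    qed
    \<comment> \<open>Rewriting \<open>1 - mu\<close> as a multiple of \<open>mu\<close> refers the
      kink to the value at the transition node; \<open>1 - r >= 1 / 4\<close> and
      \<open>r <= s\<close> give the 8.\<close>
    have "M - mu * M \<le> 8 * s * (mu * M)"
    proof -
      have "1 - mu = 2 * r / (1 + r)" using r_bounds by (simp add: mu_def field_simps)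
      also have "\<dots> = 2 * r / (1 - r) * mu" using r_bounds by (simp add: mu_def)
      also have "\<dots> \<le> 8 * s * mu"
      proof -
        have "2 * r / (1 - r) \<le> 2 * r / (1 / 4)" using r_bounds by (intro divide_left_mono) auto
        also have "\<dots> \<le> 8 * s" using r_bounds by simp
        finally show ?thesis using mu_bounds by (intro mult_right_mono) auto
      qed
      finally have "(1 - mu) * M \<le> 8 * s * mu * M" using M by (intro mult_right_mono) auto
      then show ?thesis by (simp add: algebra_simps)
    qed
    then have "(a + 1) * (M - mu * M) \<le> (2 / s\<^sup>2 + 1) * (8 * s * (mu * M))"
      using a mu_bounds M by (intro mult_mono) (auto simp: mult_le_cancel_right1)
    moreover have "barrier_op W n \<le> (a + 1) * (M - mu * M)"
    proof -
      have "0 \<le> m / gam * (W (n - 1) + 2 * W n + W (n + 1))"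
        using m_pos gam_pos W_bounds(1)[of "n - 1"] W_bounds(1)[of n] W_bounds(1)[of "n + 1"] by simp
      then show ?thesis unfolding disc_op_def Wn a_def by simp
    qed
    moreover have "(2 / s\<^sup>2 + 1) * (8 * s * (mu * M)) = (16 / s + 8 * s) * mu ^ n"
      using s_pos n_pos by (simp add: M_def power_eq_if[of mu n] field_simps power2_eq_square)
    ultimately show ?thesis by linarith
  qed
  show ?thesis
  proof (cases "i = n")
    case False
    then have "i = N - n" using assms N_eq by auto
    then show ?thesis using base barrier_op_sym[of W n] W_sym n_pos N_eq by auto
  qed (use base in auto)
qed

lemma barrier_interior:
  assumes "n < i" "i < 3 * n"
  shows "barrier_op W i \<le> 0"
proof -
  have "W (i - 1) = mu ^ n" "W i = mu ^ n" "W (i + 1) = mu ^ n"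
    using assms by (auto intro!: W_mid)
  moreover have "0 \<le> m / gam * (4 * mu ^ n)" using m_pos gam_pos mu_bounds by simp
  ultimately show ?thesis by (simp add: disc_op_def)
qed

text \<open>The exponent \<open>2 * r * n\<close> equals \<open>3 / 8 * kap * N * tanh s\<close>,
  which is \<open>3 / 2 * L\<close> up to a loss of at most \<open>24 / kap\<close>. Thus
  \<open>mu ^ n\<close> is O(N powr (-3/2)), and \<open>L / sqrt N\<close> remains, which is at most
  2.\<close>

lemma mu_power_le: "real N * L * mu ^ n \<le> 2 * exp (24 / kap)"
proof -
  have "mu ^ n \<le> exp (- 2 * r) ^ n"
    unfolding mu_def using moebius_le_exp[of r] r_bounds by (intro power_mono) auto
  also have "\<dots> = exp (real n * (- 2 * r))" by (rule exp_of_nat_mult[symmetric])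
  also have "\<dots> \<le> exp (24 / kap - 3 / 2 * L)"
  proof -
    have "kap * real N * s = 4 * L" using kap_bounds N_pos by (simp add: s_eq)
    then have "3 / 8 * (kap * real N) * (s - s\<^sup>2) = 3 / 2 * L - 3 / 2 * (L * s)"
      by (simp add: power2_eq_square algebra_simps)
    moreover have "3 / 8 * (kap * real N) * (s - s\<^sup>2) \<le> 3 / 8 * (kap * real N) * tanh s"
      using tanh_ge_quadratic[of s] s_pos kap_bounds by (intro mult_left_mono) auto
    moreover have "real n * (2 * r) = 3 / 8 * (kap * real N) * tanh s" by (simp add: r_def N_real)
    moreover have "L * s \<le> 16 / kap"
    proof -
      have "L * s = 4 / kap * (L\<^sup>2 / real N)" by (simp add: s_eq power2_eq_square)
      also have "\<dots> \<le> 4 / kap * 4"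
        using L_square_le N_pos kap_bounds by (intro mult_left_mono) (auto simp: divide_le_eq)
      finally show ?thesis by simp
    qed
    ultimately have "real n * (- 2 * r) \<le> 24 / kap - 3 / 2 * L" by simp
    then show ?thesis by simp
  qed
  finally have "real N * L * mu ^ n \<le> real N * L * exp (24 / kap - 3 / 2 * L)"
    using L_gt_1 by (intro mult_left_mono) auto
  also have "\<dots> = exp (24 / kap) * (L * exp (- (L / 2)))"
  proof -
    have "24 / kap - 3 / 2 * L = 24 / kap + (- L + - (L / 2))" by simp
    then have "exp (24 / kap - 3 / 2 * L) = exp (24 / kap) * (exp (- L) * exp (- (L / 2)))"
      by (simp only: exp_add)
    then show ?thesis using N_pos by (simp add: exp_minus exp_L)
  qed
  also have "\<dots> \<le> exp (24 / kap) * 2"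
  proof (rule mult_left_mono)
    have "L / 2 \<le> exp (L / 2)" using exp_ge_add_one_self[of "L / 2"] by linarith
    then show "L * exp (- (L / 2)) \<le> 2" by (simp add: exp_minus field_simps)
  qed simp
  finally show ?thesis by simp
qed

text \<open>As \<open>1 / s\<close> is of order \<open>N / L\<close>, the left side is of order
  \<open>N * L * mu ^ n\<close>, exactly what the preceding bound controls.\<close>

lemma transition_le: "L\<^sup>2 * ((16 / s + 8 * s) * mu ^ n) \<le> (4 + 128 / kap) * (2 * exp (24 / kap))"
proof -
  have "L\<^sup>2 * (16 / s + 8 * s) = 4 * kap * real N * L + 8 * (L * s) * L"
    using L_gt_1 kap_bounds by (simp add: s_eq field_simps power2_eq_square)
  also have "\<dots> \<le> (4 + 128 / kap) * (real N * L)"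
  proof -
    have "L * s = 4 / kap * (L\<^sup>2 / real N)" by (simp add: s_eq power2_eq_square)
    also have "\<dots> \<le> 4 / kap * 4"
      using L_square_le N_pos kap_bounds by (intro mult_left_mono) (auto simp: divide_le_eq)
    finally have "8 * (L * s) * L \<le> 128 / kap * L" using L_gt_1 by (intro mult_right_mono) auto
    also have "\<dots> \<le> 128 / kap * (real N * L)"
      using L_gt_1 kap_bounds N_ge by (intro mult_left_mono) auto
    finally have "8 * (L * s) * L \<le> 128 / kap * (real N * L)" .
    moreover have "kap * (real N * L) \<le> 1 * (real N * L)"
      using kap_bounds L_gt_1 by (intro mult_right_mono) auto
    ultimately show ?thesis by (simp add: distrib_right)
  qed
  finally have "L\<^sup>2 * (16 / s + 8 * s) * mu ^ n \<le> (4 + 128 / kap) * (real N * L) * mu ^ n"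
    using mu_bounds by (intro mult_right_mono) auto
  also have "\<dots> = (4 + 128 / kap) * (real N * L * mu ^ n)" by simp
  also have "\<dots> \<le> (4 + 128 / kap) * (2 * exp (24 / kap))"
    using mu_power_le kap_bounds by (intro mult_left_mono) auto
  finally show ?thesis by (simp add: mult.assoc)
qed

end

section \<open>Error analysis\<close>

lemma disc_op_affine:
  "disc_op b hl hr (a + c * u) (a + c * v) (a + c * w) = c * disc_op b hl hr u v w"
  by (simp add: disc_op_def algebra_simps)

lemma disc_op_diff:
  "disc_op b hl hr (u - u') (v - v') (w - w') = disc_op b hl hr u v w - disc_op b hl hr u' v' w'"
  by (simp add: disc_op_def algebra_simps)

context shishkin_mesh
begin

abbreviation beta :: real where "beta \<equiv> sqrt gam / eps"

lemma beta_pos: "0 < beta" using gam_pos eps_pos by simp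

lemma scheme_disc_op:
  assumes i: "0 < i" "i < N"
    and scheme: "gam / (Ddm gam m eps N i + Ddm gam m eps N (i+1)) *
          ((3 * am gam m eps N i + dm gam m eps N i + Ddm gam m eps N (i+1)) * (u - v)
           - (3 * am gam m eps N (i+1) + dm gam m eps N (i+1) + Ddm gam m eps N i) * (v - w)
           - F / gam * (Ddm gam m eps N i + Ddm gam m eps N (i+1))) = 0"
  shows "disc_op beta (h (i - 1)) (h i) u v w = F / gam"
proof -
  have hp: "0 < h (i - 1)" "0 < h i" using h_pos i by auto
  define a a' t t' where "a = am gam m eps N i" and "a' = am gam m eps N (i+1)"
    and "t = tanh (beta * h (i - 1) / 2)" and "t' = tanh (beta * h i / 2)"
  have nz: "beta * h (i - 1) \<noteq> 0" "beta * h i \<noteq> 0" using beta_pos hp by auto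
  have D: "Ddm gam m eps N i = t" "Ddm gam m eps N (i+1) = t'"
    unfolding Ddm_def dm_def am_def t_def t'_def
    using coth_minus_csch[OF nz(1)] coth_minus_csch[OF nz(2)] by auto
  have d: "dm gam m eps N i = a + t" "dm gam m eps N (i+1) = a' + t'"
    using D unfolding Ddm_def a_def a'_def by auto
  have tp: "0 < t + t'" using gam_pos eps_pos hp unfolding t_def t'_def by (intro add_pos_pos) auto
  have W: "wgt beta (h (i - 1)) (h i) = 4 * a / (t + t')" "wgt beta (h i) (h (i - 1)) = 4 * a' / (t + t')"
    unfolding wgt_def a_def a'_def am_def t_def t'_def by (simp_all add: add.commute)
  have "gam / (t + t') \<noteq> 0" using tp gam_pos by simp
  with scheme have "(3 * a + (a + t) + t') * (u - v) - (3 * a' + (a' + t') + t) * (v - w)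
      - F / gam * (t + t') = 0"
    unfolding D d a_def[symmetric] a'_def[symmetric] by (simp only: mult_eq_0_iff simp_thms)
  then have "(4 * a + (t + t')) * (u - v) + (4 * a' + (t + t')) * (w - v) = F / gam * (t + t')"
    by (simp add: algebra_simps)
  then have "((4 * a + (t + t')) * (u - v) + (4 * a' + (t + t')) * (w - v)) / (t + t') = F / gam"
    using tp by simp
  moreover have "disc_op beta (h (i - 1)) (h i) u v w
      = ((4 * a + (t + t')) * (u - v) + (4 * a' + (t + t')) * (w - v)) / (t + t')"
  proof -
    have "(4 * a / q + 1) * (u - v) + (4 * a' / q + 1) * (w - v)
        = ((4 * a + q) * (u - v) + (4 * a' + q) * (w - v)) / q" if "q \<noteq> 0" for q
      using that by (simp add: field_simps)
    then show ?thesis unfolding disc_op_def W using tp by simp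
  qed
  ultimately show ?thesis by simp
qed

end

text \<open>All constants depend on \<open>m\<close>, \<open>gam\<close>, \<open>C0\<close> and the constant \<open>K\<close> of the a priori
  estimates only, never on \<open>eps\<close> or \<open>N\<close>.\<close>

definition data_const :: "real \<Rightarrow> real \<Rightarrow> real" where
  "data_const K C0 = K * (C0\<^sup>2 + 2 * exp 8)"

text \<open>338 is \<open>5 * 48 + 49 + 49\<close>, from the mesh variation and two squared steps of
  size \<open>7 / N\<close>; 20 is 16 from the Taylor remainders plus 4 from the averaged right-hand
  side.\<close>

definition coarse_const :: "real \<Rightarrow> real \<Rightarrow> real \<Rightarrow> real" where
  "coarse_const gam K C0 = 338 * K + (4 + 20 / gam + 16 / sqrt gam) * data_const K C0"

text \<open>\<open>64 / m\<close> comes from \<open>h0^2 / eps^2 = 64 / m * L^2 / N^2\<close>; the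
  inner square is that of the bound \<open>4 / kap\<close> on \<open>s\<close>.\<close>

definition fine_const :: "real \<Rightarrow> real \<Rightarrow> real \<Rightarrow> real \<Rightarrow> real" where
  "fine_const m gam K C0 =
     64 / m * (1 + (4 + 2 * (4 / (sqrt m / sqrt gam))\<^sup>2) / gam) * data_const K C0"

definition residual_const :: "real \<Rightarrow> real \<Rightarrow> real \<Rightarrow> real \<Rightarrow> real" where
  "residual_const m gam K C0 = coarse_const gam K C0 + fine_const m gam K C0"

definition decay_const :: "real \<Rightarrow> real \<Rightarrow> real" where
  "decay_const m gam = 2 * exp (24 / (sqrt m / sqrt gam))"

text \<open>The divisor is the gap of the barrier in the layers, so that this multiple of
  \<open>W\<close> outweighs the residual there.\<close>

definition layer_weight :: "real \<Rightarrow> real \<Rightarrow> real \<Rightarrow> real \<Rightarrow> real" where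
  "layer_weight m gam K C0 = residual_const m gam K C0 / (7 / 4 * (m / gam))"

text \<open>The divisor \<open>4 * (m / gam)\<close> is what the operator subtracts for the constant
  function 1. The numerator must pay for the \<open>1 / N^2\<close> part of the residual everywhere
  and for the kink of \<open>W\<close>.\<close>

definition base_weight :: "real \<Rightarrow> real \<Rightarrow> real \<Rightarrow> real \<Rightarrow> real" where
  "base_weight m gam K C0 =
     (residual_const m gam K C0
        + layer_weight m gam K C0 * ((4 + 128 / (sqrt m / sqrt gam)) * decay_const m gam))
       / (4 * (m / gam))"

text \<open>The factor \<open>1 + decay_const\<close> serves both ranges: it dominates
  \<open>W <= 1\<close> in the layers and \<open>L^2 * W <= decay_const\<close> in the
  middle.\<close>

definition error_const :: "real \<Rightarrow> real \<Rightarrow> real \<Rightarrow> real \<Rightarrow> real" where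
  "error_const m gam K C0 = base_weight m gam K C0 + layer_weight m gam K C0 * (1 + decay_const m gam)"

lemma const_pos:
  assumes "0 < m" "0 < gam" "0 < K"
  shows "0 < data_const K C0" "0 < coarse_const gam K C0" "0 < fine_const m gam K C0"
    "0 < residual_const m gam K C0" "0 < decay_const m gam" "0 < layer_weight m gam K C0"
    "0 < base_weight m gam K C0" "0 < error_const m gam K C0"
proof -
  show A: "0 < data_const K C0" using assms by (simp add: data_const_def add_nonneg_pos)
  show C: "0 < coarse_const gam K C0" using assms A
    unfolding coarse_const_def by (auto intro!: add_pos_pos mult_pos_pos divide_pos_pos)
  show F: "0 < fine_const m gam K C0" using assms A
    unfolding fine_const_def by (auto intro!: add_pos_pos mult_pos_pos add_pos_nonneg divide_pos_pos)
  show R: "0 < residual_const m gam K C0" using C F by (simp add: residual_const_def)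
  show D: "0 < decay_const m gam" by (simp add: decay_const_def)
  show L: "0 < layer_weight m gam K C0" using R assms by (simp add: layer_weight_def)
  show B: "0 < base_weight m gam K C0" using R L D assms
    unfolding base_weight_def by (auto intro!: divide_pos_pos add_pos_pos mult_pos_pos)
  show "0 < error_const m gam K C0" using B L D by (simp add: error_const_def add_pos_pos)
qed

locale discretised_problem =
  reaction_term f fx fy fxx fxy fyx fyy m gam + mesh: shishkin_mesh m gam eps N
  for f fx fy fxx fxy fyx fyy :: "real \<times> real \<Rightarrow> real" and m gam eps :: real and N :: nat +
  fixes y y' y'' z z' z'' F' F'' :: "real \<Rightarrow> real" and K C0 :: real
  assumes sol: "bvp_solution f eps y y' y''" and K_pos: "0 < K"
    and eps_small: "eps \<le> C0 / real N"
    and z: "\<And>t. t \<in> {0..1} \<Longrightarrow> (z has_real_derivative z' t) (at t within {0..1})"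
      "\<And>t. t \<in> {0..1} \<Longrightarrow> (z' has_real_derivative z'' t) (at t within {0..1})"
      "\<And>t. t \<in> {0..1} \<Longrightarrow> \<bar>z' t\<bar> \<le> K \<and> \<bar>z'' t\<bar> \<le> K"
    and est: "\<And>t. t \<in> {0..1} \<Longrightarrow> \<bar>y t - z t\<bar> \<le> K * (eps\<^sup>2 + layer m eps t) \<and>
       \<bar>f (t, y t)\<bar> \<le> K * (eps\<^sup>2 + layer m eps t) \<and>
       \<bar>y' t\<bar> \<le> K * (1 + layer m eps t / eps)"
    and F: "\<And>t. t \<in> {0..1} \<Longrightarrow> ((\<lambda>t. f (t, y t)) has_real_derivative F' t) (at t within {0..1})"
      "\<And>t. t \<in> {0..1} \<Longrightarrow> (F' has_real_derivative F'' t) (at t within {0..1})"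
      "\<And>t. t \<in> {0..1} \<Longrightarrow> eps\<^sup>2 * \<bar>F'' t\<bar> \<le> K * (eps\<^sup>2 + layer m eps t)"
begin

abbreviation A0 :: real where "A0 \<equiv> data_const K C0"
abbreviation T1 :: real where "T1 \<equiv> coarse_const gam K C0"
abbreviation T2 :: real where "T2 \<equiv> fine_const m gam K C0"

section \<open>The residual of the exact solution\<close>

definition residual :: "nat \<Rightarrow> real" where
  "residual i = disc_op mesh.beta (mesh.h (i - 1)) (mesh.h i)
      (y (mesh.x (i - 1))) (y (mesh.x i)) (y (mesh.x (i + 1)))
    - (f (mesh.x (i - 1), y (mesh.x (i - 1))) + 2 * f (mesh.x i, y (mesh.x i))
        + f (mesh.x (i + 1), y (mesh.x (i + 1)))) / gam"

lemma A0_pos: "0 < A0" using const_pos m_pos gam_pos K_pos by blast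

lemma eps_square_le: "eps\<^sup>2 \<le> C0\<^sup>2 / (real N)\<^sup>2"
proof -
  have "eps\<^sup>2 \<le> (C0 / real N)\<^sup>2" using eps_small mesh.eps_pos by (intro power_mono) auto
  then show ?thesis by (simp add: power_divide)
qed

lemma y_derivs:
  assumes "t \<in> {0..1}"
  shows "(y has_real_derivative y' t) (at t within {0..1})"
    "(y' has_real_derivative y'' t) (at t within {0..1})" "eps\<^sup>2 * y'' t = f (t, y t)"
  using sol assms unfolding bvp_solution_def by auto

text \<open>Operator value and averaged right-hand side are estimated separately, each being O(1 /
  N^2); \<open>eps <= C0 / N\<close> takes care of the \<open>eps^2\<close> in the a priori
  bounds.\<close>

lemma coarse_residual:
  assumes i: "mesh.n \<le> i" "i \<le> 3 * mesh.n"
  shows "\<bar>residual i\<bar> \<le> T1 / (real N)\<^sup>2"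
proof -
  have iN: "0 < i" "i < N" using i mesh.n_pos mesh.N_eq by auto
  define A where "A = A0 / (real N)\<^sup>2"
  define x hl hr where "x = mesh.x i" and "hl = mesh.h (i - 1)" and "hr = mesh.h i"
  have xs: "mesh.x (i - 1) = x - hl" "mesh.x (i + 1) = x + hr"
    using mesh.x_pred[OF iN(1)] mesh.x_succ[of i] by (auto simp: x_def hl_def hr_def)
  have hp: "0 < hl" "0 < hr" "hl \<le> 7 / real N" "hr \<le> 7 / real N"
    using mesh.h_pos mesh.h_le iN by (auto simp: hl_def hr_def)
  have sub: "{x - hl..x + hr} \<subseteq> {0..1}"
    using mesh.x_01[of "i - 1"] mesh.x_01[of "i + 1"] iN xs by auto
  have A: "K * (eps\<^sup>2 + layer m eps t) \<le> A" if "t \<in> {x - hl..x + hr}" for t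
  proof -
    have "layer m eps t \<le> 2 * exp 8 / (real N)\<^sup>2"
      using mesh.x_stencil_coarse[OF i] that xs by (intro mesh.layer_coarse) auto
    then have "eps\<^sup>2 + layer m eps t \<le> (C0\<^sup>2 + 2 * exp 8) / (real N)\<^sup>2"
      using eps_square_le by (simp add: add_divide_distrib)
    then have "K * (eps\<^sup>2 + layer m eps t) \<le> K * ((C0\<^sup>2 + 2 * exp 8) / (real N)\<^sup>2)"
      using K_pos by (intro mult_left_mono) auto
    then show ?thesis by (simp add: A_def data_const_def)
  qed
  have pts: "x - hl \<in> {x - hl..x + hr}" "x \<in> {x - hl..x + hr}" "x + hr \<in> {x - hl..x + hr}"
    using hp by auto
  have fb: "\<bar>f (t, y t)\<bar> \<le> A" if "t \<in> {x - hl..x + hr}" for t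
    using est[of t] A[OF that] that sub by fastforce
  have "\<bar>disc_op mesh.beta hl hr (y (x - hl)) (y x) (y (x + hr))\<bar>
      \<le> K * (5 * \<bar>hr - hl\<bar> + hl\<^sup>2 + hr\<^sup>2) + (4 + 16 / gam + 16 / sqrt gam) * A"
  proof (rule coarse_consistency[where y' = y' and y'' = y'' and z = z and z' = z' and z'' = z''])
    fix t assume t: "t \<in> {x - hl..x + hr}"
    then have t01: "t \<in> {0..1}" using sub by blast
    show "(y has_real_derivative y' t) (at t within {x - hl..x + hr})"
      "(y' has_real_derivative y'' t) (at t within {x - hl..x + hr})"
      "(z has_real_derivative z' t) (at t within {x - hl..x + hr})"
      "(z' has_real_derivative z'' t) (at t within {x - hl..x + hr})"
      using y_derivs[OF t01] z(1,2)[OF t01] DERIV_subset[OF _ sub] by blast+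
    have "eps\<^sup>2 * \<bar>y'' t\<bar> = \<bar>f (t, y t)\<bar>"
      using y_derivs(3)[OF t01] abs_mult[of "eps\<^sup>2" "y'' t"] by simp
    then show "eps\<^sup>2 * \<bar>y'' t\<bar> \<le> A" using fb[OF t] by simp
    show "\<bar>z' t\<bar> \<le> K \<and> \<bar>z'' t\<bar> \<le> K" by (rule z(3)[OF t01])
    show "\<bar>y t - z t\<bar> \<le> A" using est[OF t01] A[OF t] by linarith
  next
    have "\<bar>y' x\<bar> \<le> K + K * layer m eps x / eps" using est[of x] pts(2) sub by (auto simp: distrib_left)
    also have "K * layer m eps x / eps \<le> A / eps"
    proof (rule divide_right_mono)
      have "K * layer m eps x \<le> K * (eps\<^sup>2 + layer m eps x)" using K_pos by (intro mult_left_mono) auto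
      then show "K * layer m eps x \<le> A" using A[OF pts(2)] by linarith
    qed (use mesh.eps_pos in simp)
    finally show "\<bar>y' x\<bar> \<le> K + A / eps" by simp
  qed (use hp mesh.eps_pos gam_pos in auto)
  moreover have "K * (5 * \<bar>hr - hl\<bar> + hl\<^sup>2 + hr\<^sup>2) \<le> 338 * K / (real N)\<^sup>2"
  proof -
    have "hl\<^sup>2 \<le> (7 / real N)\<^sup>2" "hr\<^sup>2 \<le> (7 / real N)\<^sup>2" using hp by (auto intro!: power_mono)
    moreover have "\<bar>hr - hl\<bar> \<le> 48 / (real N)\<^sup>2" using mesh.h_diff[OF i] by (simp add: hl_def hr_def)
    ultimately have "5 * \<bar>hr - hl\<bar> + hl\<^sup>2 + hr\<^sup>2 \<le> 338 / (real N)\<^sup>2" by (simp add: power_divide)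
    then have "K * (5 * \<bar>hr - hl\<bar> + hl\<^sup>2 + hr\<^sup>2) \<le> K * (338 / (real N)\<^sup>2)"
      using K_pos by (intro mult_left_mono) auto
    then show ?thesis by (simp add: mult.commute)
  qed
  moreover have "\<bar>(f (x - hl, y (x - hl)) + 2 * f (x, y x) + f (x + hr, y (x + hr))) / gam\<bar> \<le> 4 * A / gam"
  proof -
    have "\<bar>f (x - hl, y (x - hl)) + 2 * f (x, y x) + f (x + hr, y (x + hr))\<bar> \<le> 4 * A"
      using fb[OF pts(1)] fb[OF pts(2)] fb[OF pts(3)] by linarith
    then show ?thesis using gam_pos by (simp add: abs_divide divide_right_mono)
  qed
  ultimately have "\<bar>residual i\<bar> \<le> 338 * K / (real N)\<^sup>2 + (4 + 16 / gam + 16 / sqrt gam) * A + 4 * A / gam"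
    unfolding residual_def xs x_def[symmetric] hl_def[symmetric] hr_def[symmetric] by linarith
  also have "\<dots> = 338 * K / (real N)\<^sup>2 + (4 + 20 / gam + 16 / sqrt gam) * A"
    by (simp add: algebra_simps add_divide_distrib)
  also have "\<dots> = T1 / (real N)\<^sup>2" by (simp add: coarse_const_def A_def add_divide_distrib)
  finally show ?thesis .
qed

lemma fine_residual:
  assumes i: "0 < i" "i < N" "i < mesh.n \<or> 3 * mesh.n < i"
  shows "\<bar>residual i\<bar> \<le> T2 / (real N)\<^sup>2 + T2 * mesh.L\<^sup>2 / (real N)\<^sup>2 * mesh.W i"
proof -
  define x h where "x = mesh.x i" and "h = mesh.h0"
  have hs: "mesh.h (i - 1) = h" "mesh.h i = h" using i by (auto simp: h_def intro!: mesh.h_outer)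
  have xs: "mesh.x (i - 1) = x - h" "mesh.x (i + 1) = x + h"
    using mesh.x_pred[OF i(1)] mesh.x_succ[of i] hs by (auto simp: x_def)
  have hp: "0 < h" using mesh.h0_pos by (simp add: h_def)
  have sub: "{x - h..x + h} \<subseteq> {0..1}"
    using mesh.x_01[of "i - 1"] mesh.x_01[of "i + 1"] i xs by auto
  have Np: "0 < real N" using mesh.N_pos by simp
  define A where "A = K * (eps\<^sup>2 + exp 8 * layer m eps x)"
  have A: "K * (eps\<^sup>2 + layer m eps t) \<le> A" if t: "t \<in> {x - h..x + h}" for t
  proof -
    have "layer m eps t \<le> exp (sqrt m * h / eps) * layer m eps x"
      using t m_pos mesh.eps_pos by (intro layer_shift) auto
    also have "\<dots> \<le> exp 8 * layer m eps x"
      using mesh.h0_scaled_le layer_pos[of m eps x] by (intro mult_right_mono) (auto simp: h_def)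
    finally show ?thesis unfolding A_def using K_pos by (intro mult_left_mono) auto
  qed
  have pts: "x - h \<in> {x - h..x + h}" "x \<in> {x - h..x + h}" "x + h \<in> {x - h..x + h}"
    using hp by auto
  \<comment> \<open>Writing the second derivative through the equation makes \<open>F'\<close> and
    \<open>F''\<close>, divided by \<open>eps^2\<close>, the third and fourth derivatives of
    \<open>y\<close>.\<close>
  define y2 where "y2 = (\<lambda>t. f (t, y t) / eps\<^sup>2)"
  have e2: "eps\<^sup>2 \<noteq> 0" using mesh.eps_pos by simp
  have "\<bar>disc_op mesh.beta h h (y (x - h)) (y x) (y (x + h))
        - eps\<^sup>2 / gam * (y2 (x - h) + 2 * y2 x + y2 (x + h))\<bar>
      \<le> h\<^sup>2 / eps\<^sup>2 * (1 + (4 + 2 * (mesh.beta * h / 2)\<^sup>2) / gam) * A"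
  proof (rule fine_consistency[where ?y1.0 = y' and ?y3.0 = "\<lambda>t. F' t / eps\<^sup>2" and ?y4.0 = "\<lambda>t. F'' t / eps\<^sup>2"])
    fix t assume t: "t \<in> {x - h..x + h}"
    then have t01: "t \<in> {0..1}" using sub by blast
    have "y'' t = y2 t" using y_derivs(3)[OF t01] e2 by (simp add: y2_def field_simps)
    then show "(y has_real_derivative y' t) (at t within {x - h..x + h})"
      "(y' has_real_derivative y2 t) (at t within {x - h..x + h})"
      "(y2 has_real_derivative F' t / eps\<^sup>2) (at t within {x - h..x + h})"
      "((\<lambda>t. F' t / eps\<^sup>2) has_real_derivative F'' t / eps\<^sup>2) (at t within {x - h..x + h})"
      using DERIV_subset[OF y_derivs(1)[OF t01] sub] DERIV_subset[OF y_derivs(2)[OF t01] sub]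
        DERIV_cdivide[OF DERIV_subset[OF F(1)[OF t01] sub], of "eps\<^sup>2"]
        DERIV_cdivide[OF DERIV_subset[OF F(2)[OF t01] sub], of "eps\<^sup>2"]
      unfolding y2_def by simp_all
    have "eps ^ 4 * \<bar>F'' t / eps\<^sup>2\<bar> = eps\<^sup>2 * \<bar>F'' t\<bar>"
      using e2 by (simp add: abs_divide power4_eq_xxxx power2_eq_square)
    then show "eps ^ 4 * \<bar>F'' t / eps\<^sup>2\<bar> \<le> A" using F(3)[OF t01] A[OF t] by linarith
  next
    have "eps\<^sup>2 * \<bar>y2 x\<bar> = \<bar>f (x, y x)\<bar>" using e2 by (simp add: y2_def abs_divide)
    then show "eps\<^sup>2 * \<bar>y2 x\<bar> \<le> A" using est[of x] A[OF pts(2)] pts(2) sub by fastforce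
  qed (use gam_pos mesh.eps_pos hp in auto)
  also have "eps\<^sup>2 / gam * (y2 (x - h) + 2 * y2 x + y2 (x + h))
      = (f (x - h, y (x - h)) + 2 * f (x, y x) + f (x + h, y (x + h))) / gam"
  proof -
    have "eps\<^sup>2 * y2 t = f (t, y t)" for t using e2 by (simp add: y2_def)
    then have "eps\<^sup>2 * (y2 (x - h) + 2 * y2 x + y2 (x + h))
        = f (x - h, y (x - h)) + 2 * f (x, y x) + f (x + h, y (x + h))"
      by (simp only: distrib_left mult.left_commute[of "eps\<^sup>2" 2])
    then show ?thesis by simp
  qed
  finally have res: "\<bar>residual i\<bar> \<le> h\<^sup>2 / eps\<^sup>2 * (1 + (4 + 2 * (mesh.beta * h / 2)\<^sup>2) / gam) * A"
    unfolding residual_def hs xs x_def[symmetric] .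
  define G where "G = 1 + (4 + 2 * (4 / mesh.kap)\<^sup>2) / gam"
  have G0: "0 \<le> G" using gam_pos by (simp add: G_def add_nonneg_nonneg)
  have G: "1 + (4 + 2 * (mesh.beta * h / 2)\<^sup>2) / gam \<le> G"
  proof -
    have "(mesh.beta * h / 2)\<^sup>2 \<le> (4 / mesh.kap)\<^sup>2"
      using mesh.s_le mesh.s_pos unfolding mesh.s_def h_def by (intro power_mono) auto
    then show ?thesis unfolding G_def using gam_pos by (intro add_left_mono divide_right_mono) auto
  qed
  have hh: "h\<^sup>2 / eps\<^sup>2 = 64 / m * (mesh.L\<^sup>2 / (real N)\<^sup>2)"
    using m_pos e2 by (simp add: h_def mesh.h0_eq power_divide power_mult_distrib)
  have Ab: "A \<le> A0 * (1 / (real N)\<^sup>2 + mesh.W i)"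
  proof -
    have lay: "layer m eps x \<le> mesh.W i + 1 / (real N)\<^sup>2"
      unfolding x_def using i by (intro mesh.layer_fine) auto
    have "exp 8 * layer m eps x \<le> (2 * exp 8) * (mesh.W i + 1 / (real N)\<^sup>2)"
      using lay layer_pos[of m eps x] by (intro mult_mono) auto
    moreover have "C0\<^sup>2 / (real N)\<^sup>2 \<le> C0\<^sup>2 * (1 / (real N)\<^sup>2 + mesh.W i)"
      using mesh.W_bounds(1)[of i] by (simp add: distrib_left)
    ultimately have "eps\<^sup>2 + exp 8 * layer m eps x \<le> (C0\<^sup>2 + 2 * exp 8) * (1 / (real N)\<^sup>2 + mesh.W i)"
      using eps_square_le unfolding distrib_right[of "C0\<^sup>2"] by (simp only: add.commute)
    then have "A \<le> K * ((C0\<^sup>2 + 2 * exp 8) * (1 / (real N)\<^sup>2 + mesh.W i))"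
      unfolding A_def using K_pos by (intro mult_left_mono) auto
    then show ?thesis by (simp add: data_const_def mult.assoc)
  qed
  \<comment> \<open>Lets the product of \<open>L^2 / N^2\<close> with the summand
    \<open>1 / N^2\<close> be absorbed into \<open>1 / N^2\<close> without a logarithm.\<close>
  have Q1: "mesh.L\<^sup>2 / (real N)\<^sup>2 \<le> 1"
    using mesh.L_le_N mesh.L_gt_1 Np by (simp add: divide_le_eq_1 power_mono)
  have A_nn: "0 \<le> A" using K_pos layer_pos[of m eps x] by (auto simp: A_def intro!: mult_nonneg_nonneg add_nonneg_nonneg)
  note res
  also have "h\<^sup>2 / eps\<^sup>2 * (1 + (4 + 2 * (mesh.beta * h / 2)\<^sup>2) / gam) * A
      \<le> h\<^sup>2 / eps\<^sup>2 * G * (A0 * (1 / (real N)\<^sup>2 + mesh.W i))"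
    using G Ab G0 A_nn by (intro mult_mono mult_left_mono) auto
  also have "\<dots> = 64 / m * G * A0 * (mesh.L\<^sup>2 / (real N)\<^sup>2 * (1 / (real N)\<^sup>2) + mesh.L\<^sup>2 / (real N)\<^sup>2 * mesh.W i)"
    unfolding hh by (simp only: mult_ac distrib_left)
  also have "\<dots> \<le> 64 / m * G * A0 * (1 * (1 / (real N)\<^sup>2) + mesh.L\<^sup>2 / (real N)\<^sup>2 * mesh.W i)"
    using Q1 G0 A0_pos m_pos by (intro mult_left_mono add_right_mono mult_right_mono) auto
  also have "64 / m * G * A0 = T2" by (simp add: fine_const_def G_def mesh.kap_def)
  finally show ?thesis by (simp add: distrib_left)
qed

text \<open>The multiple \<open>K2\<close> of \<open>W\<close> is dictated by the residual in the
  layers; \<open>K1\<close> is then large enough for the remaining residual and for the damage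
  \<open>K2 * W\<close> does at the transition nodes.\<close>

lemma error_bound:
  fixes yb :: "nat \<Rightarrow> real"
  assumes yb: "yb 0 = 0" "yb N = 0"
    and scheme: "\<And>i. 0 < i \<Longrightarrow> i < N \<Longrightarrow>
      disc_op mesh.beta (mesh.h (i - 1)) (mesh.h i) (yb (i - 1)) (yb i) (yb (i + 1))
        = (f (mesh.x (i - 1), yb (i - 1)) + 2 * f (mesh.x i, yb i) + f (mesh.x (i + 1), yb (i + 1))) / gam"
    and iN: "i \<le> N"
  shows "\<bar>y (mesh.x i) - yb i\<bar> \<le> error_const m gam K C0 * mesh.L\<^sup>2 / (real N)\<^sup>2"
    and "mesh.n \<le> i \<Longrightarrow> i \<le> 3 * mesh.n \<Longrightarrow> \<bar>y (mesh.x i) - yb i\<bar> \<le> error_const m gam K C0 / (real N)\<^sup>2"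
proof -
  define kap T P K1 K2 where "kap = sqrt m / sqrt gam" and "T = residual_const m gam K C0"
    and "P = decay_const m gam" and "K1 = base_weight m gam K C0" and "K2 = layer_weight m gam K C0"
  have C_eq: "error_const m gam K C0 = K1 + K2 * (1 + P)"
    by (simp add: error_const_def K1_def K2_def P_def)
  have P_eq: "P = 2 * exp (24 / kap)" by (simp add: P_def decay_const_def kap_def)
  define e where "e = (\<lambda>i. y (mesh.x i) - yb i)"
  define Q where "Q = mesh.L\<^sup>2 / (real N)\<^sup>2"
  define w where "w = (\<lambda>i. K1 / (real N)\<^sup>2 + K2 * Q * mesh.W i)"
  define tau where "tau = (\<lambda>i. T / (real N)\<^sup>2
      + (if i < mesh.n \<or> 3 * mesh.n < i then T * Q * mesh.W i else 0))"
  have kap: "kap = mesh.kap" by (simp add: kap_def mesh.kap_def)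
  note pos = const_pos[OF m_pos gam_pos K_pos]
  have T: "0 < T" "T1 \<le> T" "T2 \<le> T" 
    using pos(4)[of C0] pos(2)[of C0] pos(3)[of C0] by (auto simp: T_def residual_const_def)
  have P: "0 < P" and K2: "0 < K2" and K1: "0 < K1" using pos by (auto simp: P_def K1_def K2_def)
  have kp: "0 < kap" using mesh.kap_bounds kap by simp
  have Q: "0 \<le> Q" by (simp add: Q_def)
  have K2_eq: "K2 * (7 / 4 * (m / gam)) = T"
    using m_pos gam_pos by (simp add: K2_def layer_weight_def T_def)
  have K1_eq: "K1 * (4 * (m / gam)) = T + K2 * ((4 + 128 / kap) * P)" 
    using m_pos gam_pos by (simp add: K1_def base_weight_def T_def K2_def P_def kap_def)
  have "\<exists>c. m \<le> c \<and> c \<le> gam \<and> f (mesh.x j, y (mesh.x j)) - f (mesh.x j, yb j) = c * e j" if "j \<le> N" for j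
    using difference_quotient[OF mesh.x_01[OF that]] unfolding e_def by metis
  then obtain c where c: "\<And>j. j \<le> N \<Longrightarrow> m \<le> c j \<and> c j \<le> gam"
    and ce: "\<And>j. j \<le> N \<Longrightarrow> f (mesh.x j, y (mesh.x j)) - f (mesh.x j, yb j) = c j * e j"
    by metis
  have main: "\<bar>e i\<bar> \<le> w i"
  proof (rule discrete_comparison[OF mesh.beta_pos m_pos mesh.h_pos c _ _ _ _ _ iN])
    show "0 \<le> w j" for j
      unfolding w_def using K1 K2 Q mesh.W_bounds(1)[of j]
      by (intro add_nonneg_nonneg mult_nonneg_nonneg divide_nonneg_nonneg) auto
    show "e 0 = 0" "e N = 0" using sol yb unfolding e_def bvp_solution_def by (auto simp: mesh.x_0 mesh.x_N)
  next
    fix j assume j: "0 < j" "j < N"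
    have "disc_op mesh.beta (mesh.h (j - 1)) (mesh.h j) (e (j - 1)) (e j) (e (j + 1))
        - (c (j - 1) * e (j - 1) + 2 * (c j * e j) + c (j + 1) * e (j + 1)) / gam = residual j"
    proof -
      have d: "disc_op mesh.beta (mesh.h (j - 1)) (mesh.h j) (e (j - 1)) (e j) (e (j + 1))
          = disc_op mesh.beta (mesh.h (j - 1)) (mesh.h j) (y (mesh.x (j - 1))) (y (mesh.x j)) (y (mesh.x (j + 1)))
          - (f (mesh.x (j - 1), yb (j - 1)) + 2 * f (mesh.x j, yb j) + f (mesh.x (j + 1), yb (j + 1))) / gam"
        unfolding e_def disc_op_diff scheme[OF j] ..
      have "j - 1 \<le> N" "j \<le> N" "j + 1 \<le> N" using j by auto
      from this[THEN ce] have "f (mesh.x (j - 1), y (mesh.x (j - 1))) + 2 * f (mesh.x j, y (mesh.x j))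
            + f (mesh.x (j + 1), y (mesh.x (j + 1)))
          = (f (mesh.x (j - 1), yb (j - 1)) + 2 * f (mesh.x j, yb j) + f (mesh.x (j + 1), yb (j + 1)))
            + (c (j - 1) * e (j - 1) + 2 * (c j * e j) + c (j + 1) * e (j + 1))"
        by linarith
      then show ?thesis unfolding residual_def d by (simp only: add_divide_distrib)
    qed
    moreover have "\<bar>residual j\<bar> \<le> tau j"
    proof (cases "j < mesh.n \<or> 3 * mesh.n < j")
      case True
      have "\<bar>residual j\<bar> \<le> T2 / (real N)\<^sup>2 + T2 * Q * mesh.W j"
        using fine_residual[OF j True] by (simp add: Q_def)
      also have "\<dots> \<le> T / (real N)\<^sup>2 + T * Q * mesh.W j"
        using T Q mesh.W_bounds(1)[of j] by (intro add_mono divide_right_mono mult_right_mono) auto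
      finally show ?thesis using True by (simp add: tau_def)
    next
      case False
      then have "\<bar>residual j\<bar> \<le> T1 / (real N)\<^sup>2" by (intro coarse_residual) auto
      also have "\<dots> \<le> T / (real N)\<^sup>2" using T by (intro divide_right_mono) auto
      finally show ?thesis using False by (simp add: tau_def)
    qed
    ultimately show "\<bar>disc_op mesh.beta (mesh.h (j - 1)) (mesh.h j) (e (j - 1)) (e j) (e (j + 1))
        - (c (j - 1) * e (j - 1) + 2 * (c j * e j) + c (j + 1) * e (j + 1)) / gam\<bar> \<le> tau j" by simp
    \<comment> \<open>The constant part of \<open>w\<close> contributes only through the reaction
      term, \<open>- 4 * (m / gam) * K1 / N^2\<close>, which \<open>K1_eq\<close> expresses by the
      quantities it has to cover.\<close>
    have eq: "mesh.barrier_op w j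
        = K2 * Q * mesh.barrier_op mesh.W j - (T + K2 * ((4 + 128 / kap) * P)) / (real N)\<^sup>2"
      unfolding w_def disc_op_affine K1_eq[symmetric]
      by (simp add: algebra_simps add_divide_distrib diff_divide_distrib)
    have KP: "0 \<le> K2 * ((4 + 128 / kap) * P) / (real N)\<^sup>2"
      using K2 kp P by (intro divide_nonneg_nonneg mult_nonneg_nonneg add_nonneg_nonneg) auto
    have split: "(T + K2 * ((4 + 128 / kap) * P)) / (real N)\<^sup>2
        = T / (real N)\<^sup>2 + K2 * ((4 + 128 / kap) * P) / (real N)\<^sup>2" by (simp add: add_divide_distrib)
    have KQ: "0 \<le> K2 * Q" using K2 Q by simp
    consider "j < mesh.n \<or> 3 * mesh.n < j" | "j = mesh.n \<or> j = 3 * mesh.n"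
      | "mesh.n < j" "j < 3 * mesh.n" by linarith
    then show "mesh.barrier_op w j \<le> - tau j"
    proof cases
      case 1
      have "K2 * Q * mesh.barrier_op mesh.W j \<le> K2 * Q * (- (7 / 4 * (m / gam)) * mesh.W j)"
        using mesh.barrier_fine[OF j 1] KQ by (intro mult_left_mono) auto
      also have "\<dots> = - (K2 * (7 / 4 * (m / gam))) * Q * mesh.W j" by simp
      also have "\<dots> = - (T * Q * mesh.W j)" unfolding K2_eq by simp
      finally show ?thesis unfolding eq split tau_def using 1 KP by simp
    next
      case 2
      have "K2 * Q * mesh.barrier_op mesh.W j
          \<le> K2 * Q * ((16 / mesh.s + 8 * mesh.s) * mesh.mu ^ mesh.n)"
        using mesh.barrier_transition[OF 2] KQ by (intro mult_left_mono) auto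
      also have "\<dots> = K2 / (real N)\<^sup>2 * (mesh.L\<^sup>2 * ((16 / mesh.s + 8 * mesh.s) * mesh.mu ^ mesh.n))"
        by (simp add: Q_def)
      also have "\<dots> \<le> K2 / (real N)\<^sup>2 * ((4 + 128 / kap) * P)"
        using mesh.transition_le K2 by (intro mult_left_mono) (auto simp: P_eq kap)
      finally show ?thesis unfolding eq split tau_def using 2 mesh.n_pos by auto
    next
      case 3
      have "K2 * Q * mesh.barrier_op mesh.W j \<le> 0"
        using mesh.barrier_interior[OF 3] KQ by (intro mult_nonneg_nonpos) auto
      then show ?thesis unfolding eq split tau_def using 3 KP by simp
    qed
  qed
  have L1: "1 \<le> mesh.L\<^sup>2" using mesh.L_gt_1 by (simp add: one_le_power)
  have "w i \<le> K1 * mesh.L\<^sup>2 / (real N)\<^sup>2 + K2 * (1 + P) * mesh.L\<^sup>2 / (real N)\<^sup>2"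
  proof -
    have "K1 * 1 / (real N)\<^sup>2 \<le> K1 * mesh.L\<^sup>2 / (real N)\<^sup>2"
      using K1 L1 by (intro divide_right_mono mult_left_mono) auto
    moreover have "K2 * Q * mesh.W i \<le> K2 * Q * (1 + P)"
      using K2 Q P mesh.W_bounds[of i] by (intro mult_left_mono) auto
    ultimately show ?thesis by (simp add: w_def Q_def mult_ac)
  qed
  then show "\<bar>y (mesh.x i) - yb i\<bar> \<le> error_const m gam K C0 * mesh.L\<^sup>2 / (real N)\<^sup>2"
    using main unfolding e_def C_eq by (simp add: distrib_right add_divide_distrib)
  assume i: "mesh.n \<le> i" "i \<le> 3 * mesh.n"
  \<comment> \<open>In the middle the logarithms are swallowed by the decay of the barrier, using
    \<open>L <= N\<close>.\<close>
  have "mesh.L\<^sup>2 * mesh.W i \<le> P"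
  proof -
    have "mesh.L\<^sup>2 * mesh.mu ^ mesh.n \<le> real N * mesh.L * mesh.mu ^ mesh.n"
      unfolding power2_eq_square using mesh.mu_bounds mesh.L_le_N mesh.L_gt_1
      by (intro mult_right_mono) auto
    then show ?thesis using mesh.mu_power_le mesh.W_mid[OF i] unfolding P_eq kap by simp
  qed
  then have "K2 * (mesh.L\<^sup>2 * mesh.W i) \<le> K2 * (1 + P)" using K2 by (intro mult_left_mono) auto
  then have "K1 + K2 * (mesh.L\<^sup>2 * mesh.W i) \<le> K1 + K2 * (1 + P)" by simp
  then have "(K1 + K2 * (mesh.L\<^sup>2 * mesh.W i)) / (real N)\<^sup>2 \<le> (K1 + K2 * (1 + P)) / (real N)\<^sup>2"
    by (intro divide_right_mono) auto
  moreover have "w i = (K1 + K2 * (mesh.L\<^sup>2 * mesh.W i)) / (real N)\<^sup>2"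
    by (simp add: w_def Q_def add_divide_distrib mult_ac)
  ultimately show "\<bar>y (mesh.x i) - yb i\<bar> \<le> error_const m gam K C0 / (real N)\<^sup>2"
    using main unfolding e_def C_eq by simp
qed

end

section \<open>Uniform convergence of the scheme\<close>

theorem theorem3:
  fixes f :: "real \<Rightarrow> real \<Rightarrow> real" and k :: nat and m gam C0 :: real
  assumes k2: "k \<ge> 2"
    and fCk: "Ck_on k ({0..1} \<times> UNIV) (\<lambda>(x, v). f x v)"
    and mpos: "m > 0"
    and fy_lower: "\<forall>x\<in>{0..1}. \<forall>v. m \<le> deriv (f x) v"
    and fy_upper: "\<forall>x\<in>{0..1}. \<forall>v. deriv (f x) v \<le> gam"
  shows "\<exists>C>0. \<forall>(eps::real) (N::nat) (y::real \<Rightarrow> real) (yb::nat \<Rightarrow> real).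
     0 < eps \<longrightarrow> eps < 1 \<longrightarrow>
     (\<exists>y' y''. \<forall>x\<in>{0..1}. (y has_real_derivative y' x) (at x within {0..1}) \<and>
                          (y' has_real_derivative y'' x) (at x within {0..1}) \<and>
                          eps^2 * y'' x = f x (y x)) \<longrightarrow>
     y 0 = 0 \<longrightarrow> y 1 = 0 \<longrightarrow>
     0 < N \<longrightarrow> 4 dvd N \<longrightarrow>
     lam_mesh m eps N \<le> q_mesh \<longrightarrow> eps \<le> C0 / real N \<longrightarrow>
     yb 0 = 0 \<longrightarrow> yb N = 0 \<longrightarrow>
     (\<forall>i\<in>{1..N-1}.
        gam / (Ddm gam m eps N i + Ddm gam m eps N (i+1)) *
          ((3 * am gam m eps N i + dm gam m eps N i + Ddm gam m eps N (i+1)) * (yb (i-1) - yb i)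
           - (3 * am gam m eps N (i+1) + dm gam m eps N (i+1) + Ddm gam m eps N i) * (yb i - yb (i+1))
           - (f (xm m eps N (i-1)) (yb (i-1)) + 2 * f (xm m eps N i) (yb i)
               + f (xm m eps N (i+1)) (yb (i+1))) / gam
             * (Ddm gam m eps N i + Ddm gam m eps N (i+1))) = 0) \<longrightarrow>
     (\<forall>i. i < N div 4 \<longrightarrow>
          \<bar>y (xm m eps N i) - yb i\<bar> \<le> C * (ln (real N))^2 / (real N)^2) \<and>
     (\<forall>i. N div 4 \<le> i \<and> i \<le> 3 * N div 4 \<longrightarrow>
          \<bar>y (xm m eps N i) - yb i\<bar> \<le> C / (real N)^2) \<and>
     (\<forall>i. 3 * N div 4 < i \<and> i \<le> N \<longrightarrow>
          \<bar>y (xm m eps N i) - yb i\<bar> \<le> C * (ln (real N))^2 / (real N)^2)"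
proof -
  define g where "g = (\<lambda>(x, v). f x v)"
  have g: "g (x, v) = f x v" for x v by (simp add: g_def)
  have "Ck_on (Suc (Suc 0)) strip g"
    using Ck_on_le[OF _ fCk, of 2] k2 unfolding g_def by (simp only: numeral_2_eq_2)
  then obtain fx fy fxx fxy fyx fyy where
    d: "\<forall>p\<in>strip. (g has_derivative (\<lambda>(u,v). fx p * u + fy p * v)) (at p within strip)"
      "\<forall>p\<in>strip. (fx has_derivative (\<lambda>(u,v). fxx p * u + fxy p * v)) (at p within strip)"
      "\<forall>p\<in>strip. (fy has_derivative (\<lambda>(u,v). fyx p * u + fyy p * v)) (at p within strip)"
    and c: "continuous_on strip fxx" "continuous_on strip fxy" "continuous_on strip fyx" "continuous_on strip fyy"
    unfolding Ck_on.simps by blast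
  have fy: "deriv (f x) v = fy (x, v)" if "x \<in> {0..1}" for x v
  proof -
    have "((\<lambda>t. g (x, t)) has_real_derivative fy (x, v)) (at v)"
      by (rule derivative_along_fibre[OF d(1)[rule_format] that]) (use that in auto)
    then show ?thesis by (simp add: g DERIV_imp_deriv)
  qed
  interpret reaction_term g fx fy fxx fxy fyx fyy m gam
  proof
    fix p :: "real \<times> real" assume p: "p \<in> strip"
    then obtain x v where xv: "p = (x, v)" "x \<in> {0..1}" by auto
    show "m \<le> fy p" "fy p \<le> gam" 
      using fy_lower[rule_format, OF xv(2), of v] fy_upper[rule_format, OF xv(2), of v] fy[OF xv(2), of v]
      by (auto simp: xv(1))
  qed (use d c mpos in auto)
  obtain K z z' z'' where K: "0 < K"
    and z: "\<And>x. x \<in> {0..1} \<Longrightarrow> (z has_real_derivative z' x) (at x within {0..1})"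
      "\<And>x. x \<in> {0..1} \<Longrightarrow> (z' has_real_derivative z'' x) (at x within {0..1})"
      "\<And>x. x \<in> {0..1} \<Longrightarrow> \<bar>z' x\<bar> \<le> K \<and> \<bar>z'' x\<bar> \<le> K"
    and est: "\<And>eps y y' y'' x. 0 < eps \<Longrightarrow> eps < 1 \<Longrightarrow> bvp_solution g eps y y' y'' \<Longrightarrow> x \<in> {0..1} \<Longrightarrow>
       \<bar>y x - z x\<bar> \<le> K * (eps\<^sup>2 + layer m eps x) \<and>
       \<bar>g (x, y x)\<bar> \<le> K * (eps\<^sup>2 + layer m eps x) \<and>
       \<bar>y' x\<bar> \<le> K * (1 + layer m eps x / eps)"
    and F: "\<And>eps y y' y''. 0 < eps \<Longrightarrow> eps < 1 \<Longrightarrow> bvp_solution g eps y y' y'' \<Longrightarrow>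
       \<exists>F' F''. \<forall>x\<in>{0..1}. ((\<lambda>t. g (t, y t)) has_real_derivative F' x) (at x within {0..1}) \<and>
         (F' has_real_derivative F'' x) (at x within {0..1}) \<and>
         eps\<^sup>2 * \<bar>F'' x\<bar> \<le> K * (eps\<^sup>2 + layer m eps x)"
    by (fact a_priori_estimates)
  show ?thesis
  \<comment> \<open>The witness is legitimate because \<open>K\<close> was obtained before
    \<open>eps\<close>, \<open>N\<close>, \<open>y\<close> and \<open>yb\<close> are
    introduced.\<close>
  proof (rule exI[of _ "error_const m gam K C0"], intro conjI[OF const_pos(8)[OF mpos gam_pos K]] allI impI)
    fix eps :: real and N :: nat and y :: "real \<Rightarrow> real" and yb :: "nat \<Rightarrow> real"
    assume eps: "0 < eps" "eps < 1"
      and ode: "\<exists>y' y''. \<forall>x\<in>{0..1}. (y has_real_derivative y' x) (at x within {0..1}) \<and>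
                          (y' has_real_derivative y'' x) (at x within {0..1}) \<and>
                          eps^2 * y'' x = f x (y x)"
      and bc: "y 0 = 0" "y 1 = 0" and N: "0 < N" "4 dvd N"
      and lam: "lam_mesh m eps N \<le> q_mesh" and small: "eps \<le> C0 / real N"
      and yb: "yb 0 = 0" "yb N = 0"
      and scheme: "\<forall>i\<in>{1..N-1}.
        gam / (Ddm gam m eps N i + Ddm gam m eps N (i+1)) *
          ((3 * am gam m eps N i + dm gam m eps N i + Ddm gam m eps N (i+1)) * (yb (i-1) - yb i)
           - (3 * am gam m eps N (i+1) + dm gam m eps N (i+1) + Ddm gam m eps N i) * (yb i - yb (i+1))
           - (f (xm m eps N (i-1)) (yb (i-1)) + 2 * f (xm m eps N i) (yb i)
               + f (xm m eps N (i+1)) (yb (i+1))) / gam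
             * (Ddm gam m eps N i + Ddm gam m eps N (i+1))) = 0"
    obtain y' y'' where sol: "bvp_solution g eps y y' y''"
      using ode bc unfolding bvp_solution_def g by blast
    obtain F' F'' where F': "\<forall>x\<in>{0..1}. ((\<lambda>t. g (t, y t)) has_real_derivative F' x) (at x within {0..1}) \<and>
         (F' has_real_derivative F'' x) (at x within {0..1}) \<and>
         eps\<^sup>2 * \<bar>F'' x\<bar> \<le> K * (eps\<^sup>2 + layer m eps x)"
      using F[OF eps sol] by blast
    have mesh: "shishkin_mesh m gam eps N"
      by unfold_locales (use mpos m_le_gam eps N lam in auto)
    interpret dp: discretised_problem g fx fy fxx fxy fyx fyy m gam eps N y y' y'' z z' z'' F' F'' K C0
    proof (rule discretised_problem.intro[OF reaction_term_axioms mesh])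
      show "discretised_problem_axioms g m eps N y y' y'' z z' z'' F' F'' K C0"
        by unfold_locales (use sol K small z est[OF eps sol] F' in auto)
    qed
    have disc: "disc_op dp.mesh.beta (hm m eps N (i - 1)) (hm m eps N i) (yb (i - 1)) (yb i) (yb (i + 1))
        = (g (xm m eps N (i - 1), yb (i - 1)) + 2 * g (xm m eps N i, yb i) + g (xm m eps N (i + 1), yb (i + 1))) / gam"
      if "0 < i" "i < N" for i
      unfolding g by (rule dp.mesh.scheme_disc_op[OF that]) (use scheme[rule_format, of i] that in auto)
    note bound = dp.error_bound[OF yb disc]
    \<comment> \<open>\<open>3 * N div 4\<close> parses as \<open>(3 * N) div 4\<close>;
      divisibility by 4 makes it exactly \<open>3 * n\<close>, so both transition nodes belong to
      the middle range.\<close>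
    have n: "N div 4 = dp.mesh.n" "3 * N div 4 = 3 * dp.mesh.n"
      using dp.mesh.N_eq by (auto simp: dp.mesh.n_def)
    have left: "\<forall>i. i < N div 4 \<longrightarrow>
        \<bar>y (xm m eps N i) - yb i\<bar> \<le> error_const m gam K C0 * (ln (real N))^2 / (real N)^2" (is ?left)
      using bound(1) unfolding dp.mesh.L_def by (meson div_le_dividend less_imp_le order_trans)
    have mid: "\<forall>i. N div 4 \<le> i \<and> i \<le> 3 * N div 4 \<longrightarrow>
        \<bar>y (xm m eps N i) - yb i\<bar> \<le> error_const m gam K C0 / (real N)^2" (is ?mid)
    proof (intro allI impI)
      fix i assume "N div 4 \<le> i \<and> i \<le> 3 * N div 4"
      then have i: "dp.mesh.n \<le> i" "i \<le> 3 * dp.mesh.n" unfolding n by auto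
      moreover have "i \<le> N" using i dp.mesh.N_eq by linarith
      ultimately show "\<bar>y (xm m eps N i) - yb i\<bar> \<le> error_const m gam K C0 / (real N)^2"
        using bound(2) by blast
    qed
    have right: "\<forall>i. 3 * N div 4 < i \<and> i \<le> N \<longrightarrow>
        \<bar>y (xm m eps N i) - yb i\<bar> \<le> error_const m gam K C0 * (ln (real N))^2 / (real N)^2" (is ?right)
      using bound(1) unfolding dp.mesh.L_def by blast
    show "?left \<and> ?mid \<and> ?right" using left mid right by blast
  qed
qed

end
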